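(* For any $j\in\{0,1\}$, let $\vec{\alpha}^{(j)},\vec{\beta}^{(j)}\in\mathbb{R}^n$ and $\vec{p}^{(j)},\vec{q}^{(j)},\vec{s}^{(j)},\vec{t}^{(j)}\in[1,\infty]^n$. Let $\theta\in[0,1]$, and let $\vec{p},\vec{q},\vec{s},\vec{t}\in[1,\infty]^n$ and $\vec{\alpha},\vec{\beta}\in\mathbb{R}^n$ satisfy (componentwise, with $1/\infty=0$) $$\frac{1}{\vec{p}}=\frac{1-\theta}{\vec{p}^{(0)}}+\frac{\theta}{\vec{p}^{(1)}},\quad \frac{1}{\vec{q}}=\frac{1-\theta}{\vec{q}^{(0)}}+\frac{\theta}{\vec{q}^{(1)}},\quad \frac{1}{\vec{s}}=\frac{1-\theta}{\vec{s}^{(0)}}+\frac{\theta}{\vec{s}^{(1)}},\quad \frac{1}{\vec{t}}=\frac{1-\theta}{\vec{t}^{(0)}}+\frac{\theta}{\vec{t}^{(1)}},$$ $$\vec{\alpha}=(1-\theta)\vec{\alpha}^{(0)}+\theta\vec{\alpha}^{(1)},\qquad \vec{\beta}=(1-\theta)\vec{\beta}^{(0)}+\theta\vec{\beta}^{(1)}.$$ Let $T$ be a linear operator, mapping each $f\in H(\mathbb{R}^n)$ to a sequence $T(f)=\{T(f)(j,\cdot)\}_{j\in\mathbb{Z}}$ of measurable functions on $\mathbb{R}^n$, such that there exist positive constants $M_0$ and $M_1$ satisfying, for any $f\in H(\mathbb{R}^n)$, $$\|T(f)\|_{(\dot{E}^{\vec{\alpha}^{(0)},\vec{p}^{(0)}}_{\vec{q}^{(0)}}(\mathbb{R}^n),l^\infty)}\le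 M_0\|f\|_{\dot{E}^{\vec{\beta}^{(0)},\vec{s}^{(0)}}_{\vec{t}^{(0)}}(\mathbb{R}^n)} \quad\text{and}\quad \|T(f)\|_{(\dot{E}^{\vec{\alpha}^{(1)},\vec{p}^{(1)}}_{\vec{q}^{(1)}}(\mathbb{R}^n),l^\infty)}\le M_1\|f\|_{\dot{E}^{\vec{\beta}^{(1)},\vec{s}^{(1)}}_{\vec{t}^{(1)}}(\mathbb{R}^n)}.$$ Then, for any $f\in H(\mathbb{R}^n)$, $$\|T(f)\|_{(\dot{E}^{\vec{\alpha},\vec{p}}_{\vec{q}}(\mathbb{R}^n),l^\infty)}\le M_0^{1-\theta}M_1^{\theta}\|f\|_{\dot{E}^{\vec{\beta},\vec{s}}_{\vec{t}}(\mathbb{R}^n)}.$$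
   Context: For $k\in\mathbb{Z}$ let $R_k:=(-2^{k},2^{k})\setminus(-2^{k-1},2^{k-1})\subset\mathbb{R}$. For $p,q\in(0,\infty]$, $\alpha\in\mathbb{R}$, and measurable $h$ on $\mathbb{R}$, let $\|h\|_{\dot{K}^{\alpha,p}_{q}(\mathbb{R})}:=[\sum_{k\in\mathbb{Z}}2^{kp\alpha}\|h\mathbf{1}_{R_k}\|_{L^q(\mathbb{R})}^p]^{1/p}$, with the usual modifications when $p=\infty$ or $q=\infty$. For $\vec{p}=(p_1,\ldots,p_n),\vec{q}=(q_1,\ldots,q_n)\in(0,\infty]^n$ and $\vec{\alpha}=(\alpha_1,\ldots,\alpha_n)\in\mathbb{R}^n$, the mixed-norm Herz space $\dot{E}^{\vec{\alpha},\vec{p}}_{\vec{q}}(\mathbb{R}^n)$ is the set of all measurable $f$ on $\mathbb{R}^n$ such that $\|f\|_{\dot{E}^{\vec{\alpha},\vec{p}}_{\vec{q}}(\mathbb{R}^n)}:=\|\cdots\|f\|_{\dot{K}^{\alpha_1,p_1}_{q_1}(\mathbb{R})}\cdots\|_{\dot{K}^{\alpha_n,p_n}_{q_n}(\mathbb{R})}<\infty$, i.e. the norm obtained by taking successively the $\dot{K}^{\alpha_1,p_1}_{q_1}(\mathbb{R})$-norm in $x_1$, ..., and the $\dot{K}^{\alpha_n,p_n}_{q_n}(\mathbb{R})$-norm in $x_n$. For a sequence $f=\{f(j,\cdot)\}_{j\in\mathbb{Z}}$ of measurable functions, $\|f\|_{(\dot{E}^{\vec{\alpha},\vec{p}}_{\vec{q}}(\mathbb{R}^n),l^\infty)}:=\|\sup_{j\in\mathbb{Z}}|f(j,\cdot)|\,\|_{\dot{E}^{\vec{\alpha},\vec{p}}_{\vec{q}}(\mathbb{R}^n)}$.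 For $m\in\mathbb{N}$ let $I_m:=(-2^m,-2^{-m}]\cup[2^{-m},2^m)$ and $A_m:=I_m^n\subset\mathbb{R}^n$. $H(\mathbb{R}^n)$ denotes the class of all simple functions $f=\sum_{k=1}^N a_k\mathbf{1}_{E_k}$, where $N\in\mathbb{N}$, $a_k\in\mathbb{C}$, the sets $E_1,\ldots,E_N$ are pairwise disjoint, and each $E_k$ is contained in $A_m$ for some $m\in\mathbb{N}$ and is of the form $E_k=E_{k_1}\times\cdots\times E_{k_n}$ with measurable $E_{k_i}\subset\mathbb{R}$ for $i\in\{1,\ldots,n\}$. *)

theory Defs
  imports "HOL-Analysis.Analysis" "HOL-Probability.Essential_Supremum"
begin

text \<open>
  Norms take values in \<^typ>\<open>ennreal\<close>, so they are defined for every function and equal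
  \<open>\<infinity>\<close> when the function is not in the space. Exponents in \<open>(0, \<infinity>]\<close> are also of type
  \<^typ>\<open>ennreal\<close>. ``Measurable'' means Lebesgue measurable.
\<close>

text \<open>Real powers on \<open>[0, \<infinity>]\<close>; only meant for \<open>r > 0\<close>.\<close>
definition enn_powr :: "ennreal \<Rightarrow> real \<Rightarrow> ennreal" where
  "enn_powr x r = (if x = \<infinity> then \<infinity> else ennreal (enn2real x powr r))"

definition Lq_norm :: "ennreal \<Rightarrow> (real \<Rightarrow> ennreal) \<Rightarrow> ennreal" where
  "Lq_norm q h =
     (if q = \<infinity> then esssup lebesgue h
      else enn_powr (\<integral>\<^sup>+ t. enn_powr (h t) (enn2real q) \<partial>lebesgue) (1 / enn2real q))"

definition dyadic_ring :: "int \<Rightarrow> real set" where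
  "dyadic_ring k = {- (2 powi k) <..< 2 powi k} - {- (2 powi (k - 1)) <..< 2 powi (k - 1)}"

definition herz_norm :: "real \<Rightarrow> ennreal \<Rightarrow> ennreal \<Rightarrow> (real \<Rightarrow> ennreal) \<Rightarrow> ennreal" where
  "herz_norm \<alpha> p q h =
     (if p = \<infinity>
      then (SUP k::int. ennreal (2 powr (real_of_int k * \<alpha>)) *
                        Lq_norm q (\<lambda>t. h t * indicator (dyadic_ring k) t))
      else enn_powr
             (\<Sum>\<^sub>\<infinity>k::int. ennreal (2 powr (real_of_int k * enn2real p * \<alpha>)) *
                        enn_powr (Lq_norm q (\<lambda>t. h t * indicator (dyadic_ring k) t)) (enn2real p))
             (1 / enn2real p))"

text \<open>
  \<open>\<real>\<^sup>n\<close> is \<^typ>\<open>real ^ 'n\<close> with a linearly ordered finite index type \<open>'n\<close>, whose elements in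
  increasing order play the role of \<open>1, \<dots>, n\<close>. Taking the Herz norm in the \<open>i\<close>-th variable yields a
  function on \<open>\<real>\<^sup>n\<close> that no longer depends on the \<open>i\<close>-th variable.
\<close>
definition coord_herz_norm ::
  "real ^ 'n \<Rightarrow> ennreal ^ 'n \<Rightarrow> ennreal ^ 'n \<Rightarrow> 'n \<Rightarrow> (real ^ 'n \<Rightarrow> ennreal) \<Rightarrow> real ^ 'n \<Rightarrow> ennreal"
  where
  "coord_herz_norm \<alpha> p q i F =
     (\<lambda>x. herz_norm (\<alpha> $ i) (p $ i) (q $ i) (\<lambda>t. F (\<chi> l. if l = i then t else x $ l)))"

text \<open>
  The smallest index is processed first, so it gives the innermost norm. After all variables have
  been processed the function is constant; the evaluation point \<open>0\<close> is immaterial.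
\<close>
definition mixed_herz_norm ::
  "real ^ 'n::{finite,linorder} \<Rightarrow> ennreal ^ 'n::{finite,linorder} \<Rightarrow> ennreal ^ 'n::{finite,linorder} \<Rightarrow> (real ^ 'n::{finite,linorder} \<Rightarrow> ennreal) \<Rightarrow> ennreal"
  where
  "mixed_herz_norm \<alpha> p q F =
     fold (coord_herz_norm \<alpha> p q) (sorted_list_of_set (UNIV :: 'n::{finite,linorder} set)) F 0"

definition E_norm ::
  "real ^ 'n::{finite,linorder} \<Rightarrow> ennreal ^ 'n::{finite,linorder} \<Rightarrow> ennreal ^ 'n::{finite,linorder} \<Rightarrow> (real ^ 'n::{finite,linorder} \<Rightarrow> complex) \<Rightarrow> ennreal"
  where
  "E_norm \<alpha> p q f = mixed_herz_norm \<alpha> p q (\<lambda>x. ennreal (cmod (f x)))"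

definition E_linf_norm ::
  "real ^ 'n::{finite,linorder} \<Rightarrow> ennreal ^ 'n::{finite,linorder} \<Rightarrow> ennreal ^ 'n::{finite,linorder} \<Rightarrow>
   (int \<Rightarrow> real ^ 'n::{finite,linorder} \<Rightarrow> complex) \<Rightarrow> ennreal"
  where
  "E_linf_norm \<alpha> p q f = mixed_herz_norm \<alpha> p q (\<lambda>x. SUP j. ennreal (cmod (f j x)))"

definition I_set :: "nat \<Rightarrow> real set" where
  "I_set m = {- (2 ^ m) <.. - (1 / 2 ^ m)} \<union> {1 / 2 ^ m ..< 2 ^ m}"

definition A_set :: "nat \<Rightarrow> (real ^ 'n) set" where
  "A_set m = {x. \<forall>i. x $ i \<in> I_set m}"

definition measurable_box :: "(real ^ 'n) set \<Rightarrow> bool" where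
  "measurable_box S \<longleftrightarrow>
     (\<exists>e :: 'n \<Rightarrow> real set. (\<forall>i. e i \<in> sets lebesgue) \<and> S = {x. \<forall>i. x $ i \<in> e i})"

definition H_class :: "(real ^ 'n \<Rightarrow> complex) set" where
  "H_class =
     {f. \<exists>(N::nat) (a :: nat \<Rightarrow> complex) (E :: nat \<Rightarrow> (real ^ 'n) set).
           disjoint_family_on E {..<N} \<and>
           (\<forall>k<N. measurable_box (E k) \<and> (\<exists>m. E k \<subseteq> A_set m)) \<and>
           f = (\<lambda>x. \<Sum>k<N. a k * indicator (E k) x)}"

text \<open>
  Measurable functions are identified when they agree almost everywhere, so linearity is
  required almost everywhere. Nothing is assumed about \<open>T f\<close> for \<open>f\<close> outside \<^const>\<open>H_class\<close>.
\<close>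
definition linear_seq_operator ::
  "((real ^ 'n \<Rightarrow> complex) \<Rightarrow> int \<Rightarrow> real ^ 'n \<Rightarrow> complex) \<Rightarrow> bool" where
  "linear_seq_operator T \<longleftrightarrow>
     (\<forall>f\<in>H_class. \<forall>j. T f j \<in> borel_measurable lebesgue) \<and>
     (\<forall>f\<in>H_class. \<forall>g\<in>H_class. \<forall>a b :: complex. \<forall>j.
        AE x in lebesgue. T (\<lambda>y. a * f y + b * g y) j x = a * T f j x + b * T g j x)"

end

theory Submission
  imports
    Defs
    "HOL-Complex_Analysis.Complex_Analysis"
    "HOL-Probability.Characteristic_Functions"
    "HOL-Real_Asymp.Real_Asymp"
begin

text \<open>
  The proof is complex interpolation in the form used by Calderon and Hirschman. Write
  \<open>S f = sup\<^sub>j \<bar>T f (j, \<cdot>)\<bar>\<close> and let \<open>0 < \<theta> < 1\<close>; for \<open>\<theta> \<in> {0, 1}\<close> the claim is one of the two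
  hypotheses.

  A function \<open>f\<close> of \<^const>\<open>H_class\<close> is constant on the cells of a finite grid, and on that grid it
  factors as \<open>\<bar>f\<bar> = u0\<^sup>1\<^sup>-\<^sup>\<theta> u1\<^sup>\<theta>\<close>, where the norm of \<open>u0\<close> for the data with index \<open>0\<close> and the norm of
  \<open>u1\<close> for the data with index \<open>1\<close> are at most the norm \<open>n\<close> of \<open>f\<close> for the intermediate data
  (\<open>grid_factorization\<close>). For a single Lebesgue norm, \<open>u0\<close> is \<open>\<bar>f\<bar>\<close> to the power \<open>p/p0\<close>, up to a
  constant. A Herz norm consists of two Lebesgue norms, and the mixed norm adds one Herz norm for
  each coordinate; each time, the factors of the outer function are distributed over the factors of
  the inner ones. Then \<open>F\<^sub>z = sgn f u0\<^sup>1\<^sup>-\<^sup>z u1\<^sup>z\<close> lies in \<^const>\<open>H_class\<close> for every complex \<open>z\<close>, equals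
  \<open>f\<close> at \<open>z = \<theta>\<close>, and has modulus \<open>u0\<close> on \<open>Re z = 0\<close> and \<open>u1\<close> on \<open>Re z = 1\<close>.

  By linearity, \<open>T F\<^sub>z (j, x)\<close> is for fixed \<open>j\<close> and \<open>x\<close> an exponential sum in \<open>z\<close>, whose frequencies
  depend on neither \<open>j\<close> nor \<open>x\<close>. The Poisson formula of the strip \<open>0 \<le> Re z \<le> 1\<close>, optimised over the
  factors \<open>exp (\<lambda> (z - \<theta>))\<close>, bounds its modulus at \<open>\<theta>\<close> by \<open>A\<^sup>1\<^sup>-\<^sup>\<theta> B\<^sup>\<theta>\<close>, where \<open>A\<close> and \<open>B\<close> are averages of
  the modulus over the two boundary lines. Averages, in contrast to the suprema in the three lines
  theorem, can be pulled out of a norm by the triangle inequality. Up to an error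
  \<open>\<epsilon>\<close> they are finite sums whose nodes and weights depend on the frequencies alone
  (\<open>exponential_sum_interpolation\<close>), so the bound passes to \<open>S f\<close> for almost every \<open>x\<close>, with
  \<open>S F\<^sub>z\<close> at finitely many points \<open>z\<close> of the boundary on the right. Hoelder's inequality for mixed
  norms (\<open>mixed_norm_holder\<close>), the triangle inequality and the two hypotheses on \<open>T\<close> now give
  \<open>\<parallel>S f\<parallel> \<le> (M0 n + \<epsilon> C0)\<^sup>1\<^sup>-\<^sup>\<theta> (M1 n + \<epsilon> C1)\<^sup>\<theta>\<close>, and \<open>\<epsilon>\<close> tends to \<open>0\<close>.

  The functions \<open>T f (j, \<cdot>)\<close> are Lebesgue measurable, but their one-variable sections are so only for
  almost every choice of the other coordinates. All inequalities between iterated norms are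
  therefore propagated almost everywhere (\<open>AE_vec_upd\<close>); once every coordinate has been used, both
  sides are constants, and the inequality holds.
\<close>

section \<open>Harmonic measure of the strip\<close>

text \<open>
  The quotient \<open>sin (\<pi> \<theta>) / strip_den \<theta> z\<close> is, up to a constant factor, the complex Poisson kernel
  of the strip with pole \<open>\<theta>\<close>: it comes from the kernel of the upper half plane by the conformal map
  \<open>z \<mapsto> exp (\<i> \<pi> z)\<close>.
\<close>
definition strip_den :: "real \<Rightarrow> complex \<Rightarrow> complex" where
  "strip_den \<theta> z = complex_of_real (cos (pi * \<theta>)) - cos (of_real pi * z)"

text \<open>
  The densities of the harmonic measure at \<open>\<theta>\<close> on the lines \<open>Re z = 0\<close> and \<open>Re z = 1\<close>.
\<close>
definition left_kernel :: "real \<Rightarrow> real \<Rightarrow> real" where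
  "left_kernel \<theta> y = sin (pi * \<theta>) / (2 * (cosh (pi * y) - cos (pi * \<theta>)))"

definition right_kernel :: "real \<Rightarrow> real \<Rightarrow> real" where
  "right_kernel \<theta> y = sin (pi * \<theta>) / (2 * (cosh (pi * y) + cos (pi * \<theta>)))"

lemma abs_cos_less_one:
  assumes "0 < \<theta>" "\<theta> < 1"
  shows "\<bar>cos (pi * \<theta>)\<bar> < 1" "0 < sin (pi * \<theta>)"
proof -
  show s: "0 < sin (pi * \<theta>)" using assms by (intro sin_gt_zero) auto
  have "(cos (pi * \<theta>))\<^sup>2 < 1" using s sin_cos_squared_add[of "pi * \<theta>"]
    by (smt (verit) zero_less_power)
  then show "\<bar>cos (pi * \<theta>)\<bar> < 1" by (simp add: abs_square_less_1)
qed

lemma kernel_pos: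
  assumes "0 < \<theta>" "\<theta> < 1"
  shows "0 < left_kernel \<theta> y" "0 < right_kernel \<theta> y"
  using abs_cos_less_one[OF assms] cosh_real_ge_1[of "pi * y"]
  unfolding left_kernel_def right_kernel_def by (auto intro!: divide_pos_pos)

lemma continuous_kernel:
  assumes "0 < \<theta>" "\<theta> < 1"
  shows "continuous_on A (left_kernel \<theta>)" "continuous_on A (right_kernel \<theta>)"
proof -
  have "cosh (pi * y) - cos (pi * \<theta>) \<noteq> 0" "cosh (pi * y) + cos (pi * \<theta>) \<noteq> 0" for y
    using abs_cos_less_one[OF assms] cosh_real_ge_1[of "pi * y"] by auto
  then have "2 * (cosh (pi * y) - cos (pi * \<theta>)) \<noteq> 0" "2 * (cosh (pi * y) + cos (pi * \<theta>)) \<noteq> 0" for y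
    by (simp_all del: distrib_left_numeral right_diff_distrib_numeral)
  then show "continuous_on A (left_kernel \<theta>)" "continuous_on A (right_kernel \<theta>)"
    unfolding left_kernel_def right_kernel_def by (intro continuous_intros ballI; blast)+
qed

lemma cos_vertical:
  "cos (of_real pi * Complex 0 y) = complex_of_real (cosh (pi * y))"
  "cos (of_real pi * Complex 1 y) = - complex_of_real (cosh (pi * y))"
proof -
  have e: "cos (\<i> * complex_of_real (pi * y)) = complex_of_real (cosh (pi * y))"
    unfolding cosh_conv_cos[symmetric] cosh_def by (simp add: scaleR_conv_of_real exp_of_real del: of_real_mult flip: of_real_minus)
  show "cos (of_real pi * Complex 0 y) = complex_of_real (cosh (pi * y))"
    using e by (simp add: Complex_eq algebra_simps)
  have "cos (of_real pi * Complex 1 y) = cos (\<i> * complex_of_real (pi * y) + of_real pi)"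
    by (simp add: Complex_eq algebra_simps)
  also have "\<dots> = - cos (\<i> * complex_of_real (pi * y))"
    by (simp add: cos_add flip: cos_of_real sin_of_real)
  finally show "cos (of_real pi * Complex 1 y) = - complex_of_real (cosh (pi * y))"
    using e by simp
qed

text \<open>
  On the two boundary lines the kernel is real, which is why the contour integral below turns into
  an integral against two positive measures.
\<close>
lemma strip_den_vertical:
  assumes "0 < \<theta>" "\<theta> < 1"
  shows "of_real (sin (pi * \<theta>)) / strip_den \<theta> (Complex 0 y) = - 2 * of_real (left_kernel \<theta> y)"
    and "of_real (sin (pi * \<theta>)) / strip_den \<theta> (Complex 1 y) = 2 * of_real (right_kernel \<theta> y)"
proof -
  have n: "cosh (pi * y) - cos (pi * \<theta>) \<noteq> 0" "cosh (pi * y) + cos (pi * \<theta>) \<noteq> 0" 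
     "cos (pi * \<theta>) - cosh (pi * y) \<noteq> 0"
    using abs_cos_less_one[OF assms] cosh_real_ge_1[of "pi * y"] by auto
  have "of_real (sin (pi * \<theta>)) / strip_den \<theta> (Complex 0 y)
      = complex_of_real (sin (pi * \<theta>) / (cos (pi * \<theta>) - cosh (pi * y)))"
    by (simp add: strip_den_def cos_vertical)
  also have "sin (pi * \<theta>) / (cos (pi * \<theta>) - cosh (pi * y)) = - 2 * left_kernel \<theta> y"
    using n by (simp add: left_kernel_def field_simps)
  finally show "of_real (sin (pi * \<theta>)) / strip_den \<theta> (Complex 0 y) = - 2 * of_real (left_kernel \<theta> y)"
    by simp
  have "of_real (sin (pi * \<theta>)) / strip_den \<theta> (Complex 1 y)
      = complex_of_real (sin (pi * \<theta>) / (cos (pi * \<theta>) + cosh (pi * y)))"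
    by (simp add: strip_den_def cos_vertical)
  also have "sin (pi * \<theta>) / (cos (pi * \<theta>) + cosh (pi * y)) = 2 * right_kernel \<theta> y"
    using n by (simp add: right_kernel_def field_simps)
  finally show "of_real (sin (pi * \<theta>)) / strip_den \<theta> (Complex 1 y) = 2 * of_real (right_kernel \<theta> y)"
    by simp
qed

text \<open>
  The zeros of the denominator are the points \<open>\<plusminus> \<theta> + 2 n\<close>; the open strip
  \<open>- \<theta> < Re z < 2 - \<theta>\<close> contains the closed unit strip and only one of them.
\<close>
lemma strip_den_zero:
  assumes "0 < \<theta>" "\<theta> < 1" "- \<theta> < Re z" "Re z < 2 - \<theta>" "strip_den \<theta> z = 0"
  shows "z = of_real \<theta>"
proof -
  have "cos (of_real pi * z) = cos (complex_of_real (pi * \<theta>))"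
    using assms(5) by (simp add: strip_den_def cos_of_real del: of_real_mult)
  then obtain n where n: "n \<in> \<int>" and
    "of_real pi * z = complex_of_real (pi * \<theta>) + of_real (2 * n * pi) \<or>
     of_real pi * z = - complex_of_real (pi * \<theta>) + of_real (2 * n * pi)"
    unfolding complex_cos_eq by auto
  then have "of_real pi * z = of_real pi * of_real (\<theta> + 2 * n) \<or> of_real pi * z = of_real pi * of_real (- \<theta> + 2 * n)"
    by (auto simp: algebra_simps)
  then have zz: "z = of_real (\<theta> + 2 * n) \<or> z = of_real (- \<theta> + 2 * n)"
    by (simp only: mult_cancel_left) auto
  obtain m where m: "n = of_int m" using n by (auto elim: Ints_cases)
  from zz show ?thesis
  proof
    assume z: "z = of_real (\<theta> + 2 * n)"
    then have "-\<theta> < \<theta> + 2 * n" "\<theta> + 2 * n < 2 - \<theta>" using assms by auto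
    then have "- 1 < n" "n < 1" using assms by auto
    then have "m = 0" using m by auto
    then show ?thesis using z m by simp
  next
    assume z: "z = of_real (- \<theta> + 2 * n)"
    then have "-\<theta> < - \<theta> + 2 * n" "- \<theta> + 2 * n < 2 - \<theta>" using assms by auto
    then have "0 < n" "n < 1" by auto
    then have False using m by auto
    then show ?thesis ..
  qed
qed

lemma norm_cos_lower: "cmod (cos w) \<ge> sinh \<bar>Im w\<bar>"
proof -
  have "cos w = (exp (\<i> * w) + exp (- \<i> * w)) / 2"
    by (simp add: cos_exp_eq)
  then have "cmod (cos w) = cmod (exp (\<i> * w) + exp (- \<i> * w)) / 2"
    by (simp only: norm_divide norm_numeral)
  moreover have "cmod (exp (\<i> * w) + exp (- \<i> * w)) \<ge> \<bar>cmod (exp (\<i> * w)) - cmod (exp (- \<i> * w))\<bar>"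
    using norm_triangle_ineq3[of "exp (\<i> * w)" "- exp (- \<i> * w)"] by simp
  moreover have "cmod (exp (\<i> * w)) = exp (- Im w)" "cmod (exp (- \<i> * w)) = exp (Im w)"
    by simp_all
  ultimately have "cmod (cos w) \<ge> \<bar>exp (- Im w) - exp (Im w)\<bar> / 2" by simp
  also have "\<bar>exp (- Im w) - exp (Im w)\<bar> / 2 = sinh \<bar>Im w\<bar>"
    by (cases "Im w \<ge> 0") (auto simp: sinh_def)
  finally show ?thesis .
qed

text \<open>
  Residue theorem: inside the rectangle the only pole is the simple one at \<open>\<theta>\<close>. The continuity
  statement makes the integrals over the single sides meaningful.
\<close>
lemma strip_rectangle_integral:
  assumes \<theta>: "0 < \<theta>" "\<theta> < 1" and F: "F holomorphic_on UNIV" and R: "0 < R"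
  defines "G \<equiv> \<lambda>z. F z * (of_real (sin (pi * \<theta>)) / strip_den \<theta> z)"
  shows "contour_integral (rectpath (Complex 0 (-R)) (Complex 1 R)) G = 2 * \<i> * F (of_real \<theta>)"
    and "continuous_on {z. 0 \<le> Re z \<and> Re z \<le> 1 \<and> z \<noteq> of_real \<theta>} G"
proof -
  define S where "S = {z. - \<theta> < Re z} \<inter> {z. Re z < 2 - \<theta>}"
  define p where "p = complex_of_real \<theta>"
  have S: "open S" "convex S"
    unfolding S_def by (auto intro!: open_Int open_halfspace_Re_gt open_halfspace_Re_lt
      convex_Int convex_halfspace_Re_gt convex_halfspace_Re_lt)
  have p: "p \<in> S" using \<theta> by (auto simp: S_def p_def)
  have nz: "strip_den \<theta> z \<noteq> 0" if "z \<in> S" "z \<noteq> p" for z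
    using strip_den_zero[OF \<theta>, of z] that by (auto simp: S_def p_def)
  have Fh: "F holomorphic_on A" for A using F holomorphic_on_subset by blast
  have holo: "G holomorphic_on S - {p}"
    unfolding G_def using nz Fh by (auto intro!: holomorphic_intros simp: strip_den_def)
  have sub: "{z. 0 \<le> Re z \<and> Re z \<le> 1 \<and> z \<noteq> of_real \<theta>} \<subseteq> S - {p}"
    using \<theta> by (auto simp: S_def p_def)
  show "continuous_on {z. 0 \<le> Re z \<and> Re z \<le> 1 \<and> z \<noteq> of_real \<theta>} G"
    using holo sub holomorphic_on_imp_continuous_on continuous_on_subset by blast
  have s0: "sin (pi * \<theta>) \<noteq> 0" using abs_cos_less_one[OF \<theta>] by auto
  have res: "residue G p = F p / pi"
  proof (rule residue_simple'[OF S(1) p holo])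
    have "(strip_den \<theta> has_field_derivative (of_real pi * sin (of_real pi * p))) (at p)"
      unfolding strip_den_def by (auto intro!: derivative_eq_intros)
    moreover have "strip_den \<theta> p = 0"
      by (simp add: strip_den_def p_def cos_of_real flip: of_real_mult)
    ultimately have "((\<lambda>w. strip_den \<theta> w / (w - p)) \<longlongrightarrow> of_real pi * sin (of_real pi * p)) (at p)"
      by (simp add: has_field_derivative_iff)
    moreover have sp: "sin (of_real pi * p) = of_real (sin (pi * \<theta>))"
      by (simp add: p_def sin_of_real flip: of_real_mult)
    ultimately have "((\<lambda>w. strip_den \<theta> w / (w - p)) \<longlongrightarrow> of_real pi * of_real (sin (pi * \<theta>))) (at p)"
      by simp
    moreover have "(F \<longlongrightarrow> F p) (at p)"
      using holomorphic_on_imp_continuous_on[OF F]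
      by (simp add: continuous_on_eq_continuous_at isCont_def)
    ultimately have "((\<lambda>w. F w * of_real (sin (pi * \<theta>)) / (strip_den \<theta> w / (w - p)))
        \<longlongrightarrow> F p * of_real (sin (pi * \<theta>)) / (of_real pi * of_real (sin (pi * \<theta>)))) (at p)"
      using s0 by (intro tendsto_intros) (auto simp del: of_real_mult simp flip: of_real_mult)
    then show "((\<lambda>w. G w * (w - p)) \<longlongrightarrow> F p / of_real pi) (at p)"
      using s0 by (simp add: G_def field_simps)
  qed
  let ?g = "rectpath (Complex 0 (-R)) (Complex 1 R)"
  have img: "path_image ?g \<subseteq> {z. 0 \<le> Re z \<and> Re z \<le> 1 \<and> z \<noteq> of_real \<theta>}"
    using R \<theta> by (subst path_image_rectpath) auto
  have "contour_integral ?g G = 2 * pi * \<i> * (\<Sum>q\<in>{p}. winding_number ?g q * residue G q)"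
  proof (rule Residue_theorem)
    show "\<forall>z. z \<notin> S \<longrightarrow> winding_number ?g z = 0"
    proof (intro allI impI)
      fix z assume "z \<notin> S"
      then have "z \<notin> cbox (Complex 0 (-R)) (Complex 1 R)"
        using \<theta> by (auto simp: S_def in_cbox_complex_iff)
      then show "winding_number ?g z = 0"
        using R by (intro winding_number_rectpath_outside) auto
    qed
  qed (use S holo img sub convex_connected in auto)
  moreover have "winding_number ?g p = 1"
    using R \<theta> by (intro winding_number_rectpath) (auto simp: p_def in_box_complex_iff)
  ultimately show "contour_integral ?g G = 2 * \<i> * F (of_real \<theta>)"
    using res by (simp add: p_def)
qed

text \<open>
  The two vertical sides give the two integrals. On the horizontal sides the kernel is at most
  \<open>1 / (sinh (\<pi> R) - 1)\<close>, which bounds the error.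
\<close>
lemma poisson_strip_finite:
  assumes \<theta>: "0 < \<theta>" "\<theta> < 1" and F: "F holomorphic_on UNIV" and R: "0 < R"
    and C: "\<And>z. 0 \<le> Re z \<Longrightarrow> Re z \<le> 1 \<Longrightarrow> cmod (F z) \<le> C * (1 + \<bar>Im z\<bar>)"
    and big: "1 < sinh (pi * R)"
  shows "cmod (integral {-R..R} (\<lambda>y. F (Complex 0 y) * of_real (left_kernel \<theta> y))
      + integral {-R..R} (\<lambda>y. F (Complex 1 y) * of_real (right_kernel \<theta> y)) - F (of_real \<theta>))
      \<le> C * (1 + R) / (sinh (pi * R) - 1)"
proof -
  define G where "G = (\<lambda>z. F z * (of_real (sin (pi * \<theta>)) / strip_den \<theta> z))"
  define a where "a = Complex 0 (-R)"
  define b where "b = Complex 1 (-R)"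
  define c where "c = Complex 1 R"
  define d where "d = Complex 0 R"
  note abcd = a_def b_def c_def d_def
  let ?D = "{z. 0 \<le> Re z \<and> Re z \<le> 1 \<and> z \<noteq> complex_of_real \<theta>}"
  have main: "contour_integral (rectpath a c) G = 2 * \<i> * F (of_real \<theta>)"
    and cont: "continuous_on ?D G"
    using strip_rectangle_integral[OF \<theta> F R] by (auto simp: G_def abcd)
  have seg: "closed_segment a b \<subseteq> ?D \<inter> {z. Im z = -R}" "closed_segment b c \<subseteq> ?D"
      "closed_segment c d \<subseteq> ?D \<inter> {z. Im z = R}" "closed_segment d a \<subseteq> ?D"
    using R \<theta> by (auto simp: abcd closed_segment_same_Re closed_segment_same_Im closed_segment_eq_real_ivl)
  have ci: "G contour_integrable_on linepath a b" "G contour_integrable_on linepath b c"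
      "G contour_integrable_on linepath c d" "G contour_integrable_on linepath d a"
    using seg by (auto intro!: contour_integrable_continuous_linepath continuous_on_subset[OF cont])
  have eq: "rectpath a c = linepath a b +++ linepath b c +++ linepath c d +++ linepath d a"
    by (simp add: rectpath_def Let_def abcd)
  have split: "contour_integral (rectpath a c) G = contour_integral (linepath a b) G
     + contour_integral (linepath b c) G + contour_integral (linepath c d) G + contour_integral (linepath d a) G"
    unfolding eq using ci by (simp add: contour_integrable_joinI)
  have right: "contour_integral (linepath b c) G
      = 2 * \<i> * integral {-R..R} (\<lambda>y. F (Complex 1 y) * of_real (right_kernel \<theta> y))"
  proof -
    have "contour_integral (linepath b c) G = \<i> * integral {-R..R} (\<lambda>y. G (Complex 1 y))"
      using R by (intro contour_integral_linepath_same_Re) (auto simp: abcd)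
    also have "(\<lambda>y. G (Complex 1 y)) = (\<lambda>y. 2 * (F (Complex 1 y) * of_real (right_kernel \<theta> y)))"
      using strip_den_vertical(2)[OF \<theta>] by (simp add: G_def fun_eq_iff del: times_divide_eq_right)
    also have "integral {-R..R} \<dots> = 2 * integral {-R..R} (\<lambda>y. F (Complex 1 y) * of_real (right_kernel \<theta> y))"
      by (rule integral_mult_right)
    finally show ?thesis by simp
  qed
  have left: "contour_integral (linepath d a) G
      = 2 * \<i> * integral {-R..R} (\<lambda>y. F (Complex 0 y) * of_real (left_kernel \<theta> y))"
  proof -
    have "contour_integral (linepath d a) G = - contour_integral (linepath a d) G"
      using seg by (intro contour_integral_reverse_linepath continuous_on_subset[OF cont]) auto
    also have "contour_integral (linepath a d) G = \<i> * integral {-R..R} (\<lambda>y. G (Complex 0 y))"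
      using R by (intro contour_integral_linepath_same_Re) (auto simp: abcd)
    also have "(\<lambda>y. G (Complex 0 y)) = (\<lambda>y. (- 2) * (F (Complex 0 y) * of_real (left_kernel \<theta> y)))"
      using strip_den_vertical(1)[OF \<theta>] by (simp add: G_def fun_eq_iff del: times_divide_eq_right)
    also have "integral {-R..R} \<dots> = (- 2) * integral {-R..R} (\<lambda>y. F (Complex 0 y) * of_real (left_kernel \<theta> y))"
      by (rule integral_mult_right)
    finally show ?thesis by simp
  qed
  have bnd: "cmod (G z) \<le> C * (1 + R) / (sinh (pi * R) - 1)"
    if "0 \<le> Re z" "Re z \<le> 1" "\<bar>Im z\<bar> = R" for z
  proof -
    have "sinh (pi * R) - 1 \<le> cmod (cos (of_real pi * z)) - cmod (complex_of_real (cos (pi * \<theta>)))"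
      using norm_cos_lower[of "of_real pi * z"] that abs_cos_less_one[OF \<theta>] by (simp add: abs_mult)
    also have "\<dots> \<le> cmod (strip_den \<theta> z)"
      unfolding strip_den_def by (metis norm_minus_commute norm_triangle_ineq2)
    finally have den: "sinh (pi * R) - 1 \<le> cmod (strip_den \<theta> z)" .
    have "cmod (F z) \<le> C * (1 + R)" using C[OF that(1,2)] that(3) by simp
    moreover have "\<bar>sin (pi * \<theta>)\<bar> \<le> 1" by simp
    ultimately have "cmod (F z) * \<bar>sin (pi * \<theta>)\<bar> \<le> C * (1 + R) * 1"
      by (intro mult_mono) (auto intro: order_trans[OF norm_ge_zero])
    moreover from this have "0 \<le> C * (1 + R)"
      by (smt (verit) abs_ge_zero mult_nonneg_nonneg norm_ge_zero)
    ultimately have "cmod (F z) * \<bar>sin (pi * \<theta>)\<bar> / cmod (strip_den \<theta> z) \<le> C * (1 + R) / (sinh (pi * R) - 1)"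
      using den big by (intro frac_le) auto
    then show ?thesis by (simp add: G_def norm_mult norm_divide)
  qed
  have B0: "0 \<le> C * (1 + R) / (sinh (pi * R) - 1)"
    using bnd[of "Complex 0 R"] R by (auto intro: order_trans[OF norm_ge_zero])
  have bot: "cmod (contour_integral (linepath a b) G) \<le> C * (1 + R) / (sinh (pi * R) - 1) * cmod (b - a)"
    using seg(1) R by (intro contour_integral_bound_linepath ci B0 bnd) auto
  have top: "cmod (contour_integral (linepath c d) G) \<le> C * (1 + R) / (sinh (pi * R) - 1) * cmod (d - c)"
    using seg(3) R by (intro contour_integral_bound_linepath ci B0 bnd) auto
  have len: "cmod (b - a) = 1" "cmod (d - c) = 1" by (simp_all add: abcd cmod_def)
  let ?I = "integral {-R..R} (\<lambda>y. F (Complex 0 y) * of_real (left_kernel \<theta> y))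
      + integral {-R..R} (\<lambda>y. F (Complex 1 y) * of_real (right_kernel \<theta> y)) - F (of_real \<theta>)"
  have "2 * \<i> * ?I = - (contour_integral (linepath a b) G + contour_integral (linepath c d) G)"
    using main split left right by (simp add: algebra_simps)
  then have "cmod (2 * \<i> * ?I) \<le> cmod (contour_integral (linepath a b) G) + cmod (contour_integral (linepath c d) G)"
    by (simp add: norm_triangle_ineq norm_minus_commute del: minus_add_distrib)
  then show ?thesis using bot top len by (simp add: norm_mult)
qed

text \<open>
  Linear growth is permitted so that the formula applies to \<open>F z = z\<close> in \<open>kernel_mass\<close>.
\<close>
lemma poisson_strip:
  assumes \<theta>: "0 < \<theta>" "\<theta> < 1" and F: "F holomorphic_on UNIV"
    and C: "\<And>z. 0 \<le> Re z \<Longrightarrow> Re z \<le> 1 \<Longrightarrow> cmod (F z) \<le> C * (1 + \<bar>Im z\<bar>)"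
  shows "((\<lambda>R. integral {-R..R} (\<lambda>y. F (Complex 0 y) * of_real (left_kernel \<theta> y))
      + integral {-R..R} (\<lambda>y. F (Complex 1 y) * of_real (right_kernel \<theta> y))) \<longlongrightarrow> F (of_real \<theta>)) at_top"
proof -
  have "eventually (\<lambda>R. 1 < sinh (pi * R)) at_top" by real_asymp
  then have "eventually (\<lambda>R. 0 < R \<and> 1 < sinh (pi * R)) at_top"
    using eventually_gt_at_top[of 0] by eventually_elim auto
  then have "eventually (\<lambda>R. cmod (integral {-R..R} (\<lambda>y. F (Complex 0 y) * of_real (left_kernel \<theta> y))
      + integral {-R..R} (\<lambda>y. F (Complex 1 y) * of_real (right_kernel \<theta> y)) - F (of_real \<theta>))
      \<le> C * (1 + R) / (sinh (pi * R) - 1)) at_top"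
    by eventually_elim (use poisson_strip_finite[OF \<theta> F _ C] in blast)
  moreover have "((\<lambda>R. C * (1 + R) / (sinh (pi * R) - 1)) \<longlongrightarrow> 0) at_top" by real_asymp
  ultimately have "((\<lambda>R. integral {-R..R} (\<lambda>y. F (Complex 0 y) * of_real (left_kernel \<theta> y))
      + integral {-R..R} (\<lambda>y. F (Complex 1 y) * of_real (right_kernel \<theta> y)) - F (of_real \<theta>)) \<longlongrightarrow> 0) at_top"
    by (rule Lim_null_comparison)
  then show ?thesis using LIM_zero_iff by blast
qed

lemma Re_integral_interval:
  fixes f :: "real \<Rightarrow> complex"
  assumes "continuous_on {a..b} f"
  shows "Re (integral {a..b} f) = integral {a..b} (\<lambda>y. Re (f y))"
  using integral_linear[OF integrable_continuous_real[OF assms] bounded_linear_Re] by (simp add: o_def)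

lemma continuous_on_vertical:
  assumes "F holomorphic_on UNIV"
  shows "continuous_on A (\<lambda>y. F (Complex c y))"
proof -
  have "continuous_on UNIV F" using assms by (rule holomorphic_on_imp_continuous_on)
  moreover have "continuous_on A (\<lambda>y. Complex c y)" by (auto simp: Complex_eq intro!: continuous_intros)
  ultimately show ?thesis by (rule continuous_on_compose2) auto
qed

text \<open>
  The formula for \<open>F z = z\<close> yields the mass \<open>\<theta>\<close> of the right line, and the one for \<open>F z = 1\<close> yields
  the total mass \<open>1\<close>. The sharp constant \<open>M0\<^sup>1\<^sup>-\<^sup>\<theta> M1\<^sup>\<theta>\<close> depends on these exact values.
\<close>
lemma kernel_mass:
  assumes \<theta>: "0 < \<theta>" "\<theta> < 1"
  shows "((\<lambda>R. integral {-R..R} (left_kernel \<theta>)) \<longlongrightarrow> 1 - \<theta>) at_top"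
    and "((\<lambda>R. integral {-R..R} (right_kernel \<theta>)) \<longlongrightarrow> \<theta>) at_top"
proof -
  note ck = continuous_kernel[OF \<theta>]
  have re: "Re (integral {-R..R} (\<lambda>y. G y * of_real (k y))) = integral {-R..R} (\<lambda>y. Re (G y) * k y)"
    if "continuous_on {-R..R} G" "continuous_on {-R..R} k" for G :: "real \<Rightarrow> complex" and k R
    using that by (subst Re_integral_interval) (auto intro!: continuous_intros)
  have cid: "continuous_on A (\<lambda>y. Complex c y)" for A c
    by (auto simp: Complex_eq intro!: continuous_intros)
  have id_bound: "cmod z \<le> 1 * (1 + \<bar>Im z\<bar>)" if "0 \<le> Re z" "Re z \<le> 1" for z
    using cmod_le[of z] that by simp
  have "((\<lambda>R. Re (integral {-R..R} (\<lambda>y. Complex 0 y * of_real (left_kernel \<theta> y))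
      + integral {-R..R} (\<lambda>y. Complex 1 y * of_real (right_kernel \<theta> y)))) \<longlongrightarrow> Re (of_real \<theta>)) at_top"
    using poisson_strip[OF \<theta>, of "\<lambda>z. z" 1] id_bound by (intro tendsto_Re) (auto intro!: holomorphic_intros)
  then show b: "((\<lambda>R. integral {-R..R} (right_kernel \<theta>)) \<longlongrightarrow> \<theta>) at_top"
    by (simp add: re cid ck)
  have "((\<lambda>R. Re (integral {-R..R} (\<lambda>y. 1 * of_real (left_kernel \<theta> y))
      + integral {-R..R} (\<lambda>y. 1 * of_real (right_kernel \<theta> y)))) \<longlongrightarrow> Re 1) at_top"
    using poisson_strip[OF \<theta>, of "\<lambda>z. 1" 1] by (intro tendsto_Re) auto
  then have "((\<lambda>R. integral {-R..R} (left_kernel \<theta>) + integral {-R..R} (right_kernel \<theta>)) \<longlongrightarrow> 1) at_top"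
    using re[OF continuous_on_const[of _ 1] ck(1)] re[OF continuous_on_const[of _ 1] ck(2)] by simp
  from tendsto_diff[OF this b]
  show "((\<lambda>R. integral {-R..R} (left_kernel \<theta>)) \<longlongrightarrow> 1 - \<theta>) at_top" by simp
qed

text \<open>
  The Poisson formula for \<open>F z exp (l (z - \<theta>))\<close> gives
  \<open>\<bar>F \<theta>\<bar> \<le> (1 - \<theta>) exp (- l \<theta>) X + \<theta> exp (l (1 - \<theta>)) Y\<close>. The choice \<open>l = ln (X / Y)\<close> makes both
  exponential terms equal to \<open>X\<^sup>1\<^sup>-\<^sup>\<theta> Y\<^sup>\<theta>\<close>.
\<close>
lemma poisson_interpolation:
  assumes \<theta>: "0 < \<theta>" "\<theta> < 1" and F: "F holomorphic_on UNIV"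
    and C: "\<And>z. 0 \<le> Re z \<Longrightarrow> Re z \<le> 1 \<Longrightarrow> cmod (F z) \<le> C"
    and XY: "0 < X" "0 < Y"
    and left: "\<And>R. 0 < R \<Longrightarrow> integral {-R..R} (\<lambda>y. cmod (F (Complex 0 y)) * left_kernel \<theta> y) \<le> (1 - \<theta>) * X"
    and right: "\<And>R. 0 < R \<Longrightarrow> integral {-R..R} (\<lambda>y. cmod (F (Complex 1 y)) * right_kernel \<theta> y) \<le> \<theta> * Y"
  shows "cmod (F (of_real \<theta>)) \<le> X powr (1 - \<theta>) * Y powr \<theta>"
proof -
  \<comment> \<open>The minimiser of the bound on the right-hand side.\<close>
  define l where "l = ln X - ln Y"
  define G where "G = (\<lambda>z. F z * exp (of_real l * (z - of_real \<theta>)))"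
  have G: "G holomorphic_on UNIV" unfolding G_def using F by (intro holomorphic_intros)
  have Gn: "cmod (G z) = cmod (F z) * exp (l * (Re z - \<theta>))" for z
    by (simp add: G_def norm_mult)
  have Gb: "cmod (G z) \<le> (C * exp \<bar>l\<bar>) * (1 + \<bar>Im z\<bar>)" if z: "0 \<le> Re z" "Re z \<le> 1" for z
  proof -
    have "\<bar>l\<bar> * \<bar>Re z - \<theta>\<bar> \<le> \<bar>l\<bar> * 1" using z \<theta> by (intro mult_left_mono) auto
    moreover have "l * (Re z - \<theta>) \<le> \<bar>l\<bar> * \<bar>Re z - \<theta>\<bar>"
      unfolding abs_mult[symmetric] by (rule abs_ge_self)
    ultimately have "l * (Re z - \<theta>) \<le> \<bar>l\<bar>" by simp
    then have "cmod (F z) * exp (l * (Re z - \<theta>)) \<le> C * exp \<bar>l\<bar>"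
      using C[OF z] by (intro mult_mono) (auto intro: order_trans[OF norm_ge_zero])
    moreover have "0 \<le> C" using C[OF z] norm_ge_zero[of "F z"] by linarith
    then have "C * exp \<bar>l\<bar> * 1 \<le> C * exp \<bar>l\<bar> * (1 + \<bar>Im z\<bar>)"
      by (intro mult_left_mono) auto
    ultimately show ?thesis unfolding Gn by simp
  qed
  have bnd: "cmod (integral {-R..R} (\<lambda>y. G (Complex c y) * of_real (k y)))
      \<le> exp (l * (c - \<theta>)) * integral {-R..R} (\<lambda>y. cmod (F (Complex c y)) * k y)"
    if k: "continuous_on {-R..R} k" "\<And>y. 0 \<le> k y" for c k R
  proof -
    have "cmod (integral {-R..R} (\<lambda>y. G (Complex c y) * of_real (k y)))
        \<le> integral {-R..R} (\<lambda>y. exp (l * (c - \<theta>)) * (cmod (F (Complex c y)) * k y))"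
      using k by (intro Henstock_Kurzweil_Integration.integral_norm_bound_integral
            integrable_continuous_real continuous_intros continuous_on_vertical F G)
         (auto simp: Gn norm_mult)
    then show ?thesis by simp
  qed
  have "eventually (\<lambda>R. cmod (integral {-R..R} (\<lambda>y. G (Complex 0 y) * of_real (left_kernel \<theta> y))
      + integral {-R..R} (\<lambda>y. G (Complex 1 y) * of_real (right_kernel \<theta> y)))
      \<le> exp (l * (0 - \<theta>)) * ((1 - \<theta>) * X) + exp (l * (1 - \<theta>)) * (\<theta> * Y)) at_top"
    using eventually_gt_at_top[of 0]
  proof eventually_elim
    case (elim R)
    note k = continuous_kernel[OF \<theta>] less_imp_le[OF kernel_pos(1)[OF \<theta>]] less_imp_le[OF kernel_pos(2)[OF \<theta>]]
    have "cmod (integral {-R..R} (\<lambda>y. G (Complex 0 y) * of_real (left_kernel \<theta> y)))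
        \<le> exp (l * (0 - \<theta>)) * ((1 - \<theta>) * X)"
      by (rule order_trans[OF bnd]) (use k left[OF elim] in auto)
    moreover have "cmod (integral {-R..R} (\<lambda>y. G (Complex 1 y) * of_real (right_kernel \<theta> y)))
        \<le> exp (l * (1 - \<theta>)) * (\<theta> * Y)"
      by (rule order_trans[OF bnd]) (use k right[OF elim] in auto)
    ultimately show ?case by (meson add_mono norm_triangle_ineq order_trans)
  qed
  then have "cmod (G (of_real \<theta>)) \<le> exp (l * (0 - \<theta>)) * ((1 - \<theta>) * X) + exp (l * (1 - \<theta>)) * (\<theta> * Y)"
    by (intro tendsto_upperbound[OF tendsto_norm[OF poisson_strip[OF \<theta> G Gb]]]) auto
  also have "exp (l * (0 - \<theta>)) * ((1 - \<theta>) * X) = (1 - \<theta>) * (X powr (1 - \<theta>) * Y powr \<theta>)"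
  proof -
    have "exp (l * (0 - \<theta>)) * exp (ln X) = exp ((1 - \<theta>) * ln X) * exp (\<theta> * ln Y)"
      unfolding exp_add[symmetric] l_def by (simp add: algebra_simps)
    then show ?thesis using XY by (simp add: powr_def)
  qed
  also have "exp (l * (1 - \<theta>)) * (\<theta> * Y) = \<theta> * (X powr (1 - \<theta>) * Y powr \<theta>)"
  proof -
    have "exp (l * (1 - \<theta>)) * exp (ln Y) = exp ((1 - \<theta>) * ln X) * exp (\<theta> * ln Y)"
      unfolding exp_add[symmetric] l_def by (simp add: algebra_simps)
    then show ?thesis using XY by (simp add: powr_def)
  qed
  finally show ?thesis by (simp add: G_def algebra_simps)
qed

lemma exponential_sum_lipschitz:
  fixes h :: "'a \<Rightarrow> complex"
  shows "\<bar>cmod (\<Sum>k\<in>D. h k * exp (\<i> * of_real (\<Lambda> k * x))) - cmod (\<Sum>k\<in>D. h k * exp (\<i> * of_real (\<Lambda> k * y)))\<bar>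
     \<le> (\<Sum>k\<in>D. \<bar>\<Lambda> k\<bar>) * \<bar>x - y\<bar> * (\<Sum>k\<in>D. cmod (h k))"
proof (cases "finite D")
  case D: True
  have lip: "cmod (iexp a - iexp b) \<le> \<bar>a - b\<bar>" for a b
  proof -
    have "iexp a - iexp b = iexp b * (iexp (a - b) - 1)"
      by (simp add: algebra_simps exp_diff)
    then have "cmod (iexp a - iexp b) = cmod (iexp (a - b) - 1)" by (simp add: norm_mult)
    also have "\<dots> \<le> \<bar>a - b\<bar>" using iexp_approx1[of "a - b" 0] by simp
    finally show ?thesis .
  qed
  have "\<bar>cmod (\<Sum>k\<in>D. h k * iexp (\<Lambda> k * x)) - cmod (\<Sum>k\<in>D. h k * iexp (\<Lambda> k * y))\<bar>
      \<le> cmod (\<Sum>k\<in>D. h k * (iexp (\<Lambda> k * x) - iexp (\<Lambda> k * y)))"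
    by (rule order_trans[OF norm_triangle_ineq3]) (simp add: sum_subtractf algebra_simps)
  also have "\<dots> \<le> (\<Sum>k\<in>D. cmod (h k) * ((\<Sum>k\<in>D. \<bar>\<Lambda> k\<bar>) * \<bar>x - y\<bar>))"
  proof (intro sum_norm_le)
    fix k assume k: "k \<in> D"
    have "cmod (iexp (\<Lambda> k * x) - iexp (\<Lambda> k * y)) \<le> \<bar>\<Lambda> k\<bar> * \<bar>x - y\<bar>"
      by (rule order_trans[OF lip]) (simp add: abs_mult flip: right_diff_distrib)
    also have "\<dots> \<le> (\<Sum>k\<in>D. \<bar>\<Lambda> k\<bar>) * \<bar>x - y\<bar>"
      using D k by (intro mult_right_mono member_le_sum) auto
    finally show "cmod (h k * (iexp (\<Lambda> k * x) - iexp (\<Lambda> k * y))) \<le> cmod (h k) * ((\<Sum>k\<in>D. \<bar>\<Lambda> k\<bar>) * \<bar>x - y\<bar>)"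
      unfolding norm_mult by (intro mult_left_mono) auto
  qed
  finally show ?thesis by (simp add: sum_distrib_right[symmetric] mult.commute)
qed simp

text \<open>
  Exponential sums with given frequencies have a common Lipschitz constant relative to the sum of
  the moduli of their coefficients. So one Riemann sum, on an interval that carries all but a small
  part of the mass, works for all coefficients at once.
\<close>
lemma kernel_quadrature:
  fixes P :: "real \<Rightarrow> real" and D :: "'a set" and \<Lambda> :: "'a \<Rightarrow> real"
  assumes P: "continuous_on UNIV P" "\<And>y. 0 \<le> P y"
    and lim: "((\<lambda>R. integral {-R..R} P) \<longlongrightarrow> m) at_top" and m: "0 < m" and e: "0 < e"
  shows "\<exists>(n::nat) w \<tau>. (\<forall>l<n. 0 \<le> w l) \<and> (\<Sum>l<n. w l) \<le> 1 \<and>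
    (\<forall>(h :: 'a \<Rightarrow> complex) R. 0 < R \<longrightarrow>
      integral {-R..R} (\<lambda>y. cmod (\<Sum>k\<in>D. h k * exp (\<i> * of_real (\<Lambda> k * y))) * P y)
      \<le> m * ((\<Sum>l<n. w l * cmod (\<Sum>k\<in>D. h k * exp (\<i> * of_real (\<Lambda> k * \<tau> l)))) + e * (\<Sum>k\<in>D. cmod (h k))))"
proof -
  define I where "I R = integral {-R..R} P" for R
  have int: "f integrable_on {a..b}" if "continuous_on UNIV f" for f :: "real \<Rightarrow> real" and a b
    using that by (intro integrable_continuous_real) (rule continuous_on_subset, auto)
  have Imono: "I a \<le> I b" if "a \<le> b" for a b
    unfolding I_def using that P by (intro integral_subset_le int) auto
  have Ile: "I R \<le> m" for R
    by (rule tendsto_lowerbound[OF lim[folded I_def]])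
       (auto intro!: Imono eventually_mono[OF eventually_ge_at_top[of R]])
  have "eventually (\<lambda>R. m - e * m / 2 < I R) at_top"
    using lim e m unfolding I_def by (intro order_tendstoD) auto
  then have "eventually (\<lambda>R. 0 < R \<and> m - e * m / 2 < I R) at_top"
    using eventually_gt_at_top[of 0] by eventually_elim auto
  then obtain R0 where R0: "0 < R0" "m - e * m / 2 < I R0"
    using eventually_happens'[OF trivial_limit_at_top_linorder] by blast
  define B where "B = (\<Sum>k\<in>D. \<bar>\<Lambda> k\<bar>)"
  have B0: "0 \<le> B" by (auto simp: B_def sum_nonneg)
  \<comment> \<open>The mesh \<open>d = 2 * R0 / n\<close> has to satisfy \<open>B * d \<le> e / 2\<close>, where \<open>B\<close> is the Lipschitz constant.\<close>
  obtain n :: nat where n: "4 * R0 * B / e < n" using reals_Archimedean2 by blast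
  moreover have "0 \<le> 4 * R0 * B / e" using R0 B0 e by auto
  ultimately have n0: "0 < real n" by linarith
  define d where "d = 2 * R0 / n"
  have d: "0 < d" "B * d \<le> e / 2" using n n0 R0 e by (auto simp: d_def field_simps)
  define \<tau> where "\<tau> l = - R0 + real l * d" for l :: nat
  define w where "w l = integral {\<tau> l..\<tau> (Suc l)} P / m" for l
  have \<tau>: "\<tau> 0 = - R0" "\<tau> n = R0" "\<tau> l \<le> \<tau> (Suc l)" "- R0 \<le> \<tau> l" "\<tau> (Suc l) - \<tau> l = d" for l
  proof -
    show "\<tau> 0 = - R0" "\<tau> n = R0" using n0 by (simp_all add: \<tau>_def d_def)
    show "\<tau> (Suc l) - \<tau> l = d" by (simp add: \<tau>_def algebra_simps)
    then show "\<tau> l \<le> \<tau> (Suc l)" using d by simp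
    show "- R0 \<le> \<tau> l" using d by (simp add: \<tau>_def)
  qed
  have w0: "0 \<le> w l" for l
    using m P by (auto simp: w_def intro!: divide_nonneg_pos Henstock_Kurzweil_Integration.integral_nonneg int)
  have wsum: "integral {- R0..\<tau> j} P = m * (\<Sum>l<j. w l)" for j
  proof (induction j)
    case (Suc j)
    have "integral {- R0..\<tau> (Suc j)} P = integral {- R0..\<tau> j} P + integral {\<tau> j..\<tau> (Suc j)} P"
      by (rule Henstock_Kurzweil_Integration.integral_combine[symmetric]) (use \<tau> P int in auto)
    then show ?case using Suc m by (simp add: w_def algebra_simps)
  qed (simp add: \<tau>)
  have "m * (\<Sum>l<n. w l) \<le> m * 1" using wsum[of n] Ile[of R0] by (simp add: \<tau> I_def)
  then have wle: "(\<Sum>l<n. w l) \<le> 1" using m by simp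
  have "integral {-R..R} (\<lambda>y. cmod (\<Sum>k\<in>D. h k * exp (\<i> * of_real (\<Lambda> k * y))) * P y)
      \<le> m * ((\<Sum>l<n. w l * cmod (\<Sum>k\<in>D. h k * exp (\<i> * of_real (\<Lambda> k * \<tau> l)))) + e * (\<Sum>k\<in>D. cmod (h k)))"
    if R: "0 < R" for h :: "'a \<Rightarrow> complex" and R
  proof -
    define g where "g y = cmod (\<Sum>k\<in>D. h k * exp (\<i> * of_real (\<Lambda> k * y)))" for y
    define S where "S = (\<Sum>k\<in>D. cmod (h k))"
    have S0: "0 \<le> S" by (auto simp: S_def sum_nonneg)
    have gS: "g y \<le> S" for y unfolding g_def S_def by (intro sum_norm_le) (simp add: norm_mult)
    have g0: "0 \<le> g y" for y by (simp add: g_def)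
    have gc: "continuous_on UNIV g" unfolding g_def by (intro continuous_intros)
    have lip: "g y \<le> g x + e / 2 * S" if "\<bar>y - x\<bar> \<le> d" for x y
    proof -
      have "g y - g x \<le> B * \<bar>y - x\<bar> * S"
        using exponential_sum_lipschitz[where D = D and h = h and \<Lambda> = \<Lambda> and x = y and y = x] by (simp add: g_def B_def S_def abs_le_iff)
      also have "\<dots> \<le> e / 2 * S"
        using that d B0 S0 by (intro mult_right_mono order_trans[OF mult_left_mono d(2)]) auto
      finally show ?thesis by simp
    qed
    have sum: "integral {- R0..\<tau> j} (\<lambda>y. g y * P y) \<le> m * (\<Sum>l<j. w l * (g (\<tau> l) + e / 2 * S))" for j
    proof (induction j)
      case (Suc j)
      have "integral {- R0..\<tau> (Suc j)} (\<lambda>y. g y * P y)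
          = integral {- R0..\<tau> j} (\<lambda>y. g y * P y) + integral {\<tau> j..\<tau> (Suc j)} (\<lambda>y. g y * P y)"
        by (rule Henstock_Kurzweil_Integration.integral_combine[symmetric])
           (use \<tau> P gc in \<open>auto intro!: int continuous_intros\<close>)
      also have "integral {\<tau> j..\<tau> (Suc j)} (\<lambda>y. g y * P y)
          \<le> integral {\<tau> j..\<tau> (Suc j)} (\<lambda>y. (g (\<tau> j) + e / 2 * S) * P y)"
        using P gc \<tau>(5)[of j] by (intro integral_le int continuous_intros mult_right_mono lip) auto
      also have "\<dots> = m * (w j * (g (\<tau> j) + e / 2 * S))" using m by (simp add: w_def)
      finally show ?case using Suc by (simp add: algebra_simps)
    qed (simp add: \<tau>)
    \<comment> \<open>Outside \<open>[- R0, R0]\<close> the sum is bounded by \<open>S\<close>, and the kernel has mass at most \<open>e * m / 2\<close>.\<close>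
    define R' where "R' = max R R0"
    have "integral {-R..R} (\<lambda>y. g y * P y) \<le> integral {-R'..R'} (\<lambda>y. g y * P y)"
      using P gc g0 by (intro integral_subset_le int continuous_intros) (auto simp: R'_def)
    also have "\<dots> \<le> integral {-R0..R0} (\<lambda>y. g y * P y) + S * (I R' - I R0)"
    proof -
      have "integral {-R0..R0} (\<lambda>y. S * P y - g y * P y) \<le> integral {-R'..R'} (\<lambda>y. S * P y - g y * P y)"
        using P gc gS by (intro integral_subset_le int continuous_intros)
          (auto simp: R'_def intro!: mult_right_mono)
      moreover have "integral {-a..a} (\<lambda>y. S * P y - g y * P y) = S * I a - integral {-a..a} (\<lambda>y. g y * P y)" for a
        using P gc by (subst Henstock_Kurzweil_Integration.integral_diff) (auto intro!: int continuous_intros simp: I_def)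
      ultimately have "S * I R0 - integral {-R0..R0} (\<lambda>y. g y * P y)
          \<le> S * I R' - integral {-R'..R'} (\<lambda>y. g y * P y)" by simp
      then show ?thesis by (simp only: right_diff_distrib)
    qed
    also have "S * (I R' - I R0) \<le> S * (e * m / 2)"
      using S0 Ile[of R'] R0 by (intro mult_left_mono) auto
    also have "integral {-R0..R0} (\<lambda>y. g y * P y) \<le> m * (\<Sum>l<n. w l * (g (\<tau> l) + e / 2 * S))"
      using sum[of n] by (simp add: \<tau>)
    also have "(\<Sum>l<n. w l * (g (\<tau> l) + e / 2 * S)) = (\<Sum>l<n. w l * g (\<tau> l)) + (\<Sum>l<n. w l) * (e / 2 * S)"
      by (simp add: distrib_left sum.distrib sum_distrib_right)
    also have "\<dots> \<le> (\<Sum>l<n. w l * g (\<tau> l)) + 1 * (e / 2 * S)"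
      using wle e S0 by (intro add_left_mono mult_right_mono) auto
    finally have "integral {-R..R} (\<lambda>y. g y * P y) \<le> m * ((\<Sum>l<n. w l * g (\<tau> l)) + e * S)"
      using m by (simp add: algebra_simps)
    then show ?thesis by (simp add: g_def S_def)
  qed
  then show ?thesis using w0 wle by blast
qed

text \<open>
  The form in which the Poisson formula is used: nodes and weights are fixed before the
  coefficients \<open>h\<close>, which later depend on a point of \<open>\<real>\<^sup>n\<close> and on \<open>j\<close>.
\<close>
lemma exponential_sum_interpolation:
  fixes D :: "'a set" and \<Lambda> :: "'a \<Rightarrow> real"
  assumes \<theta>: "0 < \<theta>" "\<theta> < 1" and D: "finite D" and e: "0 < e"
  shows "\<exists>(n::nat) w \<tau> (n'::nat) w' \<tau>'.
    (\<forall>l<n. 0 \<le> w l) \<and> (\<Sum>l<n. w l) \<le> 1 \<and> (\<forall>l<n'. 0 \<le> w' l) \<and> (\<Sum>l<n'. w' l) \<le> 1 \<and>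
    (\<forall>h :: 'a \<Rightarrow> complex. cmod (\<Sum>k\<in>D. h k * exp (of_real (\<Lambda> k) * of_real \<theta>))
      \<le> ((\<Sum>l<n. w l * cmod (\<Sum>k\<in>D. h k * exp (of_real (\<Lambda> k) * Complex 0 (\<tau> l)))) + e * (\<Sum>k\<in>D. cmod (h k))) powr (1 - \<theta>)
      * ((\<Sum>l<n'. w' l * cmod (\<Sum>k\<in>D. h k * exp (of_real (\<Lambda> k) * Complex 1 (\<tau>' l)))) + e * (\<Sum>k\<in>D. cmod (h k))) powr \<theta>)"
proof -
  define E where "E = (\<Sum>k\<in>D. exp (\<Lambda> k)) + 1"
  have E: "0 < E" "\<And>k. k \<in> D \<Longrightarrow> exp (\<Lambda> k) \<le> E"
    using D by (auto simp: E_def intro!: add_nonneg_pos sum_nonneg add_increasing2 member_le_sum)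
  note pos = less_imp_le[OF kernel_pos(1)[OF \<theta>]] less_imp_le[OF kernel_pos(2)[OF \<theta>]]
  from kernel_quadrature[where D = D and \<Lambda> = \<Lambda>, OF continuous_kernel(1)[OF \<theta>] pos(1) kernel_mass(1)[OF \<theta>] _ e] \<theta>
  obtain n :: nat and w \<tau> where 0: "\<forall>l<n. 0 \<le> w l" "(\<Sum>l<n. w l) \<le> 1"
    "\<And>(h :: 'a \<Rightarrow> complex) R. 0 < R \<Longrightarrow>
      integral {-R..R} (\<lambda>y. cmod (\<Sum>k\<in>D. h k * exp (\<i> * of_real (\<Lambda> k * y))) * left_kernel \<theta> y)
      \<le> (1 - \<theta>) * ((\<Sum>l<n. w l * cmod (\<Sum>k\<in>D. h k * exp (\<i> * of_real (\<Lambda> k * \<tau> l)))) + e * (\<Sum>k\<in>D. cmod (h k)))"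
    by (auto simp del: of_real_mult)
  \<comment> \<open>On the line \<open>Re z = 1\<close> the coefficients are \<open>h k * exp (\<Lambda> k)\<close>, so their sum grows by a factor \<open>E\<close> at most.\<close>
  have eE: "0 < e / E" using e E by simp
  from kernel_quadrature[where D = D and \<Lambda> = \<Lambda>, OF continuous_kernel(2)[OF \<theta>] pos(2) kernel_mass(2)[OF \<theta>] _ eE] \<theta>
  obtain n' :: nat and w' \<tau>' where 1: "\<forall>l<n'. 0 \<le> w' l" "(\<Sum>l<n'. w' l) \<le> 1"
    "\<And>(h :: 'a \<Rightarrow> complex) R. 0 < R \<Longrightarrow>
      integral {-R..R} (\<lambda>y. cmod (\<Sum>k\<in>D. h k * exp (\<i> * of_real (\<Lambda> k * y))) * right_kernel \<theta> y)
      \<le> \<theta> * ((\<Sum>l<n'. w' l * cmod (\<Sum>k\<in>D. h k * exp (\<i> * of_real (\<Lambda> k * \<tau>' l)))) + e / E * (\<Sum>k\<in>D. cmod (h k)))"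
    by (auto simp del: of_real_mult)
  have "cmod (\<Sum>k\<in>D. h k * exp (of_real (\<Lambda> k) * of_real \<theta>))
      \<le> ((\<Sum>l<n. w l * cmod (\<Sum>k\<in>D. h k * exp (of_real (\<Lambda> k) * Complex 0 (\<tau> l)))) + e * (\<Sum>k\<in>D. cmod (h k))) powr (1 - \<theta>)
      * ((\<Sum>l<n'. w' l * cmod (\<Sum>k\<in>D. h k * exp (of_real (\<Lambda> k) * Complex 1 (\<tau>' l)))) + e * (\<Sum>k\<in>D. cmod (h k))) powr \<theta>"
    (is "_ \<le> ?X powr _ * ?Y powr _") for h :: "'a \<Rightarrow> complex"
  proof (cases "(\<Sum>k\<in>D. cmod (h k)) = 0")
    case True
    then have "h k = 0" if "k \<in> D" for k using D that by (simp add: sum_nonneg_eq_0_iff)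
    then show ?thesis by simp
  next
    case False
    then have S: "0 < (\<Sum>k\<in>D. cmod (h k))" by (metis less_eq_real_def norm_ge_zero sum_nonneg)
    define F where "F z = (\<Sum>k\<in>D. h k * exp (of_real (\<Lambda> k) * z))" for z
    have v0: "exp (of_real (\<Lambda> k) * Complex 0 y) = exp (\<i> * of_real (\<Lambda> k * y))" for k y
      by (simp add: Complex_eq algebra_simps)
    have v1: "exp (of_real (\<Lambda> k) * Complex 1 y) = of_real (exp (\<Lambda> k)) * exp (\<i> * of_real (\<Lambda> k * y))" for k y
      by (simp add: Complex_eq algebra_simps exp_add exp_of_real)
    have XY: "0 < ?X" "0 < ?Y"
      using 0 1 e S by (auto intro!: add_nonneg_pos sum_nonneg)
    have Fh: "F holomorphic_on UNIV" unfolding F_def by (intro holomorphic_intros)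
    have "cmod (F (of_real \<theta>)) \<le> ?X powr (1 - \<theta>) * ?Y powr \<theta>"
    proof (rule poisson_interpolation[OF \<theta> Fh _ XY])
      fix z assume z: "0 \<le> Re z" "Re z \<le> 1"
      show "cmod (F z) \<le> (\<Sum>k\<in>D. cmod (h k) * exp \<bar>\<Lambda> k\<bar>)" unfolding F_def
      proof (intro sum_norm_le)
        fix k assume "k \<in> D"
        have "\<Lambda> k * Re z \<le> \<bar>\<Lambda> k\<bar>"
          using z mult_mono[of "\<Lambda> k" "\<bar>\<Lambda> k\<bar>" "Re z" 1] by simp
        then show "cmod (h k * exp (of_real (\<Lambda> k) * z)) \<le> cmod (h k) * exp \<bar>\<Lambda> k\<bar>"
          by (simp add: norm_mult mult_left_mono)
      qed
    next
      fix R :: real assume R: "0 < R"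
      show "integral {-R..R} (\<lambda>y. cmod (F (Complex 0 y)) * left_kernel \<theta> y) \<le> (1 - \<theta>) * ?X"
        using 0(3)[OF R, of h] unfolding F_def v0 .
      have "(\<Sum>k\<in>D. cmod (h k * of_real (exp (\<Lambda> k)))) \<le> (\<Sum>k\<in>D. cmod (h k) * E)"
        using E(2) by (intro sum_mono) (auto simp: norm_mult intro!: mult_left_mono)
      then have "e / E * (\<Sum>k\<in>D. cmod (h k * of_real (exp (\<Lambda> k)))) \<le> e / E * (\<Sum>k\<in>D. cmod (h k) * E)"
        using eE by (intro mult_left_mono) auto
      also have "\<dots> = e * (\<Sum>k\<in>D. cmod (h k))"
        using E by (simp flip: sum_distrib_right)
      finally have le: "e / E * (\<Sum>k\<in>D. cmod (h k * of_real (exp (\<Lambda> k)))) \<le> e * (\<Sum>k\<in>D. cmod (h k))" .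
      have "integral {-R..R} (\<lambda>y. cmod (F (Complex 1 y)) * right_kernel \<theta> y)
        \<le> \<theta> * ((\<Sum>l<n'. w' l * cmod (\<Sum>k\<in>D. h k * exp (of_real (\<Lambda> k) * Complex 1 (\<tau>' l))))
             + e / E * (\<Sum>k\<in>D. cmod (h k * of_real (exp (\<Lambda> k)))))"
        using 1(3)[OF R, of "\<lambda>k. h k * of_real (exp (\<Lambda> k))"] unfolding F_def v1 mult.assoc .
      also have "\<dots> \<le> \<theta> * ?Y" using le \<theta> by (intro mult_left_mono) auto
      finally show "integral {-R..R} (\<lambda>y. cmod (F (Complex 1 y)) * right_kernel \<theta> y) \<le> \<theta> * ?Y" .
    qed
    then show ?thesis by (simp add: F_def)
  qed
  then show ?thesis using 0 1 by blast
qed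

section \<open>Lebesgue norms indexed by the reciprocal exponent\<close>

lemma enn_powr_simps [simp]:
  "enn_powr \<infinity> r = \<infinity>" "enn_powr top r = top" "enn_powr 0 r = 0" "enn_powr 1 r = 1" "enn_powr x 1 = x"
  by (cases x; auto simp: enn_powr_def)+

lemma enn_powr_ennreal [simp]: "0 \<le> x \<Longrightarrow> enn_powr (ennreal x) r = ennreal (x powr r)"
  by (simp add: enn_powr_def)

lemma enn_powr_eq_0_iff [simp]: "enn_powr x r = 0 \<longleftrightarrow> x = 0"
  by (cases x) auto

lemma enn_powr_eq_top_iff [simp]: "enn_powr x r = top \<longleftrightarrow> x = top"
  by (cases x) auto

lemma enn_powr_mono: "x \<le> y \<Longrightarrow> 0 \<le> r \<Longrightarrow> enn_powr x r \<le> enn_powr y r"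
  by (cases x; cases y) (auto simp: top_unique intro!: ennreal_leI powr_mono2)

lemma enn_powr_mult: "enn_powr (x * y) r = enn_powr x r * enn_powr y r"
proof (cases x; cases y)
  fix a b assume "x = ennreal a" "y = ennreal b" "0 \<le> a" "0 \<le> b"
  then show ?thesis by (simp add: powr_mult flip: ennreal_mult)
next
  fix a assume *: "x = ennreal a" "0 \<le> a" "y = top"
  show ?thesis by (cases "a = 0") (auto simp: * ennreal_mult_top ennreal_top_mult)
next
  fix a assume *: "x = top" "0 \<le> a" "y = ennreal a"
  show ?thesis by (cases "a = 0") (auto simp: * ennreal_mult_top ennreal_top_mult)
qed auto

lemma enn_powr_powr: "enn_powr (enn_powr x r) s = enn_powr x (r * s)"
  by (cases x) (auto simp: powr_powr)

lemma borel_measurable_enn_powr [measurable (raw)]: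
  assumes [measurable]: "f \<in> borel_measurable M"
  shows "(\<lambda>x. enn_powr (f x) r) \<in> borel_measurable M"
  unfolding enn_powr_def by measurable

text \<open>
  The Calderon product. With \<open>0 * \<infinity> = 0\<close> it vanishes as soon as one factor does.
\<close>
definition enn_geo :: "real \<Rightarrow> ennreal \<Rightarrow> ennreal \<Rightarrow> ennreal" where
  "enn_geo \<theta> x y = enn_powr x (1 - \<theta>) * enn_powr y \<theta>"

lemma enn_geo_mono:
  "x \<le> x' \<Longrightarrow> y \<le> y' \<Longrightarrow> 0 \<le> \<theta> \<Longrightarrow> \<theta> \<le> 1 \<Longrightarrow> enn_geo \<theta> x y \<le> enn_geo \<theta> x' y'"
  unfolding enn_geo_def by (intro mult_mono enn_powr_mono) auto

lemma enn_geo_mult: "enn_geo \<theta> (c * x) (d * y) = enn_geo \<theta> c d * enn_geo \<theta> x y"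
  by (simp add: enn_geo_def enn_powr_mult mult_ac)

lemma enn_geo_ennreal:
  "0 \<le> x \<Longrightarrow> 0 \<le> y \<Longrightarrow> enn_geo \<theta> (ennreal x) (ennreal y) = ennreal (x powr (1 - \<theta>) * y powr \<theta>)"
  by (simp add: enn_geo_def ennreal_mult)

lemma enn_geo_0 [simp]: "enn_geo \<theta> 0 y = 0" "enn_geo \<theta> x 0 = 0" "enn_geo \<theta> 1 1 = 1"
  by (auto simp: enn_geo_def)

lemma borel_measurable_enn_geo [measurable (raw)]:
  assumes [measurable]: "f \<in> borel_measurable M" "g \<in> borel_measurable M"
  shows "(\<lambda>x. enn_geo \<theta> (f x) (g x)) \<in> borel_measurable M"
  unfolding enn_geo_def by measurable

text \<open>
  The norm of \<open>L\<^sup>p\<close> with \<open>p = 1 / a\<close>. The interpolation relations between exponents are linear in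
  \<open>a\<close>, and \<open>p = \<infinity>\<close> becomes the ordinary value \<open>a = 0\<close>.
\<close>
definition Lr :: "'a measure \<Rightarrow> real \<Rightarrow> ('a \<Rightarrow> ennreal) \<Rightarrow> ennreal" where
  "Lr M a h = (if a = 0 then esssup M h else enn_powr (\<integral>\<^sup>+ x. enn_powr (h x) (1 / a) \<partial>M) a)"

lemma Lr_mono_AE:
  assumes "0 \<le> a" "f \<in> borel_measurable M" "AE x in M. f x \<le> g x"
  shows "Lr M a f \<le> Lr M a g"
proof (cases "a = 0")
  case True
  then show ?thesis using assms by (simp add: Lr_def esssup_AE_mono)
next
  case False
  have "AE x in M. enn_powr (f x) (1 / a) \<le> enn_powr (g x) (1 / a)"
    using assms(3) by eventually_elim (use assms in \<open>auto intro: enn_powr_mono\<close>)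
  then show ?thesis using False assms
    by (auto simp: Lr_def intro!: enn_powr_mono nn_integral_mono_AE)
qed

lemma Lr_cong_AE:
  assumes "0 \<le> a" "f \<in> borel_measurable M" "g \<in> borel_measurable M" "AE x in M. f x = g x"
  shows "Lr M a f = Lr M a g"
  using assms by (intro antisym Lr_mono_AE) (auto elim!: eventually_mono)

lemma Lr_powr: "a \<noteq> 0 \<Longrightarrow> enn_powr (Lr M a f) (1 / a) = (\<integral>\<^sup>+ x. enn_powr (f x) (1 / a) \<partial>M)"
  by (simp add: Lr_def enn_powr_powr)

lemma Lr_zero: "0 \<le> a \<Longrightarrow> Lr M a (\<lambda>x. 0) = 0"
  by (auto simp: Lr_def intro: antisym[OF esssup_I])

lemma Lr_eq_0D:
  assumes "0 \<le> a" and [measurable]: "f \<in> borel_measurable M" and "Lr M a f = 0"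
  shows "AE x in M. f x = 0"
proof (cases "a = 0")
  case True
  then have "esssup M f = 0" using assms by (simp add: Lr_def)
  with esssup_AE[of f M] show ?thesis by simp
next
  case False
  then have "(\<integral>\<^sup>+ x. enn_powr (f x) (1 / a) \<partial>M) = 0" using assms by (simp add: Lr_def)
  then show ?thesis by (subst (asm) nn_integral_0_iff_AE) auto
qed

lemma Lr_cmult_le:
  assumes "0 \<le> a" and [measurable]: "f \<in> borel_measurable M"
  shows "Lr M a (\<lambda>x. c * f x) \<le> c * Lr M a f"
proof (cases "a = 0")
  case True
  have "AE x in M. c * f x \<le> c * esssup M f"
    using esssup_AE[of f M] by eventually_elim (auto intro: mult_left_mono)
  then show ?thesis using True by (auto simp: Lr_def intro!: esssup_I)
next
  case False
  then show ?thesis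
    using assms by (simp add: Lr_def enn_powr_mult nn_integral_cmult enn_powr_powr)
qed

lemma AE_less_top_of_Lr:
  assumes "0 \<le> a" and [measurable]: "f \<in> borel_measurable M" and "Lr M a f \<noteq> top"
  shows "AE x in M. f x \<noteq> top"
proof (cases "a = 0")
  case True
  then have "esssup M f \<noteq> top" using assms by (simp add: Lr_def)
  with esssup_AE[of f M] show ?thesis by (auto elim!: eventually_mono simp: top_unique)
next
  case False
  then have "(\<integral>\<^sup>+ x. enn_powr (f x) (1 / a) \<partial>M) \<noteq> \<infinity>" using assms by (simp add: Lr_def)
  then have "AE x in M. enn_powr (f x) (1 / a) \<noteq> \<infinity>" by (intro nn_integral_PInf_AE) auto
  then show ?thesis by simp
qed

text \<open>
  Convexity of \<open>t\<^sup>p\<close> applied to \<open>(u + v) / (x + y)\<close> as a convex combination of \<open>u / x\<close> and \<open>v / y\<close>;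
  integrated with \<open>x\<close> and \<open>y\<close> the two norms, it is Minkowski's inequality.
\<close>
lemma powr_convex_bound:
  fixes u v x y p :: real
  assumes "1 \<le> p" "0 \<le> u" "0 \<le> v" "0 < x" "0 < y"
  shows "(u + v) powr p \<le> (x + y) powr p * (x / (x + y)) * (x powr - p) * u powr p
       + (x + y) powr p * (y / (x + y)) * (y powr - p) * v powr p"
proof -
  have conv: "(s * b + t * c) powr p \<le> s * b powr p + t * c powr p"
    if st: "0 \<le> s" "0 \<le> t" "s + t = 1" and bc: "0 \<le> b" "0 \<le> c" for s t b c :: real
  proof (cases "b = 0 \<or> c = 0")
    case False
    then show ?thesis
      using convex_onD[OF powr_convex[OF assms(1)], of t b c] st bc by (simp add: eq_diff_eq[symmetric])
  next
    case True
    have le: "(s * b) powr p \<le> s * b powr p" if "0 \<le> s" "s \<le> 1" "0 \<le> b" for s b :: real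
    proof (cases "s = 0")
      case False
      then have "s powr p \<le> s powr 1" using that assms by (intro powr_mono') auto
      then show ?thesis using that by (auto simp: powr_mult intro!: mult_right_mono)
    qed simp
    then show ?thesis using True st bc by auto
  qed
  have "(u + v) powr p = (x + y) powr p * (x / (x + y) * (u / x) + y / (x + y) * (v / y)) powr p"
  proof -
    have "x / (x + y) * (u / x) + y / (x + y) * (v / y) = (u + v) / (x + y)"
      using assms by (simp add: add_divide_distrib)
    moreover have "u + v = (x + y) * ((u + v) / (x + y))" using assms by simp
    ultimately show ?thesis
      using assms by (simp only: powr_mult[symmetric])
  qed
  also have "(x / (x + y) * (u / x) + y / (x + y) * (v / y)) powr p
      \<le> x / (x + y) * (u / x) powr p + y / (x + y) * (v / y) powr p"
    using assms by (intro conv) (auto simp flip: add_divide_distrib)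
  also have "x / (x + y) * (u / x) powr p + y / (x + y) * (v / y) powr p
      = x / (x + y) * x powr - p * u powr p + y / (x + y) * y powr - p * v powr p"
    using assms by (simp add: powr_divide powr_minus_divide)
  finally have "(u + v) powr p \<le> (x + y) powr p *
      (x / (x + y) * x powr - p * u powr p + y / (x + y) * y powr - p * v powr p)"
    by (simp only: mult_left_mono powr_ge_zero)
  then show ?thesis
    by (simp only: distrib_left mult.assoc)
qed

lemma Lr_triangle:
  assumes a: "0 \<le> a" "a \<le> 1" and [measurable]: "f \<in> borel_measurable M" "g \<in> borel_measurable M"
  shows "Lr M a (\<lambda>x. f x + g x) \<le> Lr M a f + Lr M a g"
proof (cases "a = 0")
  case True
  have "AE x in M. f x + g x \<le> esssup M f + esssup M g"
    using esssup_AE[of f M] esssup_AE[of g M] by eventually_elim (rule add_mono)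
  then show ?thesis using True by (auto simp: Lr_def intro!: esssup_I)
next
  case a0: False
  consider "Lr M a f = top \<or> Lr M a g = top" | "Lr M a f = 0" | "Lr M a g = 0"
    | x y where "Lr M a f = ennreal x" "Lr M a g = ennreal y" "0 < x" "0 < y"
    by (cases "Lr M a f"; cases "Lr M a g") (auto simp: order.strict_iff_order)
  then show ?thesis
  proof cases
    case 1
    then show ?thesis by auto
  next
    case 2
    then have "AE x in M. f x + g x = g x" using Lr_eq_0D[of a f M] a by auto
    then have "Lr M a (\<lambda>x. f x + g x) = Lr M a g" using a by (intro Lr_cong_AE) auto
    then show ?thesis by simp
  next
    case 3
    then have "AE x in M. f x + g x = f x" using Lr_eq_0D[of a g M] a by auto
    then have "Lr M a (\<lambda>x. f x + g x) = Lr M a f" using a by (intro Lr_cong_AE) auto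
    then show ?thesis by simp
  next
    case 4
    define p where "p = 1 / a"
    have p: "1 \<le> p" using a a0 by (simp add: p_def)
    define c where "c = (x + y) powr p * (x / (x + y)) * (x powr - p)"
    define d where "d = (x + y) powr p * (y / (x + y)) * (y powr - p)"
    have cd: "0 \<le> c" "0 \<le> d" using 4 by (auto simp: c_def d_def)
    have fin: "AE z in M. f z \<noteq> top" "AE z in M. g z \<noteq> top"
      using 4 a by (auto intro!: AE_less_top_of_Lr)
    have ints: "(\<integral>\<^sup>+ z. enn_powr (f z) p \<partial>M) = ennreal (x powr p)" "(\<integral>\<^sup>+ z. enn_powr (g z) p \<partial>M) = ennreal (y powr p)"
      using Lr_powr[OF a0, of M f] Lr_powr[OF a0, of M g] 4 by (simp_all add: p_def)
    have "AE z in M. enn_powr (f z + g z) p \<le> ennreal c * enn_powr (f z) p + ennreal d * enn_powr (g z) p"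
      using fin
    proof eventually_elim
      case (elim z)
      then obtain u v where "f z = ennreal u" "g z = ennreal v" "0 \<le> u" "0 \<le> v" 
        by (cases "f z"; cases "g z") auto
      then show ?case
        using powr_convex_bound[OF p, of u v x y] 4 cd
        by (auto simp: c_def d_def simp flip: ennreal_plus ennreal_mult intro!: ennreal_leI)
    qed
    then have "(\<integral>\<^sup>+ z. enn_powr (f z + g z) p \<partial>M)
        \<le> (\<integral>\<^sup>+ z. ennreal c * enn_powr (f z) p + ennreal d * enn_powr (g z) p \<partial>M)"
      by (rule nn_integral_mono_AE)
    also have "\<dots> = ennreal c * ennreal (x powr p) + ennreal d * ennreal (y powr p)"
      by (simp add: nn_integral_add nn_integral_cmult ints)
    also have "\<dots> = ennreal (c * x powr p + d * y powr p)"
      using cd by (simp add: ennreal_mult)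
    also have "c * x powr p + d * y powr p = (x + y) powr p"
    proof -
      have "c * x powr p + d * y powr p = (x + y) powr p * (x / (x + y) + y / (x + y))"
        using 4 by (simp add: c_def d_def mult.assoc distrib_left flip: powr_add)
      also have "x / (x + y) + y / (x + y) = 1" using 4 by (simp flip: add_divide_distrib)
      finally show ?thesis by simp
    qed
    finally have "enn_powr (\<integral>\<^sup>+ z. enn_powr (f z + g z) p \<partial>M) a \<le> enn_powr (ennreal ((x + y) powr p)) a"
      using a by (intro enn_powr_mono)
    also have "\<dots> = ennreal (x + y)" using 4 a0 by (simp add: powr_powr p_def)
    finally show ?thesis using 4 a0 by (simp add: Lr_def p_def)
  qed
qed

text \<open>
  Young's inequality for the normalised functions, with weights \<open>(1 - \<theta>) a0 / a\<close> and \<open>\<theta> a1 / a\<close>. For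
  \<open>a0 = 0\<close> the first weight vanishes and the bound \<open>u \<le> x\<close> takes its place, so that one formula
  covers all combinations of finite and infinite exponents.
\<close>
lemma holder_young_bound:
  fixes u v x y a a0 a1 \<theta> :: real
  assumes \<theta>: "0 < \<theta>" "\<theta> < 1" and a: "a = (1 - \<theta>) * a0 + \<theta> * a1" "0 < a" "0 \<le> a0" "0 \<le> a1"
    and uv: "0 \<le> u" "0 \<le> v" and xy: "0 < x" "0 < y" and le: "a0 = 0 \<Longrightarrow> u \<le> x" "a1 = 0 \<Longrightarrow> v \<le> y"
  shows "(u powr (1 - \<theta>) * v powr \<theta>) powr (1 / a) \<le> (x powr (1 - \<theta>) * y powr \<theta>) powr (1 / a) *
    ((1 - \<theta>) * a0 / a * (u powr (1 / a0) * x powr - (1 / a0)) + \<theta> * a1 / a * (v powr (1 / a1) * y powr - (1 / a1)))"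
proof (cases "u = 0 \<or> v = 0")
  case True
  then have "(u powr (1 - \<theta>) * v powr \<theta>) powr (1 / a) = 0" by auto
  then show ?thesis using a \<theta> by auto
next
  case False
  then have uv: "0 < u" "0 < v" using uv by auto
  define s where "s = (if a0 = 0 then 1 else (u / x) powr (1 / a0))"
  define t where "t = (if a1 = 0 then 1 else (v / y) powr (1 / a1))"
  have st: "0 < s" "0 < t" using uv xy by (auto simp: s_def t_def)
  have s1: "(u / x) powr ((1 - \<theta>) / a) \<le> s powr ((1 - \<theta>) * a0 / a)"
    using le uv xy a \<theta> by (auto simp: s_def powr_powr intro!: powr_le1)
  have t1: "(v / y) powr (\<theta> / a) \<le> t powr (\<theta> * a1 / a)"
    using le uv xy a \<theta> by (auto simp: t_def powr_powr intro!: powr_le1)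
  have "(1 - \<theta>) * a0 / a + \<theta> * a1 / a = 1" using a by (simp flip: add_divide_distrib)
  then have young: "s powr ((1 - \<theta>) * a0 / a) * t powr (\<theta> * a1 / a) \<le> (1 - \<theta>) * a0 / a * s + \<theta> * a1 / a * t"
    using a \<theta> st by (intro Youngs_inequality_0) auto
  have ux: "u = (u / x) * x" "v = (v / y) * y" using xy by auto
  have "(u powr (1 - \<theta>) * v powr \<theta>) powr (1 / a) = u powr ((1 - \<theta>) / a) * v powr (\<theta> / a)"
    using uv by (simp add: powr_mult powr_powr)
  also have "u powr ((1 - \<theta>) / a) = (u / x) powr ((1 - \<theta>) / a) * x powr ((1 - \<theta>) / a)"
    using uv xy by (simp add: powr_divide)
  also have "v powr (\<theta> / a) = (v / y) powr (\<theta> / a) * y powr (\<theta> / a)"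
    using uv xy by (simp add: powr_divide)
  also have "(u / x) powr ((1 - \<theta>) / a) * x powr ((1 - \<theta>) / a) * ((v / y) powr (\<theta> / a) * y powr (\<theta> / a))
      = (x powr (1 - \<theta>) * y powr \<theta>) powr (1 / a) * ((u / x) powr ((1 - \<theta>) / a) * (v / y) powr (\<theta> / a))"
    using xy by (simp add: powr_mult powr_powr)
  also have "(u / x) powr ((1 - \<theta>) / a) * (v / y) powr (\<theta> / a) \<le> s powr ((1 - \<theta>) * a0 / a) * t powr (\<theta> * a1 / a)"
    using s1 t1 by (intro mult_mono) auto
  also note young
  also have "(1 - \<theta>) * a0 / a * s = (1 - \<theta>) * a0 / a * (u powr (1 / a0) * x powr - (1 / a0))"
    using uv xy by (auto simp: s_def powr_divide powr_minus_divide)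
  also have "\<theta> * a1 / a * t = \<theta> * a1 / a * (v powr (1 / a1) * y powr - (1 / a1))"
    using uv xy by (auto simp: t_def powr_divide powr_minus_divide)
  finally show ?thesis by (simp add: mult_left_mono)
qed

text \<open>
  If one of the norms is \<open>0\<close>, the product vanishes almost everywhere, so the inequality also holds
  when the other norm is \<open>\<infinity>\<close>.
\<close>
lemma Lr_holder:
  assumes \<theta>: "0 < \<theta>" "\<theta> < 1" and a: "a = (1 - \<theta>) * a0 + \<theta> * a1" "0 \<le> a0" "0 \<le> a1"
    and [measurable]: "f \<in> borel_measurable M" "g \<in> borel_measurable M"
  shows "Lr M a (\<lambda>x. enn_geo \<theta> (f x) (g x)) \<le> enn_geo \<theta> (Lr M a0 f) (Lr M a1 g)"
proof (cases "a = 0")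
  case True
  then have a01: "a0 = 0" "a1 = 0"
    using a \<theta> by (smt (verit) mult_nonneg_nonneg mult_pos_pos)+
  have "AE x in M. enn_geo \<theta> (f x) (g x) \<le> enn_geo \<theta> (esssup M f) (esssup M g)"
    using esssup_AE[of f M] esssup_AE[of g M] by eventually_elim (use \<theta> in \<open>auto intro: enn_geo_mono\<close>)
  then show ?thesis using True a01 by (auto simp: Lr_def intro!: esssup_I)
next
  case an: False
  then have a_pos: "0 < a" using a \<theta> by (smt (verit) mult_nonneg_nonneg)
  consider "Lr M a0 f = 0" | "Lr M a1 g = 0"
    | "Lr M a0 f \<noteq> 0" "Lr M a1 g \<noteq> 0" "Lr M a0 f = top \<or> Lr M a1 g = top"
    | x y where "Lr M a0 f = ennreal x" "Lr M a1 g = ennreal y" "0 < x" "0 < y"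
    by (cases "Lr M a0 f"; cases "Lr M a1 g") (auto simp: order.strict_iff_order)
  then show ?thesis
  proof cases
    case 1
    then have "AE x in M. enn_geo \<theta> (f x) (g x) = 0" using Lr_eq_0D[of a0 f M] a by auto
    then have "Lr M a (\<lambda>x. enn_geo \<theta> (f x) (g x)) = Lr M a (\<lambda>x. 0)"
      using a_pos by (intro Lr_cong_AE) auto
    then show ?thesis using a_pos by (simp add: Lr_zero)
  next
    case 2
    then have "AE x in M. enn_geo \<theta> (f x) (g x) = 0" using Lr_eq_0D[of a1 g M] a by auto
    then have "Lr M a (\<lambda>x. enn_geo \<theta> (f x) (g x)) = Lr M a (\<lambda>x. 0)"
      using a_pos by (intro Lr_cong_AE) auto
    then show ?thesis using a_pos by (simp add: Lr_zero)
  next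
    case 3
    then have "enn_geo \<theta> (Lr M a0 f) (Lr M a1 g) = top"
      by (auto simp: enn_geo_def ennreal_mult_eq_top_iff)
    then show ?thesis by simp
  next
    case 4
    define K where "K = (x powr (1 - \<theta>) * y powr \<theta>) powr (1 / a)"
    define A where "A = (1 - \<theta>) * a0 / a"
    define B where "B = \<theta> * a1 / a"
    have AB: "0 \<le> A" "0 \<le> B" "A + B = 1" "a0 = 0 \<Longrightarrow> A = 0" "a1 = 0 \<Longrightarrow> B = 0"
      using \<theta> a a_pos by (auto simp: A_def B_def simp flip: add_divide_distrib)
    have K: "0 \<le> K" by (simp add: K_def)
    have fin: "AE z in M. f z \<noteq> top" "AE z in M. g z \<noteq> top"
      using 4 a AE_less_top_of_Lr[of a0 f M] AE_less_top_of_Lr[of a1 g M] by auto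
    have bdd: "AE z in M. a0 = 0 \<longrightarrow> f z \<le> ennreal x" "AE z in M. a1 = 0 \<longrightarrow> g z \<le> ennreal y"
      using 4 esssup_AE[of f M] esssup_AE[of g M] by (auto simp: Lr_def)
    define c where "c = K * A * x powr - (1 / a0)"
    define d where "d = K * B * y powr - (1 / a1)"
    have cd: "0 \<le> c" "0 \<le> d" using AB K by (auto simp: c_def d_def)
    have "AE z in M. enn_powr (enn_geo \<theta> (f z) (g z)) (1 / a)
        \<le> ennreal c * enn_powr (f z) (1 / a0) + ennreal d * enn_powr (g z) (1 / a1)"
      using fin bdd
    proof eventually_elim
      case (elim z)
      then obtain u v where uv: "f z = ennreal u" "g z = ennreal v" "0 \<le> u" "0 \<le> v" 
        by (cases "f z"; cases "g z") auto
      have "(u powr (1 - \<theta>) * v powr \<theta>) powr (1 / a) \<le> c * u powr (1 / a0) + d * v powr (1 / a1)"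
        using holder_young_bound[OF \<theta> a(1) a_pos a(2,3) uv(3,4) 4(3,4)] elim uv 4
        by (auto simp: K_def A_def B_def c_def d_def algebra_simps)
      then show ?case using uv cd
        by (auto simp: enn_geo_ennreal simp flip: ennreal_plus ennreal_mult intro!: ennreal_leI)
    qed
    then have "(\<integral>\<^sup>+ z. enn_powr (enn_geo \<theta> (f z) (g z)) (1 / a) \<partial>M)
        \<le> (\<integral>\<^sup>+ z. ennreal c * enn_powr (f z) (1 / a0) + ennreal d * enn_powr (g z) (1 / a1) \<partial>M)"
      by (rule nn_integral_mono_AE)
    also have "\<dots> = ennreal c * (\<integral>\<^sup>+ z. enn_powr (f z) (1 / a0) \<partial>M) + ennreal d * (\<integral>\<^sup>+ z. enn_powr (g z) (1 / a1) \<partial>M)"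
      by (simp add: nn_integral_add nn_integral_cmult)
    also have "ennreal c * (\<integral>\<^sup>+ z. enn_powr (f z) (1 / a0) \<partial>M) = ennreal (K * A)"
    proof (cases "a0 = 0")
      case False
      have "ennreal c * (\<integral>\<^sup>+ z. enn_powr (f z) (1 / a0) \<partial>M) = ennreal (c * x powr (1 / a0))"
        using Lr_powr[OF False, of M f] 4 cd by (simp add: ennreal_mult)
      also have "c * x powr (1 / a0) = K * A" using 4 by (simp add: c_def powr_minus)
      finally show ?thesis .
    qed (use AB in \<open>auto simp: c_def\<close>)
    also have "ennreal d * (\<integral>\<^sup>+ z. enn_powr (g z) (1 / a1) \<partial>M) = ennreal (K * B)"
    proof (cases "a1 = 0")
      case False
      have "ennreal d * (\<integral>\<^sup>+ z. enn_powr (g z) (1 / a1) \<partial>M) = ennreal (d * y powr (1 / a1))"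
        using Lr_powr[OF False, of M g] 4 cd by (simp add: ennreal_mult)
      also have "d * y powr (1 / a1) = K * B" using 4 by (simp add: d_def powr_minus)
      finally show ?thesis .
    qed (use AB in \<open>auto simp: d_def\<close>)
    also have "ennreal (K * A) + ennreal (K * B) = ennreal K"
      using AB K by (simp flip: ennreal_plus distrib_left)
    finally have "enn_powr (\<integral>\<^sup>+ z. enn_powr (enn_geo \<theta> (f z) (g z)) (1 / a) \<partial>M) a \<le> enn_powr (ennreal K) a"
      using a_pos by (intro enn_powr_mono) auto
    also have "\<dots> = enn_geo \<theta> (ennreal x) (ennreal y)"
      using 4 a_pos by (simp add: K_def powr_powr enn_geo_ennreal)
    finally show ?thesis using 4 an by (simp add: Lr_def)
  qed
qed

text \<open>
  Converse of Hoelder's inequality: the powers \<open>h\<^sup>b\<^sup>/\<^sup>a n\<^sup>1\<^sup>-\<^sup>b\<^sup>/\<^sup>a\<close> with \<open>b = a0\<close> and \<open>b = a1\<close>, where \<open>n\<close>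
  is the norm of \<open>h\<close>; for \<open>a = 0\<close> or \<open>n = 0\<close> both factors are \<open>h\<close> itself. The factors are functions of
  the values of \<open>h\<close>, so they are constant wherever \<open>h\<close> is.
\<close>
lemma Lr_factorization:
  assumes \<theta>: "0 < \<theta>" "\<theta> < 1" and a: "a = (1 - \<theta>) * a0 + \<theta> * a1" "0 \<le> a0" "0 \<le> a1"
    and h: "h \<in> borel_measurable M" "\<And>x. 0 \<le> h x"
    and fin: "Lr M a (\<lambda>x. ennreal (h x)) \<noteq> top"
  shows "\<exists>\<phi>0 \<phi>1 :: real \<Rightarrow> real. \<phi>0 \<in> borel_measurable borel \<and> \<phi>1 \<in> borel_measurable borel \<and>
    (\<forall>v\<ge>0. 0 \<le> \<phi>0 v \<and> 0 \<le> \<phi>1 v \<and> (\<phi>0 v = 0 \<longleftrightarrow> v = 0) \<and> (\<phi>1 v = 0 \<longleftrightarrow> v = 0)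
        \<and> \<phi>0 v powr (1 - \<theta>) * \<phi>1 v powr \<theta> = v) \<and>
    Lr M a0 (\<lambda>x. ennreal (\<phi>0 (h x))) \<le> Lr M a (\<lambda>x. ennreal (h x)) \<and>
    Lr M a1 (\<lambda>x. ennreal (\<phi>1 (h x))) \<le> Lr M a (\<lambda>x. ennreal (h x))"
proof -
  note [measurable] = h(1)
  have triv: ?thesis if "Lr M a0 (\<lambda>x. ennreal (h x)) \<le> Lr M a (\<lambda>x. ennreal (h x))"
      "Lr M a1 (\<lambda>x. ennreal (h x)) \<le> Lr M a (\<lambda>x. ennreal (h x))"
    using that \<theta> by (intro exI[of _ "\<lambda>v. v"]) (auto simp flip: powr_add)
  consider "a = 0" | "a \<noteq> 0" "Lr M a (\<lambda>x. ennreal (h x)) = 0"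
    | n where "a \<noteq> 0" "Lr M a (\<lambda>x. ennreal (h x)) = ennreal n" "0 < n"
    using fin by (cases "Lr M a (\<lambda>x. ennreal (h x))") (auto simp: order.strict_iff_order)
  then show ?thesis
  proof cases
    case 1
    then have "a0 = 0" "a1 = 0"
      using a \<theta> by (smt (verit) mult_nonneg_nonneg mult_pos_pos)+
    then show ?thesis using 1 by (intro triv) auto
  next
    case 2
    have "0 \<le> a" using a \<theta> by simp
    then have z: "AE x in M. ennreal (h x) = 0" using 2 by (intro Lr_eq_0D[of a]) auto
    have "Lr M b (\<lambda>x. ennreal (h x)) = 0" if "0 \<le> b" for b
      using Lr_cong_AE[OF that _ _ z] Lr_zero[OF that] by simp
    then show ?thesis using a by (intro triv) auto
  next
    case 3
    have a_pos: "0 < a" using a \<theta> 3 by (smt (verit) mult_nonneg_nonneg)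
    define \<phi> where "\<phi> b v = v powr (b / a) * n powr (1 - b / a)" for b v :: real
    have sum1: "(1 - \<theta>) * a0 / a + \<theta> * a1 / a = 1" using a a_pos by (simp flip: add_divide_distrib)
    have prod: "\<phi> a0 v powr (1 - \<theta>) * \<phi> a1 v powr \<theta> = v" if v: "0 < v" for v
    proof -
      have "\<phi> a0 v powr (1 - \<theta>) * \<phi> a1 v powr \<theta>
          = (v powr ((1 - \<theta>) * a0 / a) * v powr (\<theta> * a1 / a))
            * (n powr ((1 - a0 / a) * (1 - \<theta>)) * n powr ((1 - a1 / a) * \<theta>))"
        using v 3 by (simp add: \<phi>_def powr_mult powr_powr mult_ac)
      also have "v powr ((1 - \<theta>) * a0 / a) * v powr (\<theta> * a1 / a) = v"
        using v sum1 by (simp flip: powr_add)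
      also have "n powr ((1 - a0 / a) * (1 - \<theta>)) * n powr ((1 - a1 / a) * \<theta>) = n powr 0"
        using sum1 unfolding powr_add[symmetric] by (intro arg_cong[where f = "\<lambda>r. n powr r"]) (simp add: algebra_simps)
      finally show ?thesis using 3 by simp
    qed
    have \<phi>_norm: "Lr M b (\<lambda>x. ennreal (\<phi> b (h x))) \<le> ennreal n" if b: "0 \<le> b" for b
    proof (cases "b = 0")
      case True
      have "\<phi> b v \<le> n" for v using True 3 by (auto simp: \<phi>_def powr_def)
      then show ?thesis using True by (auto simp: Lr_def \<phi>_def intro!: esssup_I ennreal_leI AE_I2)
    next
      case False
      then have b: "0 < b" using b by simp
      have int: "(\<integral>\<^sup>+ x. ennreal (h x powr (1 / a)) \<partial>M) = ennreal (n powr (1 / a))"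
        using Lr_powr[of a M "\<lambda>x. ennreal (h x)"] 3 h by simp
      have "(\<integral>\<^sup>+ x. enn_powr (ennreal (\<phi> b (h x))) (1 / b) \<partial>M)
          = (\<integral>\<^sup>+ x. ennreal (h x powr (1 / a)) * ennreal (n powr ((1 - b / a) / b)) \<partial>M)"
        using b h a_pos 3 by (intro nn_integral_cong) (simp add: \<phi>_def powr_mult powr_powr flip: ennreal_mult)
      also have "\<dots> = ennreal (n powr (1 / a)) * ennreal (n powr ((1 - b / a) / b))"
        using int by (subst nn_integral_multc) auto
      also have "\<dots> = ennreal (n powr (1 / b))"
        using b a_pos by (simp add: field_simps flip: ennreal_mult powr_add)
      finally show ?thesis using b 3 by (simp add: Lr_def powr_powr)
    qed
    have meas: "\<phi> b \<in> borel_measurable borel" for b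
      unfolding \<phi>_def by measurable
    have sgn: "0 \<le> \<phi> b v \<and> (\<phi> b v = 0 \<longleftrightarrow> v = 0)" for b v
      using 3 by (simp add: \<phi>_def)
    have prod': "\<phi> a0 v powr (1 - \<theta>) * \<phi> a1 v powr \<theta> = v" if "0 \<le> v" for v
      using prod[of v] that sgn[of a0 0] by (cases "v = 0") auto
    show ?thesis
      unfolding 3(2)
      by (intro exI[of _ "\<phi> a0"] exI[of _ "\<phi> a1"] conjI allI impI meas prod' \<phi>_norm a)
         (simp_all add: sgn)
  qed
qed

section \<open>Herz norms in one variable\<close>

definition recip :: "ennreal \<Rightarrow> real" where
  "recip p = enn2real (1 / p)"

definition herz :: "real \<Rightarrow> real \<Rightarrow> real \<Rightarrow> (real \<Rightarrow> ennreal) \<Rightarrow> ennreal" where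
  "herz \<alpha> a b h = Lr (count_space UNIV) a (\<lambda>k. ennreal (2 powr (real_of_int k * \<alpha>)) *
     Lr lebesgue b (\<lambda>t. h t * indicator (dyadic_ring k) t))"

lemma recip_cases:
  assumes "1 \<le> p"
  obtains "p = \<infinity>" "recip p = 0" | r where "p = ennreal r" "1 \<le> r" "recip p = 1 / r"
proof (cases p)
  case (real r)
  then have "1 \<le> r" using assms by (simp flip: ennreal_1)
  moreover have "recip p = 1 / r" using real \<open>1 \<le> r\<close>
    by (simp add: recip_def divide_ennreal flip: ennreal_1)
  ultimately show ?thesis using that real by blast
next
  case top
  then show ?thesis using that by (simp add: recip_def)
qed

lemma recip_bounds:
  assumes "1 \<le> p"
  shows "0 \<le> recip p" "recip p \<le> 1"
  using assms by (cases rule: recip_cases; auto)+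

text \<open>
  Translates the relation between exponents, which lives in \<^typ>\<open>ennreal\<close>, to real numbers.
\<close>
lemma recip_interpolate:
  assumes "1 / p = ennreal (1 - \<theta>) / p0 + ennreal \<theta> / p1" "1 \<le> p0" "1 \<le> p1" "0 \<le> \<theta>" "\<theta> \<le> 1"
  shows "recip p = (1 - \<theta>) * recip p0 + \<theta> * recip p1"
proof -
  have *: "ennreal c / q = ennreal (c * recip q)" if "1 \<le> q" "0 \<le> c" for c q
    using that(1) that(2) by (cases rule: recip_cases) (auto simp: divide_ennreal)
  have "1 / p = ennreal ((1 - \<theta>) * recip p0 + \<theta> * recip p1)"
    using assms recip_bounds[of p0] recip_bounds[of p1] by (simp add: * flip: ennreal_plus)
  then show ?thesis
    using assms recip_bounds[of p0] recip_bounds[of p1] unfolding recip_def[of p]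
    by (simp only: enn2real_ennreal mult_nonneg_nonneg add_nonneg_nonneg diff_ge_0_iff_ge)
qed

lemma Lq_norm_eq:
  assumes "1 \<le> q" shows "Lq_norm q h = Lr lebesgue (recip q) h"
  using assms by (cases rule: recip_cases) (auto simp: Lq_norm_def Lr_def)

lemma nn_integral_count_int:
  fixes f :: "int \<Rightarrow> ennreal"
  shows "(\<integral>\<^sup>+ k. f k \<partial>count_space UNIV) = (\<Sum>i. f (int_decode i))"
  using nn_integral_bij_count_space[OF bij_int_decode, of f] by (simp add: nn_integral_count_space_nat)

lemma infsum_int_eq_nn_integral:
  fixes f :: "int \<Rightarrow> ennreal"
  shows "infsum f UNIV = (\<integral>\<^sup>+ k. f k \<partial>count_space UNIV)"
proof -
  have eq: "infsum f UNIV = (SUP F\<in>{F. finite F \<and> F \<subseteq> UNIV}. sum f F)"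
    by (rule nonneg_infsum_complete) simp
  show ?thesis
  proof (rule antisym)
    have "sum f F \<le> (\<integral>\<^sup>+ k. f k \<partial>count_space UNIV)" if "finite F" for F
    proof -
      have "sum f F = (\<Sum>k\<in>F. f k * indicator F k)" by (intro sum.cong) auto
      also have "\<dots> = (\<integral>\<^sup>+ k. f k * indicator F k \<partial>count_space UNIV)"
        using that by (intro nn_integral_count_space'[symmetric]) auto
      also have "\<dots> \<le> (\<integral>\<^sup>+ k. f k \<partial>count_space UNIV)"
        by (intro nn_integral_mono) (auto simp: indicator_def)
      finally show ?thesis .
    qed
    then show "infsum f UNIV \<le> (\<integral>\<^sup>+ k. f k \<partial>count_space UNIV)"
      unfolding eq by (auto intro: SUP_least)
    have "(\<integral>\<^sup>+ k. f k \<partial>count_space UNIV) = (\<Sum>i. f (int_decode i))"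
      by (rule nn_integral_count_int)
    also have "\<dots> \<le> infsum f UNIV"
    proof (rule suminf_le_const)
      fix n
      have "(\<Sum>i<n. f (int_decode i)) = sum f (int_decode ` {..<n})"
        using bij_int_decode by (subst sum.reindex) (auto simp: bij_def inj_on_def)
      also have "\<dots> \<le> infsum f UNIV" unfolding eq by (auto intro: SUP_upper)
      finally show "(\<Sum>i<n. f (int_decode i)) \<le> infsum f UNIV" .
    qed simp
    finally show "(\<integral>\<^sup>+ k. f k \<partial>count_space UNIV) \<le> infsum f UNIV" .
  qed
qed

lemma SUP_eq_esssup_count:
  fixes f :: "'a \<Rightarrow> ennreal"
  shows "(SUP k. f k) = esssup (count_space UNIV) f"
proof (rule antisym)
  show "(SUP k. f k) \<le> esssup (count_space UNIV) f"
    using esssup_AE[of f "count_space UNIV"] by (auto simp: AE_count_space intro!: SUP_least)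
  show "esssup (count_space UNIV) f \<le> (SUP k. f k)"
    by (auto simp: AE_count_space intro!: esssup_I SUP_upper)
qed

lemma herz_norm_eq:
  assumes p: "1 \<le> p" and q: "1 \<le> q"
  shows "herz_norm \<alpha> p q h = herz \<alpha> (recip p) (recip q) h"
  using p
proof (cases rule: recip_cases)
  case 1
  then show ?thesis
    by (simp add: herz_norm_def herz_def Lq_norm_eq[OF q] SUP_eq_esssup_count Lr_def)
next
  case (2 r)
  have "enn_powr (ennreal (2 powr (real_of_int k * \<alpha>))) r = ennreal (2 powr (real_of_int k * r * \<alpha>))" for k
    by (simp add: powr_powr mult_ac)
  then show ?thesis using 2
    by (simp add: herz_norm_def herz_def Lq_norm_eq[OF q] infsum_int_eq_nn_integral Lr_def[of "count_space UNIV"]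
      enn_powr_mult del: enn_powr_ennreal)
qed

lemma sets_dyadic_ring [measurable]: "dyadic_ring k \<in> sets borel" "dyadic_ring k \<in> sets lebesgue"
proof -
  show "dyadic_ring k \<in> sets borel" unfolding dyadic_ring_def by auto
  then show "dyadic_ring k \<in> sets lebesgue" by (simp add: sets_completionI_sets)
qed

lemma borel_measurable_times_dyadic_ring [measurable (raw)]:
  assumes "h \<in> borel_measurable lebesgue"
  shows "(\<lambda>t. h t * indicator (dyadic_ring k) t :: ennreal) \<in> borel_measurable lebesgue"
proof -
  note [measurable] = assms
  show ?thesis by measurable
qed

lemma herz_mono_AE:
  assumes "0 \<le> a" "0 \<le> b" "f \<in> borel_measurable lebesgue" "AE t in lebesgue. f t \<le> g t"
  shows "herz \<alpha> a b f \<le> herz \<alpha> a b g"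
proof -
  have "AE t in lebesgue. f t * indicator (dyadic_ring k) t \<le> g t * indicator (dyadic_ring k) t" for k
    using assms(4) by eventually_elim (auto intro: mult_right_mono)
  then have "Lr lebesgue b (\<lambda>t. f t * indicator (dyadic_ring k) t) \<le> Lr lebesgue b (\<lambda>t. g t * indicator (dyadic_ring k) t)" for k
    using assms by (intro Lr_mono_AE) auto
  then have "ennreal (2 powr (real_of_int k * \<alpha>)) * Lr lebesgue b (\<lambda>t. f t * indicator (dyadic_ring k) t)
      \<le> ennreal (2 powr (real_of_int k * \<alpha>)) * Lr lebesgue b (\<lambda>t. g t * indicator (dyadic_ring k) t)" for k
    by (intro mult_left_mono) auto
  then show ?thesis
    unfolding herz_def by (intro Lr_mono_AE[OF assms(1)]) auto
qed

lemma herz_cong_AE: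
  assumes "0 \<le> a" "0 \<le> b" "f \<in> borel_measurable lebesgue" "g \<in> borel_measurable lebesgue"
    "AE t in lebesgue. f t = g t"
  shows "herz \<alpha> a b f = herz \<alpha> a b g"
  using assms by (intro antisym herz_mono_AE) (auto elim!: eventually_mono)

lemma herz_cmult_le:
  assumes "0 \<le> a" "0 \<le> b" "f \<in> borel_measurable lebesgue"
  shows "herz \<alpha> a b (\<lambda>t. c * f t) \<le> c * herz \<alpha> a b f"
proof -
  have "herz \<alpha> a b (\<lambda>t. c * f t) \<le> Lr (count_space UNIV) a (\<lambda>k. c * (ennreal (2 powr (real_of_int k * \<alpha>)) *
     Lr lebesgue b (\<lambda>t. f t * indicator (dyadic_ring k) t)))"
    unfolding herz_def
  proof (intro Lr_mono_AE AE_I2 assms)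
    fix k
    have "Lr lebesgue b (\<lambda>t. c * f t * indicator (dyadic_ring k) t) \<le> c * Lr lebesgue b (\<lambda>t. f t * indicator (dyadic_ring k) t)"
      unfolding mult.assoc using assms by (intro Lr_cmult_le) auto
    then have "ennreal (2 powr (real_of_int k * \<alpha>)) * Lr lebesgue b (\<lambda>t. c * f t * indicator (dyadic_ring k) t)
        \<le> ennreal (2 powr (real_of_int k * \<alpha>)) * (c * Lr lebesgue b (\<lambda>t. f t * indicator (dyadic_ring k) t))"
      by (intro mult_left_mono) auto
    then show "ennreal (2 powr (real_of_int k * \<alpha>)) * Lr lebesgue b (\<lambda>t. c * f t * indicator (dyadic_ring k) t)
      \<le> c * (ennreal (2 powr (real_of_int k * \<alpha>)) * Lr lebesgue b (\<lambda>t. f t * indicator (dyadic_ring k) t))"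
      by (simp add: mult_ac)
  qed auto
  also have "\<dots> \<le> c * herz \<alpha> a b f"
    unfolding herz_def using assms by (intro Lr_cmult_le) auto
  finally show ?thesis .
qed

lemma herz_triangle:
  assumes "0 \<le> a" "a \<le> 1" "0 \<le> b" "b \<le> 1" "f \<in> borel_measurable lebesgue" "g \<in> borel_measurable lebesgue"
  shows "herz \<alpha> a b (\<lambda>t. f t + g t) \<le> herz \<alpha> a b f + herz \<alpha> a b g"
proof -
  let ?L = "\<lambda>f k. ennreal (2 powr (real_of_int k * \<alpha>)) * Lr lebesgue b (\<lambda>t. f t * indicator (dyadic_ring k) t)"
  have "Lr lebesgue b (\<lambda>t. (f t + g t) * indicator (dyadic_ring k) t)
      \<le> Lr lebesgue b (\<lambda>t. f t * indicator (dyadic_ring k) t) + Lr lebesgue b (\<lambda>t. g t * indicator (dyadic_ring k) t)" for k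
    unfolding distrib_right using assms by (intro Lr_triangle) auto
  then have "?L (\<lambda>t. f t + g t) k \<le> ?L f k + ?L g k" for k
    unfolding distrib_left[symmetric] by (intro mult_left_mono) auto
  then have "herz \<alpha> a b (\<lambda>t. f t + g t) \<le> Lr (count_space UNIV) a (\<lambda>k. ?L f k + ?L g k)"
    unfolding herz_def by (intro Lr_mono_AE[OF assms(1)]) auto
  also have "\<dots> \<le> herz \<alpha> a b f + herz \<alpha> a b g"
    unfolding herz_def using assms by (intro Lr_triangle) auto
  finally show ?thesis .
qed

lemma herz_holder:
  assumes \<theta>: "0 < \<theta>" "\<theta> < 1" and a: "a = (1 - \<theta>) * a0 + \<theta> * a1" "0 \<le> a0" "0 \<le> a1"
    and b: "b = (1 - \<theta>) * b0 + \<theta> * b1" "0 \<le> b0" "0 \<le> b1" and \<alpha>: "\<alpha> = (1 - \<theta>) * \<alpha>0 + \<theta> * \<alpha>1"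
    and fg: "f \<in> borel_measurable lebesgue" "g \<in> borel_measurable lebesgue"
  shows "herz \<alpha> a b (\<lambda>t. enn_geo \<theta> (f t) (g t)) \<le> enn_geo \<theta> (herz \<alpha>0 a0 b0 f) (herz \<alpha>1 a1 b1 g)"
proof -
  let ?L = "\<lambda>\<alpha> b f k. ennreal (2 powr (real_of_int k * \<alpha>)) * Lr lebesgue b (\<lambda>t. f t * indicator (dyadic_ring k) t)"
  have a0: "0 \<le> a" "0 \<le> b" using a b \<theta> by auto
  have le: "?L \<alpha> b (\<lambda>t. enn_geo \<theta> (f t) (g t)) k \<le> enn_geo \<theta> (?L \<alpha>0 b0 f k) (?L \<alpha>1 b1 g k)" for k
  proof -
    have "(\<lambda>t. enn_geo \<theta> (f t) (g t) * indicator (dyadic_ring k) t)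
        = (\<lambda>t. enn_geo \<theta> (f t * indicator (dyadic_ring k) t) (g t * indicator (dyadic_ring k) t))"
      by (auto simp: indicator_def)
    then have "Lr lebesgue b (\<lambda>t. enn_geo \<theta> (f t) (g t) * indicator (dyadic_ring k) t)
        \<le> enn_geo \<theta> (Lr lebesgue b0 (\<lambda>t. f t * indicator (dyadic_ring k) t)) (Lr lebesgue b1 (\<lambda>t. g t * indicator (dyadic_ring k) t))"
      using Lr_holder[OF \<theta> b, of "\<lambda>t. f t * indicator (dyadic_ring k) t" lebesgue "\<lambda>t. g t * indicator (dyadic_ring k) t"] fg
      by auto
    moreover have "ennreal (2 powr (real_of_int k * \<alpha>))
        = enn_geo \<theta> (ennreal (2 powr (real_of_int k * \<alpha>0))) (ennreal (2 powr (real_of_int k * \<alpha>1)))"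
    proof -
      have "real_of_int k * \<alpha> = real_of_int k * \<alpha>0 * (1 - \<theta>) + real_of_int k * \<alpha>1 * \<theta>"
        by (simp add: \<alpha> algebra_simps)
      then show ?thesis by (simp add: enn_geo_ennreal powr_powr powr_add)
    qed
    ultimately show ?thesis
      by (simp add: enn_geo_mult mult_left_mono)
  qed
  have "herz \<alpha> a b (\<lambda>t. enn_geo \<theta> (f t) (g t)) \<le> Lr (count_space UNIV) a (\<lambda>k. enn_geo \<theta> (?L \<alpha>0 b0 f k) (?L \<alpha>1 b1 g k))"
    unfolding herz_def using a0 le by (intro Lr_mono_AE AE_I2) auto
  also have "\<dots> \<le> enn_geo \<theta> (herz \<alpha>0 a0 b0 f) (herz \<alpha>1 a1 b1 g)"
    unfolding herz_def by (intro Lr_holder[OF \<theta> a]) auto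
  finally show ?thesis .
qed

lemma Lr_count_ge: "c k \<le> Lr (count_space UNIV) a c" if "0 \<le> a"
proof (cases "a = 0")
  case True
  then show ?thesis using esssup_AE[of c "count_space UNIV"] by (simp add: Lr_def AE_count_space)
next
  case False
  have "enn_powr (c k) (1 / a) \<le> (\<integral>\<^sup>+ x. enn_powr (c x) (1 / a) \<partial>count_space UNIV)"
    by (rule nn_integral_ge_point) simp
  then have "enn_powr (enn_powr (c k) (1 / a)) a \<le> enn_powr (\<integral>\<^sup>+ x. enn_powr (c x) (1 / a) \<partial>count_space UNIV) a"
    using that by (intro enn_powr_mono) auto
  then show ?thesis using False by (simp add: Lr_def enn_powr_powr)
qed

text \<open>
  The sequence of the weighted norms over the rings is factored in the outer norm, and on each ring
  the restriction of \<open>h\<close> is factored in the inner norm; the inner factors are then rescaled so that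
  their norms become the factors of that sequence. On a ring where \<open>h\<close> has norm \<open>0\<close> it vanishes
  almost everywhere, and both factors can be \<open>h\<close> itself. The condition on \<open>g\<close> says nothing outside
  the rings because the Herz norm does not see that set.
\<close>
lemma herz_factorization:
  assumes \<theta>: "0 < \<theta>" "\<theta> < 1" and a: "a = (1 - \<theta>) * a0 + \<theta> * a1" "0 \<le> a0" "0 \<le> a1"
    and b: "b = (1 - \<theta>) * b0 + \<theta> * b1" "0 \<le> b0" "0 \<le> b1" and \<alpha>: "\<alpha> = (1 - \<theta>) * \<alpha>0 + \<theta> * \<alpha>1"
    and h: "h \<in> borel_measurable lebesgue" "\<And>t. 0 \<le> h t"
    and fin: "herz \<alpha> a b (\<lambda>t. ennreal (h t)) \<noteq> top"
  shows "\<exists>\<psi>0 \<psi>1 :: int \<Rightarrow> real \<Rightarrow> real.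
    (\<forall>k. \<forall>v\<ge>0. 0 \<le> \<psi>0 k v \<and> 0 \<le> \<psi>1 k v \<and> (\<psi>0 k v = 0 \<longleftrightarrow> v = 0) \<and> (\<psi>1 k v = 0 \<longleftrightarrow> v = 0)
        \<and> \<psi>0 k v powr (1 - \<theta>) * \<psi>1 k v powr \<theta> = v) \<and>
    (\<forall>g. (\<forall>k. \<forall>t\<in>dyadic_ring k. g t = ennreal (\<psi>0 k (h t))) \<longrightarrow> herz \<alpha>0 a0 b0 g \<le> herz \<alpha> a b (\<lambda>t. ennreal (h t))) \<and>
    (\<forall>g. (\<forall>k. \<forall>t\<in>dyadic_ring k. g t = ennreal (\<psi>1 k (h t))) \<longrightarrow> herz \<alpha>1 a1 b1 g \<le> herz \<alpha> a b (\<lambda>t. ennreal (h t)))"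
proof -
  have a0: "0 \<le> a" "0 \<le> b" using a b \<theta> by auto
  define hk where "hk k t = h t * indicator (dyadic_ring k) t" for k t
  have hk0: "0 \<le> hk k t" for k t using h by (simp add: hk_def)
  have hk_meas: "hk k \<in> borel_measurable lebesgue" for k
  proof -
    note [measurable] = h(1)
    show ?thesis unfolding hk_def by measurable
  qed
  have hk_enn: "ennreal (h t) * indicator (dyadic_ring k) t = ennreal (hk k t)" for k t
    by (simp add: hk_def indicator_def)
  define L where "L k = Lr lebesgue b (\<lambda>t. ennreal (hk k t))" for k
  define w where "w \<alpha> k = 2 powr (real_of_int k * \<alpha>)" for \<alpha> k
  have w_pos: "0 < w \<alpha> k" for \<alpha> k by (simp add: w_def)
  have herz_L: "herz \<alpha> a b (\<lambda>t. ennreal (h t)) = Lr (count_space UNIV) a (\<lambda>k. ennreal (w \<alpha> k) * L k)"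
    by (simp add: herz_def hk_enn L_def w_def)
  have L_fin: "L k \<noteq> top" for k
  proof
    assume "L k = top"
    then have "ennreal (w \<alpha> k) * L k = top" using w_pos[of \<alpha> k] by (simp add: ennreal_mult_top)
    then show False using Lr_count_ge[OF a0(1), of "\<lambda>k. ennreal (w \<alpha> k) * L k" k] fin herz_L by (simp add: top_unique)
  qed
  define l where "l k = enn2real (L k)" for k
  have l: "L k = ennreal (l k)" "0 \<le> l k" for k using L_fin[of k] by (simp_all add: l_def less_top)
  define c where "c k = w \<alpha> k * l k" for k
  have c: "0 \<le> c k" "ennreal (w \<alpha> k) * L k = ennreal (c k)" for k
    using l[of k] w_pos[of \<alpha> k] by (simp_all add: c_def ennreal_mult)
  have "\<exists>\<phi>0 \<phi>1 :: real \<Rightarrow> real. \<phi>0 \<in> borel_measurable borel \<and> \<phi>1 \<in> borel_measurable borel \<and>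
    (\<forall>v\<ge>0. 0 \<le> \<phi>0 v \<and> 0 \<le> \<phi>1 v \<and> (\<phi>0 v = 0 \<longleftrightarrow> v = 0) \<and> (\<phi>1 v = 0 \<longleftrightarrow> v = 0)
        \<and> \<phi>0 v powr (1 - \<theta>) * \<phi>1 v powr \<theta> = v) \<and>
    Lr (count_space UNIV) a0 (\<lambda>k. ennreal (\<phi>0 (c k))) \<le> Lr (count_space UNIV) a (\<lambda>k. ennreal (c k)) \<and>
    Lr (count_space UNIV) a1 (\<lambda>k. ennreal (\<phi>1 (c k))) \<le> Lr (count_space UNIV) a (\<lambda>k. ennreal (c k))"
    using fin unfolding herz_L c(2) by (intro Lr_factorization[OF \<theta> a]) (auto simp: c)
  then obtain \<phi>0 \<phi>1 :: "real \<Rightarrow> real" where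
    \<phi>: "\<And>v. 0 \<le> v \<Longrightarrow> 0 \<le> \<phi>0 v" "\<And>v. 0 \<le> v \<Longrightarrow> 0 \<le> \<phi>1 v"
      "\<And>v. 0 \<le> v \<Longrightarrow> \<phi>0 v = 0 \<longleftrightarrow> v = 0" "\<And>v. 0 \<le> v \<Longrightarrow> \<phi>1 v = 0 \<longleftrightarrow> v = 0"
      "\<And>v. 0 \<le> v \<Longrightarrow> \<phi>0 v powr (1 - \<theta>) * \<phi>1 v powr \<theta> = v"
    and \<phi>0_norm: "Lr (count_space UNIV) a0 (\<lambda>k. ennreal (\<phi>0 (c k))) \<le> herz \<alpha> a b (\<lambda>t. ennreal (h t))"
    and \<phi>1_norm: "Lr (count_space UNIV) a1 (\<lambda>k. ennreal (\<phi>1 (c k))) \<le> herz \<alpha> a b (\<lambda>t. ennreal (h t))"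
    unfolding herz_L c(2) by auto
  have "\<forall>k. \<exists>\<rho>0 \<rho>1 :: real \<Rightarrow> real. \<rho>0 \<in> borel_measurable borel \<and> \<rho>1 \<in> borel_measurable borel \<and>
    (\<forall>v\<ge>0. 0 \<le> \<rho>0 v \<and> 0 \<le> \<rho>1 v \<and> (\<rho>0 v = 0 \<longleftrightarrow> v = 0) \<and> (\<rho>1 v = 0 \<longleftrightarrow> v = 0)
        \<and> \<rho>0 v powr (1 - \<theta>) * \<rho>1 v powr \<theta> = v) \<and>
    Lr lebesgue b0 (\<lambda>t. ennreal (\<rho>0 (hk k t))) \<le> Lr lebesgue b (\<lambda>t. ennreal (hk k t)) \<and>
    Lr lebesgue b1 (\<lambda>t. ennreal (\<rho>1 (hk k t))) \<le> Lr lebesgue b (\<lambda>t. ennreal (hk k t))"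
    using L_fin hk_meas hk0 unfolding L_def by (intro allI Lr_factorization[OF \<theta> b])
  then obtain \<rho>0 \<rho>1 :: "int \<Rightarrow> real \<Rightarrow> real" where
    \<rho>_all: "\<And>k. \<rho>0 k \<in> borel_measurable borel \<and> \<rho>1 k \<in> borel_measurable borel \<and>
    (\<forall>v\<ge>0. 0 \<le> \<rho>0 k v \<and> 0 \<le> \<rho>1 k v \<and> (\<rho>0 k v = 0 \<longleftrightarrow> v = 0) \<and> (\<rho>1 k v = 0 \<longleftrightarrow> v = 0)
        \<and> \<rho>0 k v powr (1 - \<theta>) * \<rho>1 k v powr \<theta> = v) \<and>
    Lr lebesgue b0 (\<lambda>t. ennreal (\<rho>0 k (hk k t))) \<le> Lr lebesgue b (\<lambda>t. ennreal (hk k t)) \<and>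
    Lr lebesgue b1 (\<lambda>t. ennreal (\<rho>1 k (hk k t))) \<le> Lr lebesgue b (\<lambda>t. ennreal (hk k t))"
    unfolding choice_iff by blast
  have \<rho>: "\<rho>0 k \<in> borel_measurable borel" "\<rho>1 k \<in> borel_measurable borel"
      "0 \<le> v \<Longrightarrow> 0 \<le> \<rho>0 k v" "0 \<le> v \<Longrightarrow> 0 \<le> \<rho>1 k v"
      "0 \<le> v \<Longrightarrow> \<rho>0 k v = 0 \<longleftrightarrow> v = 0" "0 \<le> v \<Longrightarrow> \<rho>1 k v = 0 \<longleftrightarrow> v = 0"
      "0 \<le> v \<Longrightarrow> \<rho>0 k v powr (1 - \<theta>) * \<rho>1 k v powr \<theta> = v"
      "Lr lebesgue b0 (\<lambda>t. ennreal (\<rho>0 k (hk k t))) \<le> L k" "Lr lebesgue b1 (\<lambda>t. ennreal (\<rho>1 k (hk k t))) \<le> L k" for k v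
    using \<rho>_all[of k] unfolding L_def by auto
  define \<psi> where "\<psi> \<rho> \<phi> \<alpha> k v = (if l k = 0 then v else \<rho> k v * (\<phi> (c k) / (w \<alpha> k * l k)))"
    for \<rho> :: "int \<Rightarrow> real \<Rightarrow> real" and \<phi> :: "real \<Rightarrow> real" and \<alpha> k v
  have norm: "herz \<alpha>' a' b' g \<le> herz \<alpha> a b (\<lambda>t. ennreal (h t))"
    if nn: "0 \<le> a'" "0 \<le> b'" and \<rho>m: "\<And>k. \<rho> k \<in> borel_measurable borel"
      and \<rho>z: "\<And>k. \<rho> k 0 = 0" and \<rho>p: "\<And>k v. 0 \<le> v \<Longrightarrow> 0 \<le> \<rho> k v"
      and \<phi>p: "\<And>v. 0 \<le> v \<Longrightarrow> 0 \<le> \<phi> v"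
      and \<rho>n: "\<And>k. Lr lebesgue b' (\<lambda>t. ennreal (\<rho> k (hk k t))) \<le> L k"
      and \<phi>n: "Lr (count_space UNIV) a' (\<lambda>k. ennreal (\<phi> (c k))) \<le> herz \<alpha> a b (\<lambda>t. ennreal (h t))"
      and g: "\<forall>k. \<forall>t\<in>dyadic_ring k. g t = ennreal (\<psi> \<rho> \<phi> \<alpha>' k (h t))"
    for \<alpha>' a' b' g \<rho> \<phi>
  proof -
    have le: "ennreal (w \<alpha>' k) * Lr lebesgue b' (\<lambda>t. g t * indicator (dyadic_ring k) t) \<le> ennreal (\<phi> (c k))" for k
    proof (cases "l k = 0")
      case True
      then have z: "AE t in lebesgue. ennreal (hk k t) = 0"
        using l[of k] hk_meas a0 unfolding L_def by (intro Lr_eq_0D[of b]) auto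
      have "(\<lambda>t. g t * indicator (dyadic_ring k) t) = (\<lambda>t. ennreal (hk k t))"
        using g True by (auto simp: \<psi>_def hk_def indicator_def)
      then have "Lr lebesgue b' (\<lambda>t. g t * indicator (dyadic_ring k) t) = 0"
        using Lr_cong_AE[OF nn(2) _ _ z] Lr_zero[OF nn(2)] hk_meas[of k] by simp
      then show ?thesis by simp
    next
      case False
      then have lp: "0 < l k" using l(2)[of k] by simp
      have cn: "0 \<le> \<phi> (c k) / (w \<alpha>' k * l k)" using \<phi>p[OF c(1)] w_pos[of \<alpha>' k] lp by simp
      have "(\<lambda>t. g t * indicator (dyadic_ring k) t) = (\<lambda>t. ennreal (\<phi> (c k) / (w \<alpha>' k * l k)) * ennreal (\<rho> k (hk k t)))"
      proof
        fix t
        show "g t * indicator (dyadic_ring k) t = ennreal (\<phi> (c k) / (w \<alpha>' k * l k)) * ennreal (\<rho> k (hk k t))"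
        proof (cases "t \<in> dyadic_ring k")
          case True
          then have "g t = ennreal (\<rho> k (h t) * (\<phi> (c k) / (w \<alpha>' k * l k)))"
            using g False by (simp add: \<psi>_def)
          also have "\<dots> = ennreal (\<phi> (c k) / (w \<alpha>' k * l k)) * ennreal (\<rho> k (h t))"
            using cn \<rho>p[OF h(2)] by (subst mult.commute) (rule ennreal_mult)
          finally show ?thesis using True by (simp add: hk_def)
        qed (simp add: hk_def \<rho>z)
      qed
      then have "Lr lebesgue b' (\<lambda>t. g t * indicator (dyadic_ring k) t)
          \<le> ennreal (\<phi> (c k) / (w \<alpha>' k * l k)) * Lr lebesgue b' (\<lambda>t. ennreal (\<rho> k (hk k t)))"
        using nn measurable_compose[OF hk_meas[of k] \<rho>m[of k]] by (simp add: Lr_cmult_le)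
      also have "\<dots> \<le> ennreal (\<phi> (c k) / (w \<alpha>' k * l k)) * ennreal (l k)"
        using \<rho>n[of k] l(1)[of k] by (intro mult_left_mono) auto
      also have "\<dots> = ennreal (\<phi> (c k) / w \<alpha>' k)"
        using cn lp by (simp flip: ennreal_mult)
      finally have "ennreal (w \<alpha>' k) * Lr lebesgue b' (\<lambda>t. g t * indicator (dyadic_ring k) t)
          \<le> ennreal (w \<alpha>' k) * ennreal (\<phi> (c k) / w \<alpha>' k)"
        by (intro mult_left_mono) auto
      also have "\<dots> = ennreal (\<phi> (c k))"
        using \<phi>p[OF c(1)] w_pos[of \<alpha>' k] by (simp flip: ennreal_mult)
      finally show ?thesis .
    qed
    have "herz \<alpha>' a' b' g \<le> Lr (count_space UNIV) a' (\<lambda>k. ennreal (\<phi> (c k)))"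
      unfolding herz_def w_def[symmetric] using le by (intro Lr_mono_AE[OF nn(1)]) auto
    with \<phi>n show ?thesis by (rule order_trans[rotated])
  qed
  have prod: "\<psi> \<rho>0 \<phi>0 \<alpha>0 k v powr (1 - \<theta>) * \<psi> \<rho>1 \<phi>1 \<alpha>1 k v powr \<theta> = v" if v: "0 \<le> v" for k v
  proof (cases "l k = 0")
    case True
    then show ?thesis using v by (cases "v = 0") (auto simp: \<psi>_def simp flip: powr_add)
  next
    case False
    then have lp: "0 < l k" using l(2)[of k] by simp
    have wprod: "w \<alpha>0 k powr (1 - \<theta>) * w \<alpha>1 k powr \<theta> = w \<alpha> k"
    proof -
      have "real_of_int k * \<alpha> = real_of_int k * \<alpha>0 * (1 - \<theta>) + real_of_int k * \<alpha>1 * \<theta>"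
        by (simp add: \<alpha> algebra_simps)
      then show ?thesis by (simp add: w_def powr_powr powr_add)
    qed
    have "\<psi> \<rho>0 \<phi>0 \<alpha>0 k v powr (1 - \<theta>) * \<psi> \<rho>1 \<phi>1 \<alpha>1 k v powr \<theta>
      = (\<rho>0 k v powr (1 - \<theta>) * \<rho>1 k v powr \<theta>) * (\<phi>0 (c k) powr (1 - \<theta>) * \<phi>1 (c k) powr \<theta>)
        / ((w \<alpha>0 k powr (1 - \<theta>) * w \<alpha>1 k powr \<theta>) * (l k powr (1 - \<theta>) * l k powr \<theta>))"
      using False by (simp add: \<psi>_def powr_mult powr_divide mult_ac)
    also have "\<dots> = v * c k / (w \<alpha> k * l k)"
      unfolding wprod \<rho>(7)[OF v] \<phi>(5)[OF c(1)] using lp by (simp flip: powr_add)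
    also have "\<dots> = v" using lp w_pos[of \<alpha> k] by (simp add: c_def)
    finally show ?thesis .
  qed
  have cz: "c k \<noteq> 0" if "l k \<noteq> 0" for k using that w_pos[of \<alpha> k] by (simp add: c_def)
  have sgn0: "0 \<le> \<psi> \<rho>0 \<phi>0 \<alpha>0 k v" "\<psi> \<rho>0 \<phi>0 \<alpha>0 k v = 0 \<longleftrightarrow> v = 0" if "0 \<le> v" for k v
    using that \<rho>(3)[OF that, of k] \<rho>(5)[OF that, of k] \<phi>(1)[OF c(1)[of k]] \<phi>(3)[OF c(1)[of k]] w_pos[of \<alpha>0 k] l(2)[of k] cz[of k]
    by (auto simp: \<psi>_def)
  have sgn1: "0 \<le> \<psi> \<rho>1 \<phi>1 \<alpha>1 k v" "\<psi> \<rho>1 \<phi>1 \<alpha>1 k v = 0 \<longleftrightarrow> v = 0" if "0 \<le> v" for k v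
    using that \<rho>(4)[OF that, of k] \<rho>(6)[OF that, of k] \<phi>(2)[OF c(1)[of k]] \<phi>(4)[OF c(1)[of k]] w_pos[of \<alpha>1 k] l(2)[of k] cz[of k]
    by (auto simp: \<psi>_def)
  have "herz \<alpha>0 a0 b0 g \<le> herz \<alpha> a b (\<lambda>t. ennreal (h t))"
    if "\<forall>k. \<forall>t\<in>dyadic_ring k. g t = ennreal (\<psi> \<rho>0 \<phi>0 \<alpha>0 k (h t))" for g
    by (rule norm[OF a(2) b(2) \<rho>(1) _ \<rho>(3) \<phi>(1) \<rho>(8) \<phi>0_norm that]) (simp_all add: \<rho>(5))
  moreover have "herz \<alpha>1 a1 b1 g \<le> herz \<alpha> a b (\<lambda>t. ennreal (h t))"
    if "\<forall>k. \<forall>t\<in>dyadic_ring k. g t = ennreal (\<psi> \<rho>1 \<phi>1 \<alpha>1 k (h t))" for g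
    by (rule norm[OF a(3) b(3) \<rho>(2) _ \<rho>(4) \<phi>(2) \<rho>(9) \<phi>1_norm that]) (simp_all add: \<rho>(6))
  ultimately show ?thesis
    using sgn0 sgn1 prod
    by (intro exI[of _ "\<psi> \<rho>0 \<phi>0 \<alpha>0"] exI[of _ "\<psi> \<rho>1 \<phi>1 \<alpha>1"] conjI allI impI) simp_all
qed

section \<open>Iterated norms of Lebesgue measurable functions\<close>

definition vec_upd :: "real ^ 'n \<Rightarrow> 'n \<Rightarrow> real \<Rightarrow> real ^ 'n" where
  "vec_upd x i t = (\<chi> l. if l = i then t else x $ l)"

lemma vec_upd_nth [simp]: "vec_upd x i t $ l = (if l = i then t else x $ l)"
  by (simp add: vec_upd_def)

lemma vec_upd_shift: "vec_upd x i t = x + (t - x \<bullet> axis i 1) *\<^sub>R axis i 1"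
proof -
  have "x \<bullet> axis i 1 = x $ i" by (simp add: inner_axis)
  then show ?thesis by (simp add: vec_eq_iff axis_def)
qed

lemma borel_measurable_vec_upd [measurable (raw)]:
  assumes [measurable]: "f \<in> borel_measurable M" "g \<in> borel_measurable M"
  shows "(\<lambda>z. vec_upd (f z) i (g z)) \<in> borel_measurable M"
  unfolding vec_upd_shift by measurable

lemma AE_lborel_translate:
  fixes c :: "'a::euclidean_space"
  assumes "AE x in lborel. P x"
  shows "AE x in lborel. P (c + x)"
proof -
  from assms obtain N where N: "{x. \<not> P x} \<subseteq> N" "N \<in> null_sets lborel"
    by (auto elim!: AE_E simp: null_sets_def)
  have "AE x in distr lborel borel ((+) c). x \<notin> N"
    unfolding lborel_distr_plus using N by (rule_tac AE_not_in) auto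
  then have "AE x in lborel. c + x \<notin> N"
    using N by (subst (asm) AE_distr_iff) (auto simp: null_sets_def pred_def)
  then show ?thesis by eventually_elim (use N in auto)
qed

text \<open>
  Fubini's theorem for null sets and one coordinate: replacing a coordinate
  is a translation along an axis, and Lebesgue measure is invariant under translations. For a null
  set \<open>N\<close> this makes the double integral of the indicator of \<open>N\<close> at \<open>x + t e\<^sub>i\<close> vanish for either
  order of integration.
\<close>
lemma AE_vec_upd:
  fixes P :: "real ^ 'n \<Rightarrow> bool"
  assumes "AE x in lebesgue. P x"
  shows "AE x in lebesgue. AE t in lebesgue. P (vec_upd x i t)"
proof -
  let ?e = "axis i (1 :: real)"
  from assms have "AE x in lborel. P x" by (simp add: AE_completion_iff)
  then obtain N where N: "{x. \<not> P x} \<subseteq> N" "N \<in> null_sets lborel"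
    by (auto elim!: AE_E simp: null_sets_def)
  then have [measurable]: "N \<in> sets borel" by auto
  define D :: "real ^ 'n \<Rightarrow> real \<Rightarrow> ennreal" where "D x t = indicator N (x + t *\<^sub>R ?e)" for x t
  have D [measurable]: "case_prod D \<in> borel_measurable (lborel \<Otimes>\<^sub>M lborel)"
    unfolding D_def by measurable
  have zero: "(\<integral>\<^sup>+ x. D x t \<partial>lborel) = 0" for t
  proof -
    have "AE x in lborel. t *\<^sub>R ?e + x \<notin> N"
      using N by (intro AE_lborel_translate AE_not_in) auto
    then have "AE x in lborel. D x t = 0"
      by eventually_elim (auto simp: D_def add.commute)
    then show ?thesis by (subst nn_integral_0_iff_AE) (auto simp: D_def)
  qed
  have "(\<integral>\<^sup>+ x. \<integral>\<^sup>+ t. D x t \<partial>lborel \<partial>lborel) = 0"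
    using lborel_pair.Fubini'[OF D] by (simp add: zero)
  then have "AE x in lborel. (\<integral>\<^sup>+ t. D x t \<partial>lborel) = 0"
    by (subst (asm) nn_integral_0_iff_AE) auto
  then have "AE x in lborel. AE t in lebesgue. P (vec_upd x i t)"
  proof eventually_elim
    case (elim x)
    then have "AE t in lborel. D x t = 0"
      by (subst (asm) nn_integral_0_iff_AE) (auto simp: D_def)
    then have "AE t in lborel. D x (- (x \<bullet> ?e) + t) = 0" by (rule AE_lborel_translate)
    then have "AE t in lborel. P (vec_upd x i t)"
      by eventually_elim (use N in \<open>auto simp: D_def vec_upd_shift indicator_eq_0_iff\<close>)
    then show ?case by (simp add: AE_completion_iff)
  qed
  then show ?thesis by (simp add: AE_completion_iff)
qed

lemma borel_measurable_lebesgue_cong_AE: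
  fixes f g :: "'a::euclidean_space \<Rightarrow> 'b::topological_space"
  assumes "g \<in> borel_measurable lebesgue" "AE x in lebesgue. f x = g x"
  shows "f \<in> borel_measurable lebesgue"
proof (rule measurableI)
  fix A :: "'b set" assume A: "A \<in> sets borel"
  have "g -` A \<in> sets lebesgue" using measurable_sets[OF assms(1) A] by simp
  moreover have "AE x in lebesgue. x \<in> g -` A \<longleftrightarrow> x \<in> f -` A"
    using assms(2) by eventually_elim auto
  ultimately show "f -` A \<inter> space lebesgue \<in> sets lebesgue"
    by (auto intro: completion.in_sets_AE[rotated])
qed auto

lemma lebesgue_borel_version:
  fixes F :: "'a::euclidean_space \<Rightarrow> ennreal"
  assumes "F \<in> borel_measurable lebesgue"
  obtains G where "G \<in> borel_measurable borel" "AE x in lebesgue. F x = G x"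
  using completion_ex_borel_measurable[OF assms] by (auto simp: AE_completion_iff)

text \<open>
  Only almost every section is measurable, because a Lebesgue measurable function may be arbitrary
  on a null set.
\<close>
lemma AE_section_measurable:
  fixes F :: "real ^ 'n \<Rightarrow> ennreal"
  assumes "F \<in> borel_measurable lebesgue"
  shows "AE x in lebesgue. (\<lambda>t. F (vec_upd x i t)) \<in> borel_measurable lebesgue"
proof -
  obtain G where [measurable]: "G \<in> borel_measurable borel" and G: "AE x in lebesgue. F x = G x"
    using assms by (rule lebesgue_borel_version)
  from AE_vec_upd[OF G, of i] show ?thesis
  proof eventually_elim
    case (elim x)
    have "(\<lambda>t. G (vec_upd x i t)) \<in> borel_measurable borel" by measurable
    then have "(\<lambda>t. G (vec_upd x i t)) \<in> borel_measurable lebesgue"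
      by (simp add: measurable_completion)
    then show ?case using elim by (rule borel_measurable_lebesgue_cong_AE)
  qed
qed

text \<open>
  For the essential supremum, the sublevel sets are the zero sets of parametrised integrals.
\<close>
lemma borel_measurable_Lr_lebesgue:
  fixes G :: "'a::euclidean_space \<Rightarrow> real \<Rightarrow> ennreal"
  assumes [measurable]: "case_prod G \<in> borel_measurable (borel \<Otimes>\<^sub>M borel)"
  shows "(\<lambda>x. Lr lebesgue b (G x)) \<in> borel_measurable borel"
proof (cases "b = 0")
  case False
  have "case_prod (\<lambda>x t. enn_powr (G x t) (1 / b)) \<in> borel_measurable (borel \<Otimes>\<^sub>M lborel)" by measurable
  then have "(\<lambda>x. \<integral>\<^sup>+ t. enn_powr (G x t) (1 / b) \<partial>lborel) \<in> borel_measurable borel"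
    by (rule lborel.borel_measurable_nn_integral)
  then show ?thesis using False by (simp add: Lr_def nn_integral_completion)
next
  case True
  have [measurable]: "G x \<in> borel_measurable borel" for x
    using measurable_Pair2[OF assms, of x] by simp
  have "(\<lambda>x. esssup lebesgue (G x)) \<in> borel_measurable borel"
  proof (rule borel_measurableI_le)
    fix z
    have "esssup lebesgue (G x) \<le> z \<longleftrightarrow> (\<integral>\<^sup>+ t. indicator {t. z < G x t} t \<partial>lborel) = 0" for x
    proof -
      have "esssup lebesgue (G x) \<le> z \<longleftrightarrow> (AE t in lebesgue. G x t \<le> z)"
      proof
        assume "esssup lebesgue (G x) \<le> z"
        then show "AE t in lebesgue. G x t \<le> z"
          using esssup_AE[of "G x" lebesgue] by (auto elim!: eventually_mono)
      next
        assume "AE t in lebesgue. G x t \<le> z"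
        then show "esssup lebesgue (G x) \<le> z"
          by (intro esssup_I) (auto intro: measurable_completion)
      qed
      also have "\<dots> \<longleftrightarrow> (AE t in lborel. indicator {t. z < G x t} t = (0 :: ennreal))"
        by (simp add: AE_completion_iff indicator_eq_0_iff not_less)
      also have "\<dots> \<longleftrightarrow> (\<integral>\<^sup>+ t. indicator {t. z < G x t} t \<partial>lborel) = 0"
        by (subst nn_integral_0_iff_AE) auto
      finally show ?thesis .
    qed
    moreover have "(\<lambda>x. \<integral>\<^sup>+ t. indicator {t. z < G x t} t \<partial>lborel) \<in> borel_measurable borel"
    proof (rule lborel.borel_measurable_nn_integral)
      have "(\<lambda>p. indicator {p. z < case_prod G p} p :: ennreal) \<in> borel_measurable (borel \<Otimes>\<^sub>M borel)"
        by measurable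
      moreover have "case_prod (\<lambda>x t. indicator {t. z < G x t} t) = (\<lambda>p. indicator {p. z < case_prod G p} p :: ennreal)"
        by (auto simp: indicator_def fun_eq_iff)
      ultimately show "case_prod (\<lambda>x t. indicator {t. z < G x t} t :: ennreal) \<in> borel_measurable (borel \<Otimes>\<^sub>M lborel)"
        by simp
    qed
    ultimately show "{x \<in> space borel. esssup lebesgue (G x) \<le> z} \<in> sets borel" by simp
  qed
  then show ?thesis using True by (simp add: Lr_def)
qed

lemma borel_measurable_Lr_count_int:
  fixes c :: "int \<Rightarrow> 'a \<Rightarrow> ennreal"
  assumes [measurable]: "\<And>k. c k \<in> borel_measurable M"
  shows "(\<lambda>x. Lr (count_space UNIV) a (\<lambda>k. c k x)) \<in> borel_measurable M"
proof (cases "a = 0")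
  case True
  have "(\<lambda>x. SUP k. c k x) \<in> borel_measurable M" by measurable
  then show ?thesis using True by (simp add: Lr_def SUP_eq_esssup_count)
next
  case False
  have "(\<lambda>x. enn_powr (\<Sum>i. enn_powr (c (int_decode i) x) (1 / a)) a) \<in> borel_measurable M"
    by measurable
  then show ?thesis using False by (simp add: Lr_def nn_integral_count_int)
qed

lemma borel_measurable_herz_section:
  fixes F :: "real ^ 'n \<Rightarrow> ennreal"
  assumes [measurable]: "F \<in> borel_measurable borel"
  shows "(\<lambda>x. herz \<alpha> a b (\<lambda>t. F (vec_upd x i t))) \<in> borel_measurable borel"
  unfolding herz_def
proof (intro borel_measurable_Lr_count_int borel_measurable_times_ennreal borel_measurable_Lr_lebesgue)
  show "(\<lambda>(x, t). F (vec_upd x i t) * indicator (dyadic_ring k) t) \<in> borel_measurable (borel \<Otimes>\<^sub>M borel)" for k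
    by measurable
qed auto

definition coord_herz :: "('n \<Rightarrow> real) \<Rightarrow> ('n \<Rightarrow> real) \<Rightarrow> ('n \<Rightarrow> real) \<Rightarrow> 'n \<Rightarrow> (real ^ 'n \<Rightarrow> ennreal) \<Rightarrow> real ^ 'n \<Rightarrow> ennreal" where
  "coord_herz \<alpha> a b i F = (\<lambda>x. herz (\<alpha> i) (a i) (b i) (\<lambda>t. F (vec_upd x i t)))"

definition unit_range :: "('n \<Rightarrow> real) \<Rightarrow> bool" where
  "unit_range a \<longleftrightarrow> (\<forall>i. 0 \<le> a i \<and> a i \<le> 1)"

lemma unit_rangeD: "unit_range a \<Longrightarrow> 0 \<le> a i" "unit_range a \<Longrightarrow> a i \<le> 1"
  by (auto simp: unit_range_def)

text \<open>
  A Borel measurable version of \<open>F\<close> has a Borel measurable iterated norm, and the norm of \<open>F\<close> agrees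
  with it almost everywhere.
\<close>
lemma borel_measurable_coord_herz:
  assumes F: "F \<in> borel_measurable lebesgue" and ab: "unit_range a" "unit_range b"
  shows "coord_herz \<alpha> a b i F \<in> borel_measurable lebesgue"
proof -
  obtain G where G [measurable]: "G \<in> borel_measurable borel" and FG: "AE x in lebesgue. F x = G x"
    using F by (rule lebesgue_borel_version)
  have "coord_herz \<alpha> a b i G \<in> borel_measurable lebesgue"
    unfolding coord_herz_def using borel_measurable_herz_section[OF G] by (auto intro: measurable_completion)
  moreover have "AE x in lebesgue. coord_herz \<alpha> a b i F x = coord_herz \<alpha> a b i G x"
    using AE_section_measurable[OF F, of i] AE_vec_upd[OF FG, of i]
  proof eventually_elim
    case (elim x)
    have "(\<lambda>t. G (vec_upd x i t)) \<in> borel_measurable borel" by measurable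
    then have "(\<lambda>t. G (vec_upd x i t)) \<in> borel_measurable lebesgue"
      by (simp add: measurable_completion)
    then show ?case
      unfolding coord_herz_def using elim ab by (intro herz_cong_AE) (auto simp: unit_rangeD)
  qed
  ultimately show ?thesis by (rule borel_measurable_lebesgue_cong_AE)
qed

lemma fold_coord_herz_cmult:
  assumes "F \<in> borel_measurable lebesgue" "G \<in> borel_measurable lebesgue" "unit_range a" "unit_range b" 
    "AE x in lebesgue. F x \<le> c * G x"
  shows "AE x in lebesgue. fold (coord_herz \<alpha> a b) js F x \<le> c * fold (coord_herz \<alpha> a b) js G x"
  using assms(1,2,5)
proof (induction js arbitrary: F G)
  case (Cons i js)
  have "AE x in lebesgue. coord_herz \<alpha> a b i F x \<le> c * coord_herz \<alpha> a b i G x"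
    using AE_section_measurable[OF Cons.prems(1), of i] AE_section_measurable[OF Cons.prems(2), of i]
      AE_vec_upd[OF Cons.prems(3), of i]
  proof eventually_elim
    case (elim x)
    have "coord_herz \<alpha> a b i F x \<le> herz (\<alpha> i) (a i) (b i) (\<lambda>t. c * G (vec_upd x i t))"
      unfolding coord_herz_def using elim assms by (intro herz_mono_AE) (auto simp: unit_rangeD)
    also have "\<dots> \<le> c * coord_herz \<alpha> a b i G x"
      unfolding coord_herz_def using elim assms by (intro herz_cmult_le) (auto simp: unit_rangeD)
    finally show ?case .
  qed
  then show ?case using Cons assms by (simp add: borel_measurable_coord_herz)
qed simp

lemma fold_coord_herz_triangle:
  assumes "F \<in> borel_measurable lebesgue" "G \<in> borel_measurable lebesgue" "H \<in> borel_measurable lebesgue"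
    "unit_range a" "unit_range b" "AE x in lebesgue. F x \<le> G x + H x"
  shows "AE x in lebesgue. fold (coord_herz \<alpha> a b) js F x \<le> fold (coord_herz \<alpha> a b) js G x + fold (coord_herz \<alpha> a b) js H x"
  using assms(1,2,3,6)
proof (induction js arbitrary: F G H)
  case (Cons i js)
  have "AE x in lebesgue. coord_herz \<alpha> a b i F x \<le> coord_herz \<alpha> a b i G x + coord_herz \<alpha> a b i H x"
    using AE_section_measurable[OF Cons.prems(1), of i] AE_section_measurable[OF Cons.prems(2), of i]
      AE_section_measurable[OF Cons.prems(3), of i] AE_vec_upd[OF Cons.prems(4), of i]
  proof eventually_elim
    case (elim x)
    have "coord_herz \<alpha> a b i F x \<le> herz (\<alpha> i) (a i) (b i) (\<lambda>t. G (vec_upd x i t) + H (vec_upd x i t))"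
      unfolding coord_herz_def using elim assms by (intro herz_mono_AE) (auto simp: unit_rangeD)
    also have "\<dots> \<le> coord_herz \<alpha> a b i G x + coord_herz \<alpha> a b i H x"
      unfolding coord_herz_def using elim assms by (intro herz_triangle) (auto simp: unit_rangeD)
    finally show ?case .
  qed
  then show ?case using Cons assms by (simp add: borel_measurable_coord_herz)
qed simp

text \<open>
  Like the two lemmas before it, this follows by applying the one-variable inequality to almost
  every section, coordinate by coordinate.
\<close>
lemma fold_coord_herz_holder:
  assumes \<theta>: "0 < \<theta>" "\<theta> < 1" and 
    "F \<in> borel_measurable lebesgue" "G \<in> borel_measurable lebesgue" "H \<in> borel_measurable lebesgue"
    and ur: "unit_range a" "unit_range b" "unit_range a0" "unit_range b0" "unit_range a1" "unit_range b1"
    and eq: "\<And>i. a i = (1 - \<theta>) * a0 i + \<theta> * a1 i" "\<And>i. b i = (1 - \<theta>) * b0 i + \<theta> * b1 i"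
      "\<And>i. \<alpha> i = (1 - \<theta>) * \<alpha>0 i + \<theta> * \<alpha>1 i"
    and "AE x in lebesgue. F x \<le> enn_geo \<theta> (G x) (H x)"
  shows "AE x in lebesgue. fold (coord_herz \<alpha> a b) js F x
    \<le> enn_geo \<theta> (fold (coord_herz \<alpha>0 a0 b0) js G x) (fold (coord_herz \<alpha>1 a1 b1) js H x)"
  using assms(3,4,5,15)
proof (induction js arbitrary: F G H)
  case (Cons i js)
  have "AE x in lebesgue. coord_herz \<alpha> a b i F x \<le> enn_geo \<theta> (coord_herz \<alpha>0 a0 b0 i G x) (coord_herz \<alpha>1 a1 b1 i H x)"
    using AE_section_measurable[OF Cons.prems(1), of i] AE_section_measurable[OF Cons.prems(2), of i]
      AE_section_measurable[OF Cons.prems(3), of i] AE_vec_upd[OF Cons.prems(4), of i]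
  proof eventually_elim
    case (elim x)
    have "coord_herz \<alpha> a b i F x \<le> herz (\<alpha> i) (a i) (b i) (\<lambda>t. enn_geo \<theta> (G (vec_upd x i t)) (H (vec_upd x i t)))"
      unfolding coord_herz_def using elim ur by (intro herz_mono_AE) (auto simp: unit_rangeD)
    also have "\<dots> \<le> enn_geo \<theta> (coord_herz \<alpha>0 a0 b0 i G x) (coord_herz \<alpha>1 a1 b1 i H x)"
      unfolding coord_herz_def using elim ur
      by (intro herz_holder \<theta> eq) (auto simp: unit_rangeD)
    finally show ?case .
  qed
  then show ?case using Cons ur by (simp add: borel_measurable_coord_herz)
qed simp

text \<open>
  Each norm removes the dependence on its coordinate; \<open>S\<close> collects the coordinates that have been
  removed already.
\<close>
lemma fold_coord_herz_indep:
  fixes F :: "real ^ 'n \<Rightarrow> ennreal" and x y :: "real ^ 'n"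
  assumes "\<And>x y. (\<And>l. l \<notin> S \<Longrightarrow> x $ l = y $ l) \<Longrightarrow> F x = F y"
    and "\<And>l. l \<notin> S \<union> set js \<Longrightarrow> x $ l = y $ l"
  shows "fold (coord_herz \<alpha> a b) js F x = fold (coord_herz \<alpha> a b) js F y"
  using assms
proof (induction js arbitrary: F S)
  case Nil
  have "F x = F y" by (rule Nil.prems(1)) (rule Nil.prems(2), simp)
  then show ?case by simp
next
  case (Cons i js)
  have step: "coord_herz \<alpha> a b i F u = coord_herz \<alpha> a b i F v" if "\<And>l. l \<notin> insert i S \<Longrightarrow> u $ l = v $ l" for u v :: "real ^ 'n"
  proof -
    have "F (vec_upd u i t) = F (vec_upd v i t)" for t
      by (rule Cons.prems(1)) (use that in auto)
    then show ?thesis by (simp add: coord_herz_def)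
  qed
  show ?case
    unfolding fold.simps o_apply
  proof (rule Cons.IH[of "insert i S"])
    show "coord_herz \<alpha> a b i F u = coord_herz \<alpha> a b i F v" if "\<And>l. l \<notin> insert i S \<Longrightarrow> u $ l = v $ l" for u v :: "real ^ 'n"
      using that by (rule step)
    show "x $ l = y $ l" if "l \<notin> insert i S \<union> set js" for l
      using that by (intro Cons.prems(2)) auto
  qed
qed

definition mixed_norm :: "('n::{finite,linorder} \<Rightarrow> real) \<Rightarrow> ('n::{finite,linorder} \<Rightarrow> real) \<Rightarrow> ('n::{finite,linorder} \<Rightarrow> real) \<Rightarrow> (real ^ 'n::{finite,linorder} \<Rightarrow> ennreal) \<Rightarrow> ennreal" where
  "mixed_norm \<alpha> a b F = fold (coord_herz \<alpha> a b) (sorted_list_of_set UNIV) F 0"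

lemma mixed_norm_const:
  "fold (coord_herz \<alpha> a b) (sorted_list_of_set (UNIV :: 'n::{finite,linorder} set)) F x = mixed_norm \<alpha> a b F"
  unfolding mixed_norm_def by (rule fold_coord_herz_indep[of "{}"]) (auto simp: vec_eq_iff intro: arg_cong[where f = F])

lemma AE_lebesgue_const: "(AE x :: 'a::euclidean_space in lebesgue. Q) \<Longrightarrow> Q"
proof (rule ccontr)
  assume "AE x :: 'a in lebesgue. Q" "\<not> Q"
  then have "AE x :: 'a in lborel. False" by (simp add: AE_completion_iff)
  then show False by (simp add: AE_iff_measurable[OF _ refl] emeasure_lborel_UNIV)
qed

lemma mixed_norm_cmult:
  assumes "F \<in> borel_measurable lebesgue" "G \<in> borel_measurable lebesgue" "unit_range a" "unit_range b" 
    "AE x in lebesgue. F x \<le> c * G x"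
  shows "mixed_norm \<alpha> a b F \<le> c * mixed_norm \<alpha> a b G"
  using fold_coord_herz_cmult[OF assms, where \<alpha> = \<alpha> and js = "sorted_list_of_set UNIV"]
  unfolding mixed_norm_const by (rule AE_lebesgue_const)

lemma mixed_norm_triangle:
  assumes "G \<in> borel_measurable lebesgue" "H \<in> borel_measurable lebesgue" "unit_range a" "unit_range b"
  shows "mixed_norm \<alpha> a b (\<lambda>x. G x + H x) \<le> mixed_norm \<alpha> a b G + mixed_norm \<alpha> a b H"
  using fold_coord_herz_triangle[OF _ assms(1,2,3,4), where F = "\<lambda>x. G x + H x" and \<alpha> = \<alpha> and js = "sorted_list_of_set UNIV"] assms
  unfolding mixed_norm_const by (auto dest: AE_lebesgue_const)

lemma mixed_norm_holder:
  assumes \<theta>: "0 < \<theta>" "\<theta> < 1" and 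
    "F \<in> borel_measurable lebesgue" "G \<in> borel_measurable lebesgue" "H \<in> borel_measurable lebesgue"
    "unit_range a" "unit_range b" "unit_range a0" "unit_range b0" "unit_range a1" "unit_range b1"
    "\<And>i. a i = (1 - \<theta>) * a0 i + \<theta> * a1 i" "\<And>i. b i = (1 - \<theta>) * b0 i + \<theta> * b1 i"
      "\<And>i. \<alpha> i = (1 - \<theta>) * \<alpha>0 i + \<theta> * \<alpha>1 i"
    "AE x in lebesgue. F x \<le> enn_geo \<theta> (G x) (H x)"
  shows "mixed_norm \<alpha> a b F \<le> enn_geo \<theta> (mixed_norm \<alpha>0 a0 b0 G) (mixed_norm \<alpha>1 a1 b1 H)"
  using fold_coord_herz_holder[OF assms, where js = "sorted_list_of_set UNIV"]
  unfolding mixed_norm_const by (rule AE_lebesgue_const)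

lemma mixed_norm_sum:
  assumes "finite I" "\<And>l. l \<in> I \<Longrightarrow> G l \<in> borel_measurable lebesgue" "unit_range a" "unit_range b"
  shows "mixed_norm \<alpha> a b (\<lambda>x. \<Sum>l\<in>I. c l * G l x) \<le> (\<Sum>l\<in>I. c l * mixed_norm \<alpha> a b (G l))"
  using assms(1,2)
proof (induction I rule: finite_induct)
  case empty
  have "mixed_norm \<alpha> a b (\<lambda>x. 0) \<le> 0 * mixed_norm \<alpha> a b (\<lambda>x. 0)"
    using assms(3,4) by (intro mixed_norm_cmult) auto
  then show ?case by simp
next
  case (insert l I)
  have meas: "(\<lambda>x. c l * G l x) \<in> borel_measurable lebesgue" "(\<lambda>x. \<Sum>l\<in>I. c l * G l x) \<in> borel_measurable lebesgue"
    using insert by auto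
  have "mixed_norm \<alpha> a b (\<lambda>x. c l * G l x + (\<Sum>l\<in>I. c l * G l x))
      \<le> mixed_norm \<alpha> a b (\<lambda>x. c l * G l x) + mixed_norm \<alpha> a b (\<lambda>x. \<Sum>l\<in>I. c l * G l x)"
    using meas assms(3,4) by (rule mixed_norm_triangle)
  also have "\<dots> \<le> c l * mixed_norm \<alpha> a b (G l) + (\<Sum>l\<in>I. c l * mixed_norm \<alpha> a b (G l))"
    using insert meas assms(3,4) by (intro add_mono mixed_norm_cmult) auto
  finally show ?case using insert by simp
qed

lemma mixed_herz_norm_eq:
  fixes \<alpha> :: "(real, 'n::{finite,linorder}) vec" and p q :: "(ennreal, 'n) vec"
  assumes "\<And>i. 1 \<le> p $ i" "\<And>i. 1 \<le> q $ i"
  shows "mixed_herz_norm \<alpha> p q F = mixed_norm (($) \<alpha>) (\<lambda>i. recip (p $ i)) (\<lambda>i. recip (q $ i)) F"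
proof -
  have "coord_herz_norm \<alpha> p q = coord_herz (($) \<alpha>) (\<lambda>i. recip (p $ i)) (\<lambda>i. recip (q $ i))"
    using assms by (intro ext) (simp add: coord_herz_norm_def coord_herz_def herz_norm_eq vec_upd_def)
  then show ?thesis by (simp add: mixed_herz_norm_def mixed_norm_def)
qed

section \<open>Factorization of step functions on a grid\<close>

lemma dyadic_ring_iff: "t \<in> dyadic_ring k \<longleftrightarrow> 2 powi (k - 1) \<le> \<bar>t\<bar> \<and> \<bar>t\<bar> < 2 powi k"
proof -
  have "(2::real) powi (k - 1) \<le> 2 powi k" by (intro power_int_increasing) auto
  then show ?thesis unfolding dyadic_ring_def by auto
qed

lemma dyadic_ring_unique: "t \<in> dyadic_ring k \<Longrightarrow> t \<in> dyadic_ring k' \<Longrightarrow> k = k'"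
proof -
  have *: False if "t \<in> dyadic_ring k" "t \<in> dyadic_ring k'" "k < k'" for k k'
  proof -
    have "(2::real) powi k \<le> 2 powi (k' - 1)" using that by (intro power_int_increasing) auto
    then show False using that by (auto simp: dyadic_ring_iff)
  qed
  show "t \<in> dyadic_ring k \<Longrightarrow> t \<in> dyadic_ring k' \<Longrightarrow> k = k'"
    using *[of k k'] *[of k' k] by (cases k k' rule: linorder_cases) auto
qed

text \<open>
  A function of the given class is supported where all coordinates lie in finitely many dyadic rings.
\<close>
lemma I_set_eq: "I_set m = (\<Union>k\<in>{1 - int m..int m}. dyadic_ring k)"
proof -
  have "t \<in> I_set m \<longleftrightarrow> 2 powi (- int m) \<le> \<bar>t\<bar> \<and> \<bar>t\<bar> < 2 powi (int m)" for t :: real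
  proof -
    have "(- b < t \<and> t \<le> - a \<or> a \<le> t \<and> t < b) \<longleftrightarrow> a \<le> \<bar>t\<bar> \<and> \<bar>t\<bar> < b" if "0 < a" for a b
      using that by auto
    from this[of "1 / 2 ^ m" "2 ^ m"] have "t \<in> I_set m \<longleftrightarrow> 1 / 2 ^ m \<le> \<bar>t\<bar> \<and> \<bar>t\<bar> < 2 ^ m"
      by (simp add: I_set_def)
    then show ?thesis by (simp add: power_int_minus inverse_eq_divide)
  qed
  moreover have "(\<exists>k\<in>{1 - int m..int m}. t \<in> dyadic_ring k) \<longleftrightarrow> 2 powi (- int m) \<le> \<bar>t\<bar> \<and> \<bar>t\<bar> < 2 powi (int m)" for t :: real
  proof
    assume "\<exists>k\<in>{1 - int m..int m}. t \<in> dyadic_ring k"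
    then obtain k where k: "k \<in> {1 - int m..int m}" "t \<in> dyadic_ring k" by blast
    have "(2::real) powi (- int m) \<le> 2 powi (k - 1)" "(2::real) powi k \<le> 2 powi (int m)"
      using k power_int_increasing[of "- int m" "k - 1" "2::real"] power_int_increasing[of k "int m" "2::real"]
      by simp_all
    then show "2 powi (- int m) \<le> \<bar>t\<bar> \<and> \<bar>t\<bar> < 2 powi (int m)"
      using k by (auto simp: dyadic_ring_iff)
  next
    assume t: "2 powi (- int m) \<le> \<bar>t\<bar> \<and> \<bar>t\<bar> < 2 powi (int m)"
    define k where "k = \<lfloor>log 2 \<bar>t\<bar>\<rfloor> + 1"
    have t0: "0 < \<bar>t\<bar>" using t by (smt (verit) zero_less_power_int)
    have pw: "(2::real) powi j = 2 powr j" for j by (simp add: powr_real_of_int')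
    have "t \<in> dyadic_ring k" unfolding dyadic_ring_iff pw k_def
      using t0 by (auto simp: powr_le_cancel_iff simp flip: le_log_iff log_less_iff)
    moreover have "- int m \<le> log 2 \<bar>t\<bar>" "log 2 \<bar>t\<bar> < int m"
      using t t0 unfolding pw by (auto simp: le_log_iff log_less_iff)
    then have "k \<in> {1 - int m..int m}" unfolding k_def by (simp add: le_floor_iff floor_le_iff) linarith
    ultimately show "\<exists>k\<in>{1 - int m..int m}. t \<in> dyadic_ring k" by blast
  qed
  ultimately show ?thesis by auto
qed

lemma Lr_finite:
  assumes "0 \<le> a" and S: "S \<in> sets M" "emeasure M S \<noteq> top" and B: "B \<noteq> top"
    and f: "f \<in> borel_measurable M" "\<And>x. f x \<le> B * indicator S x"
  shows "Lr M a f \<noteq> top"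
proof (cases "a = 0")
  case True
  have "f x \<le> B" for x using f(2)[of x] by (cases "x \<in> S") auto
  then have "esssup M f \<le> B" using f(1) by (intro esssup_I) auto
  then show ?thesis using True B by (auto simp: Lr_def top_unique)
next
  case False
  have "(\<integral>\<^sup>+ x. enn_powr (f x) (1 / a) \<partial>M) \<le> (\<integral>\<^sup>+ x. enn_powr B (1 / a) * indicator S x \<partial>M)"
  proof (rule nn_integral_mono)
    fix x
    have "enn_powr (f x) (1 / a) \<le> enn_powr (B * indicator S x) (1 / a)"
      using f(2)[of x] assms(1) by (intro enn_powr_mono) auto
    then show "enn_powr (f x) (1 / a) \<le> enn_powr B (1 / a) * indicator S x"
      by (cases "x \<in> S") auto
  qed
  also have "\<dots> = enn_powr B (1 / a) * emeasure M S" using S by (simp add: nn_integral_cmult_indicator)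
  finally have "(\<integral>\<^sup>+ x. enn_powr (f x) (1 / a) \<partial>M) \<noteq> top"
    using B S by (auto simp: ennreal_mult_eq_top_iff top_unique)
  then show ?thesis using False by (simp add: Lr_def)
qed

text \<open>
  A finite partition of the line into measurable sets, the fibers of \<open>\<sigma>\<close>, which refines finitely many
  dyadic rings. All functions on \<open>\<real>\<^sup>n\<close> below depend only on the values of \<open>\<sigma>\<close> at the coordinates.
  Hence all their sections take finitely many values and are measurable, and no exceptional null
  sets appear on this side of the estimate.
\<close>
locale dyadic_grid =
  fixes \<sigma> :: "real \<Rightarrow> 'b" and K :: "int set"
  assumes finite_range: "finite (range \<sigma>)"
    and fiber: "\<sigma> -` {c} \<in> sets lebesgue"
    and finite_K: "finite K"
    and ring_eq: "\<sigma> t = \<sigma> t' \<Longrightarrow> k \<in> K \<Longrightarrow> t \<in> dyadic_ring k \<Longrightarrow> t' \<in> dyadic_ring k"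
begin

definition I :: "real set" where "I = (\<Union>k\<in>K. dyadic_ring k)"

lemma I_cong: "\<sigma> t = \<sigma> t' \<Longrightarrow> t \<in> I \<Longrightarrow> t' \<in> I"
  unfolding I_def using ring_eq by blast

lemma measurable_of_signature:
  assumes "\<And>t t'. \<sigma> t = \<sigma> t' \<Longrightarrow> h t = h t'"
  shows "h \<in> borel_measurable lebesgue"
proof (rule measurableI)
  fix A
  have "h t \<in> A" if "\<sigma> t = \<sigma> t'" "h t' \<in> A" for t t'
    using assms[OF that(1)] that(2) by simp
  then have eq: "h -` A = (\<Union>c\<in>\<sigma> ` (h -` A). \<sigma> -` {c})" by blast
  have "finite (\<sigma> ` (h -` A))" using finite_range by (rule finite_subset[rotated]) auto
  then have "(\<Union>c\<in>\<sigma> ` (h -` A). \<sigma> -` {c}) \<in> sets lebesgue"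
    using fiber by (intro sets.finite_UN) auto
  then show "h -` A \<inter> space lebesgue \<in> sets lebesgue"
    unfolding eq[symmetric] by simp
qed auto

lemma herz_finite:
  fixes h :: "real \<Rightarrow> real"
  assumes ab: "0 \<le> a" "0 \<le> b" and h: "\<And>t t'. \<sigma> t = \<sigma> t' \<Longrightarrow> h t = h t'" "\<And>t. h t \<noteq> 0 \<Longrightarrow> t \<in> I"
  shows "herz \<alpha> a b (\<lambda>t. ennreal (h t)) \<noteq> top"
proof -
  let ?L = "\<lambda>k. Lr lebesgue b (\<lambda>t. ennreal (h t) * indicator (dyadic_ring k) t)"
  let ?c = "\<lambda>k. ennreal (2 powr (real_of_int k * \<alpha>)) * ?L k"
  have meas: "(\<lambda>t. ennreal (h t)) \<in> borel_measurable lebesgue"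
    using measurable_of_signature[of h] h by (intro measurable_compose[OF _ measurable_ennreal]) blast
  have "finite (range h)"
  proof -
    have "h t = h (inv_into UNIV \<sigma> (\<sigma> t))" for t by (rule h(1)) (simp add: f_inv_into_f)
    then have "range h \<subseteq> (\<lambda>c. h (inv_into UNIV \<sigma> c)) ` range \<sigma>" by auto
    then show ?thesis using finite_range finite_surj by blast
  qed
  then obtain B where B: "\<And>t. h t \<le> B" by (meson bdd_above.unfold bdd_above_finite rangeI)
  have L_fin: "?L k \<noteq> top" for k
  proof (rule Lr_finite[OF ab(2)])
    show "dyadic_ring k \<in> sets lebesgue" by simp
    have "emeasure lebesgue (dyadic_ring k) \<le> emeasure lebesgue {- (2 powi k) <..< 2 powi k :: real}"
      by (intro emeasure_mono) (auto simp: dyadic_ring_def)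
    also have "\<dots> < top" by simp
    finally show "emeasure lebesgue (dyadic_ring k) \<noteq> top" by simp
    show "ennreal B \<noteq> top" by simp
    show "ennreal (h t) * indicator (dyadic_ring k) t \<le> ennreal B * indicator (dyadic_ring k) t" for t
      using B[of t] by (intro mult_right_mono ennreal_leI) auto
  qed (use meas in auto)
  have zero: "?L k = 0" if "k \<notin> K" for k
  proof -
    have "h t = 0" if "t \<in> dyadic_ring k" for t
      using h(2)[of t] that \<open>k \<notin> K\<close> dyadic_ring_unique unfolding I_def by blast
    then have "(\<lambda>t. ennreal (h t) * indicator (dyadic_ring k) t) = (\<lambda>t. 0)"
      by (auto simp: fun_eq_iff indicator_def)
    then show ?thesis using ab by (simp add: Lr_zero)
  qed
  show ?thesis unfolding herz_def
  proof (rule Lr_finite[OF ab(1)])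
    show "emeasure (count_space UNIV) K \<noteq> top" using finite_K by simp
    show "(\<Sum>k\<in>K. ?c k) \<noteq> top"
      using finite_K L_fin by (simp add: ennreal_mult_eq_top_iff)
    show "?c k \<le> (\<Sum>k\<in>K. ?c k) * indicator K k" for k
      using zero[of k] finite_K by (cases "k \<in> K") (auto intro: member_le_sum)
  qed auto
qed

text \<open>
  Only the coordinates in the list matter: after the norm in one coordinate has been taken, the
  result is invariant for the remaining list.
\<close>
definition grid_inv :: "'n list \<Rightarrow> (real ^ 'n \<Rightarrow> 'c) \<Rightarrow> bool" where
  "grid_inv js F \<longleftrightarrow> (\<forall>x y. (\<forall>l\<in>set js. \<sigma> (x $ l) = \<sigma> (y $ l)) \<longrightarrow> F x = F y)"

definition grid_supp :: "'n list \<Rightarrow> (real ^ 'n \<Rightarrow> 'c::zero) \<Rightarrow> bool" where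
  "grid_supp js F \<longleftrightarrow> (\<forall>x. F x \<noteq> 0 \<longrightarrow> (\<forall>l\<in>set js. x $ l \<in> I))"

lemma grid_invD: "grid_inv js F \<Longrightarrow> (\<And>l. l \<in> set js \<Longrightarrow> \<sigma> (x $ l) = \<sigma> (y $ l)) \<Longrightarrow> F x = F y"
  by (auto simp: grid_inv_def)

lemma grid_suppD: "grid_supp js F \<Longrightarrow> F x \<noteq> 0 \<Longrightarrow> l \<in> set js \<Longrightarrow> x $ l \<in> I"
  by (auto simp: grid_supp_def)

lemma grid_inv_section:
  assumes "grid_inv (i # js) F"
  shows "\<sigma> t = \<sigma> t' \<Longrightarrow> F (vec_upd x i t) = F (vec_upd x i t')"
    and "(\<And>l. l \<in> set js \<Longrightarrow> \<sigma> (x $ l) = \<sigma> (y $ l)) \<Longrightarrow> F (vec_upd x i t) = F (vec_upd y i t)"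
  by (auto intro!: grid_invD[OF assms])

lemma grid_inv_coord_herz:
  assumes "grid_inv (i # js) F"
  shows "grid_inv js (coord_herz \<alpha> a b i F)"
  unfolding grid_inv_def coord_herz_def
  by (auto intro!: arg_cong[where f = "herz _ _ _"] ext grid_inv_section(2)[OF assms])

lemma fold_coord_herz_grid_mono:
  assumes "unit_range a" "unit_range b" "grid_inv js F" "grid_inv js G" "\<And>x. F x \<le> G x"
  shows "fold (coord_herz \<alpha> a b) js F x \<le> fold (coord_herz \<alpha> a b) js G x"
  using assms(3,4,5)
proof (induction js arbitrary: F G)
  case (Cons i js)
  have "(\<lambda>t. F (vec_upd y i t)) \<in> borel_measurable lebesgue" for y
    by (rule measurable_of_signature) (rule grid_inv_section(1)[OF Cons.prems(1)])
  then have "coord_herz \<alpha> a b i F y \<le> coord_herz \<alpha> a b i G y" for y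
    unfolding coord_herz_def using Cons.prems(3) assms(1,2)
    by (intro herz_mono_AE) (auto simp: unit_rangeD)
  then show ?case
    using Cons.IH[OF grid_inv_coord_herz[OF Cons.prems(1)] grid_inv_coord_herz[OF Cons.prems(2)]] by simp
qed auto

lemma coord_herz_grid:
  fixes F :: "real ^ 'n \<Rightarrow> real"
  assumes ab: "unit_range a" "unit_range b" and F: "grid_inv (i # js) F" "grid_supp (i # js) F" and i: "i \<notin> set js"
  obtains g where "coord_herz \<alpha> a b i (\<lambda>x. ennreal (F x)) = (\<lambda>x. ennreal (g x))" "\<And>x. 0 \<le> g x"
    "grid_inv js g" "grid_supp js g"
proof
  define G where "G = coord_herz \<alpha> a b i (\<lambda>x. ennreal (F x))"
  have fin: "G x \<noteq> top" for x
    unfolding G_def coord_herz_def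
  proof (rule herz_finite)
    show "F (vec_upd x i t) = F (vec_upd x i t')" if "\<sigma> t = \<sigma> t'" for t t'
      using that by (rule grid_inv_section(1)[OF F(1)])
    show "t \<in> I" if "F (vec_upd x i t) \<noteq> 0" for t
      using grid_suppD[OF F(2) that, of i] by simp
  qed (use ab in \<open>auto simp: unit_rangeD\<close>)
  show "coord_herz \<alpha> a b i (\<lambda>x. ennreal (F x)) = (\<lambda>x. ennreal (enn2real (G x)))"
    using fin by (auto simp: G_def[symmetric] less_top)
  show "0 \<le> enn2real (G x)" for x by simp
  have "grid_inv (i # js) (\<lambda>x. ennreal (F x))" using F(1) unfolding grid_inv_def by metis
  then have "grid_inv js G" unfolding G_def by (rule grid_inv_coord_herz)
  then show "grid_inv js (\<lambda>x. enn2real (G x))" unfolding grid_inv_def by metis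
  show "grid_supp js (\<lambda>x. enn2real (G x))" unfolding grid_supp_def
  proof (intro allI impI ballI)
    fix x l assume nz: "enn2real (G x) \<noteq> 0" and l: "l \<in> set js"
    have "\<exists>t. F (vec_upd x i t) \<noteq> 0"
    proof (rule ccontr)
      assume "\<not> ?thesis"
      then have "G x = herz (\<alpha> i) (a i) (b i) (\<lambda>t. 0)" by (simp add: G_def coord_herz_def)
      also have "\<dots> = 0" using ab by (simp add: herz_def Lr_zero unit_rangeD)
      finally show False using nz by simp
    qed
    then obtain t where "F (vec_upd x i t) \<noteq> 0" by blast
    from grid_suppD[OF F(2) this, of l] show "x $ l \<in> I" using l i by (auto split: if_splits)
  qed
qed

lemma fold_coord_herz_grid_finite:
  fixes F :: "real ^ 'n \<Rightarrow> real"
  assumes "unit_range a" "unit_range b" "grid_inv js F" "grid_supp js F" "distinct js"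
  shows "fold (coord_herz \<alpha> a b) js (\<lambda>x. ennreal (F x)) x \<noteq> top"
  using assms(3,4,5)
proof (induction js arbitrary: F)
  case (Cons i js)
  then have "i \<notin> set js" by simp
  from coord_herz_grid[OF assms(1,2) Cons.prems(1,2) this, of \<alpha>] obtain g where
    "coord_herz \<alpha> a b i (\<lambda>x. ennreal (F x)) = (\<lambda>x. ennreal (g x))" "grid_inv js g" "grid_supp js g"
    by metis
  then show ?case using Cons.IH[of g] Cons.prems(3) by simp
qed simp

text \<open>
  Meaningful only on the rings; elsewhere the functions to be factored vanish, and so do their
  factors for any value of the index.
\<close>
definition ring_index :: "real \<Rightarrow> int" where
  "ring_index t = (THE k. t \<in> dyadic_ring k)"

lemma ring_index_eq: "t \<in> dyadic_ring k \<Longrightarrow> ring_index t = k"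
  unfolding ring_index_def using dyadic_ring_unique by (intro the_equality) auto

lemma ring_index_cong: "\<sigma> t = \<sigma> t' \<Longrightarrow> t \<in> I \<Longrightarrow> ring_index t = ring_index t'"
  using ring_eq ring_index_eq unfolding I_def by (metis UN_iff)

text \<open>
  Induction on the coordinates. The norm \<open>g\<close> of \<open>F\<close> in the first coordinate is a grid function of the
  other coordinates and factors as \<open>g0\<^sup>1\<^sup>-\<^sup>\<theta> g1\<^sup>\<theta>\<close> by induction hypothesis. Each section of \<open>F\<close> factors
  by \<open>herz_factorization\<close> with norms at most \<open>g\<close>; multiplied by \<open>g0 / g\<close> and \<open>g1 / g\<close>, its factors
  have norms at most \<open>g0\<close> and \<open>g1\<close>.
\<close>
lemma grid_factorization:
  fixes F :: "real ^ 'n \<Rightarrow> real"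
  assumes \<theta>: "0 < \<theta>" "\<theta> < 1"
    and ur: "unit_range a" "unit_range b" "unit_range a0" "unit_range b0" "unit_range a1" "unit_range b1"
    and eq: "\<And>i. a i = (1 - \<theta>) * a0 i + \<theta> * a1 i" "\<And>i. b i = (1 - \<theta>) * b0 i + \<theta> * b1 i"
      "\<And>i. \<alpha> i = (1 - \<theta>) * \<alpha>0 i + \<theta> * \<alpha>1 i"
    and F: "grid_inv js F" "grid_supp js F" "\<And>x. 0 \<le> F x" and "distinct js"
  shows "\<exists>u0 u1. grid_inv js u0 \<and> grid_inv js u1 \<and>
    (\<forall>x. 0 \<le> u0 x \<and> 0 \<le> u1 x \<and> (u0 x = 0 \<longleftrightarrow> F x = 0) \<and> (u1 x = 0 \<longleftrightarrow> F x = 0) \<and>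
      u0 x powr (1 - \<theta>) * u1 x powr \<theta> = F x) \<and>
    (\<forall>x. fold (coord_herz \<alpha>0 a0 b0) js (\<lambda>x. ennreal (u0 x)) x \<le> fold (coord_herz \<alpha> a b) js (\<lambda>x. ennreal (F x)) x) \<and>
    (\<forall>x. fold (coord_herz \<alpha>1 a1 b1) js (\<lambda>x. ennreal (u1 x)) x \<le> fold (coord_herz \<alpha> a b) js (\<lambda>x. ennreal (F x)) x)"
  using F \<open>distinct js\<close>
proof (induction js arbitrary: F)
  case Nil
  have "F x powr (1 - \<theta>) * F x powr \<theta> = F x" for x
    using Nil(3)[of x] by (cases "F x = 0") (auto simp flip: powr_add)
  then show ?case using Nil by (intro exI[of _ F]) auto
next
  case (Cons i js)
  have i: "i \<notin> set js" and dj: "distinct js" using Cons.prems(4) by auto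
  obtain g where g: "coord_herz \<alpha> a b i (\<lambda>x. ennreal (F x)) = (\<lambda>x. ennreal (g x))" "\<And>x. 0 \<le> g x"
    "grid_inv js g" "grid_supp js g"
    using coord_herz_grid[OF ur(1,2) Cons.prems(1,2) i, of \<alpha>] by metis
  from Cons.IH[OF g(3,4,2) dj] obtain g0 g1 where
    gi: "grid_inv js g0" "grid_inv js g1"
    and gp: "\<And>x. 0 \<le> g0 x" "\<And>x. 0 \<le> g1 x" "\<And>x. g0 x = 0 \<longleftrightarrow> g x = 0" "\<And>x. g1 x = 0 \<longleftrightarrow> g x = 0"
      "\<And>x. g0 x powr (1 - \<theta>) * g1 x powr \<theta> = g x"
    and gn: "\<And>x. fold (coord_herz \<alpha>0 a0 b0) js (\<lambda>x. ennreal (g0 x)) x \<le> fold (coord_herz \<alpha> a b) js (\<lambda>x. ennreal (g x)) x"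
      "\<And>x. fold (coord_herz \<alpha>1 a1 b1) js (\<lambda>x. ennreal (g1 x)) x \<le> fold (coord_herz \<alpha> a b) js (\<lambda>x. ennreal (g x)) x"
    by blast
  define sec where "sec x = (\<lambda>t. F (vec_upd x i t))" for x
  have sec_sig: "sec x t = sec x t'" if "\<sigma> t = \<sigma> t'" for x t t'
    unfolding sec_def using that by (rule grid_inv_section(1)[OF Cons.prems(1)])
  have sec_supp: "t \<in> I" if "sec x t \<noteq> 0" for x t
    using grid_suppD[OF Cons.prems(2), of "vec_upd x i t" i] that by (simp add: sec_def)
  have sec_herz: "herz (\<alpha> i) (a i) (b i) (\<lambda>t. ennreal (sec x t)) = ennreal (g x)" for x
    using fun_cong[OF g(1), of x] by (simp add: coord_herz_def sec_def)
  have sec_meas: "sec x \<in> borel_measurable lebesgue" for x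
    by (rule measurable_of_signature) (rule sec_sig)
  have sec_self: "sec x (x $ i) = F x" for x
  proof -
    have "vec_upd x i (x $ i) = x" by (simp add: vec_eq_iff)
    then show ?thesis by (simp add: sec_def)
  qed
  have sec_pos: "0 \<le> sec x t" for x t using Cons.prems(3) by (simp add: sec_def)
  define P where "P h \<psi>0 \<psi>1 \<longleftrightarrow>
    (\<forall>k. \<forall>v\<ge>0. 0 \<le> \<psi>0 k v \<and> 0 \<le> \<psi>1 k v \<and> (\<psi>0 k v = 0 \<longleftrightarrow> v = 0) \<and> (\<psi>1 k v = 0 \<longleftrightarrow> v = 0)
        \<and> \<psi>0 k v powr (1 - \<theta>) * \<psi>1 k v powr \<theta> = v) \<and>
    (\<forall>v. (\<forall>k. \<forall>t\<in>dyadic_ring k. v t = ennreal (\<psi>0 k (h t))) \<longrightarrow> herz (\<alpha>0 i) (a0 i) (b0 i) v \<le> herz (\<alpha> i) (a i) (b i) (\<lambda>t. ennreal (h t))) \<and>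
    (\<forall>v. (\<forall>k. \<forall>t\<in>dyadic_ring k. v t = ennreal (\<psi>1 k (h t))) \<longrightarrow> herz (\<alpha>1 i) (a1 i) (b1 i) v \<le> herz (\<alpha> i) (a i) (b i) (\<lambda>t. ennreal (h t)))"
    for h :: "real \<Rightarrow> real" and \<psi>0 \<psi>1 :: "int \<Rightarrow> real \<Rightarrow> real"
  have "\<exists>\<psi>0 \<psi>1. P (sec x) \<psi>0 \<psi>1" for x
    unfolding P_def using ur sec_meas sec_pos
    by (intro herz_factorization \<theta> eq) (auto simp: unit_rangeD sec_herz)
  \<comment> \<open>The factors are chosen for the section as a function, not for the point \<open>x\<close>: points with the same
    section get the same factors, which keeps the product invariant under the grid.\<close>
  then have "\<forall>h. \<exists>\<psi>0 \<psi>1. h \<in> range sec \<longrightarrow> P h \<psi>0 \<psi>1" by blast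
  then obtain \<Psi>0 \<Psi>1 where "\<And>h. h \<in> range sec \<longrightarrow> P h (\<Psi>0 h) (\<Psi>1 h)"
    unfolding choice_iff by blast
  then have \<Psi>: "P (sec x) (\<Psi>0 (sec x)) (\<Psi>1 (sec x))" for x by blast
  \<comment> \<open>Where \<open>g\<close> vanishes, the factors of the section already have norm \<open>0\<close> and need no rescaling.\<close>
  define fac where "fac g' x = (if g x = 0 then 1 else g' x / g x)" for g' x
  define u where "u g' \<Psi> x = fac g' x * \<Psi> (sec x) (ring_index (x $ i)) (F x)"
    for g' and \<Psi> :: "(real \<Rightarrow> real) \<Rightarrow> int \<Rightarrow> real \<Rightarrow> real" and x
  have fac_pos: "0 < fac g0 x" "0 < fac g1 x" for x
    using gp(1)[of x] gp(2)[of x] gp(3)[of x] gp(4)[of x] g(2)[of x]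
    by (auto simp: fac_def less_le)
  have fac_prod: "fac g0 x powr (1 - \<theta>) * fac g1 x powr \<theta> = 1" for x
  proof (cases "g x = 0")
    case False
    then have "0 < g x" using g(2)[of x] by simp
    then have "fac g0 x powr (1 - \<theta>) * fac g1 x powr \<theta> = (g0 x powr (1 - \<theta>) * g1 x powr \<theta>) / (g x powr (1 - \<theta>) * g x powr \<theta>)"
      by (simp add: fac_def powr_divide)
    also have "\<dots> = 1" using \<open>0 < g x\<close> by (simp add: gp(5) flip: powr_add)
    finally show ?thesis .
  qed (simp add: fac_def)
  have sec_eq: "sec x = sec y" if "\<And>l. l \<in> set js \<Longrightarrow> \<sigma> (x $ l) = \<sigma> (y $ l)" for x y
    unfolding sec_def using that by (intro ext grid_inv_section(2)[OF Cons.prems(1)])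
  have u_inv: "grid_inv (i # js) (u g' \<Phi>)" if "grid_inv js g'" and z: "\<And>x k. \<Phi> (sec x) k 0 = 0" for g' \<Phi>
    unfolding grid_inv_def
  proof (intro allI impI)
    fix x y :: "real ^ 'n" assume *: "\<forall>l\<in>set (i # js). \<sigma> (x $ l) = \<sigma> (y $ l)"
    have 1: "sec x = sec y" using * by (intro sec_eq) auto
    have 2: "F x = F y" using * by (intro grid_invD[OF Cons.prems(1)]) auto
    have 3: "fac g' x = fac g' y"
      using grid_invD[OF g(3), of x y] grid_invD[OF that(1), of x y] * by (simp add: fac_def)
    show "u g' \<Phi> x = u g' \<Phi> y"
    proof (cases "F x = 0")
      case True
      then show ?thesis using 2 z by (simp add: u_def)
    next
      case False
      then have "x $ i \<in> I" using grid_suppD[OF Cons.prems(2)] by simp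
      then have "ring_index (x $ i) = ring_index (y $ i)" using * by (intro ring_index_cong) auto
      then show ?thesis using 1 2 3 by (simp add: u_def)
    qed
  qed
  have u_coord: "coord_herz \<alpha>' a' b' i (\<lambda>x. ennreal (u g' \<Phi> x)) x \<le> ennreal (g' x)"
    if g': "grid_inv js g'" "\<And>x. 0 \<le> g' x" "\<And>x. g' x = 0 \<longleftrightarrow> g x = 0" "\<And>x. 0 < fac g' x"
      and ur': "unit_range a'" "unit_range b'"
      and z: "\<And>x k. \<Phi> (sec x) k 0 = 0" and pos: "\<And>x k v. 0 \<le> v \<Longrightarrow> 0 \<le> \<Phi> (sec x) k v"
      and bound: "\<And>x v. (\<forall>k. \<forall>t\<in>dyadic_ring k. v t = ennreal (\<Phi> (sec x) k (sec x t))) \<Longrightarrow>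
        herz (\<alpha>' i) (a' i) (b' i) v \<le> ennreal (g x)"
    for g' \<Phi> \<alpha>' a' b' x
  proof -
    define v where "v t = ennreal (\<Phi> (sec x) (ring_index t) (sec x t))" for t
    have v_meas: "v \<in> borel_measurable lebesgue"
    proof (rule measurable_of_signature)
      fix t t' assume t: "\<sigma> t = \<sigma> t'"
      show "v t = v t'"
      proof (cases "sec x t = 0")
        case True
        then show ?thesis using sec_sig[OF t, of x] z by (simp add: v_def)
      next
        case False
        then show ?thesis using sec_sig[OF t, of x] ring_index_cong[OF t sec_supp[OF False]] by (simp add: v_def)
      qed
    qed
    have "u g' \<Phi> (vec_upd x i t) = fac g' x * \<Phi> (sec x) (ring_index t) (sec x t)" for t
    proof -
      have "sec (vec_upd x i t) = sec x" using i by (intro sec_eq) auto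
      moreover have "fac g' (vec_upd x i t) = fac g' x"
      proof -
        have "\<sigma> (vec_upd x i t $ l) = \<sigma> (x $ l)" if "l \<in> set js" for l using that i by auto
        from grid_invD[OF g(3) this] grid_invD[OF g'(1) this] show ?thesis by (simp add: fac_def)
      qed
      ultimately show ?thesis by (simp add: u_def) (simp add: sec_def)
    qed
    then have "coord_herz \<alpha>' a' b' i (\<lambda>x. ennreal (u g' \<Phi> x)) x
        = herz (\<alpha>' i) (a' i) (b' i) (\<lambda>t. ennreal (fac g' x) * v t)"
      using g'(4)[of x] pos sec_pos by (simp add: coord_herz_def v_def ennreal_mult less_imp_le)
    also have "\<dots> \<le> ennreal (fac g' x) * herz (\<alpha>' i) (a' i) (b' i) v"
      using ur' v_meas by (intro herz_cmult_le) (auto simp: unit_rangeD)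
    also have "\<dots> \<le> ennreal (fac g' x) * ennreal (g x)"
      by (intro mult_left_mono bound) (auto simp: v_def ring_index_eq)
    also have "\<dots> = ennreal (fac g' x * g x)"
      using g'(4)[of x] g(2)[of x] by (simp add: ennreal_mult less_imp_le)
    also have "fac g' x * g x = g' x" using g'(3)[of x] by (simp add: fac_def)
    finally show ?thesis .
  qed
  have \<Psi>_pos: "0 \<le> \<Psi>0 (sec x) k v" "0 \<le> \<Psi>1 (sec x) k v" if "0 \<le> v" for x k v
    using \<Psi>[of x] that unfolding P_def by auto
  have \<Psi>_zero: "\<Psi>0 (sec x) k v = 0 \<longleftrightarrow> v = 0" "\<Psi>1 (sec x) k v = 0 \<longleftrightarrow> v = 0" if "0 \<le> v" for x k v
    using \<Psi>[of x] that unfolding P_def by auto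
  have \<Psi>_prod: "\<Psi>0 (sec x) k v powr (1 - \<theta>) * \<Psi>1 (sec x) k v powr \<theta> = v" if "0 \<le> v" for x k v
    using \<Psi>[of x] that unfolding P_def by auto
  have \<Psi>_bound: "\<forall>k. \<forall>t\<in>dyadic_ring k. v t = ennreal (\<Psi>0 (sec x) k (sec x t)) \<Longrightarrow> herz (\<alpha>0 i) (a0 i) (b0 i) v \<le> ennreal (g x)"
    "\<forall>k. \<forall>t\<in>dyadic_ring k. v t = ennreal (\<Psi>1 (sec x) k (sec x t)) \<Longrightarrow> herz (\<alpha>1 i) (a1 i) (b1 i) v \<le> ennreal (g x)" for x v
    using \<Psi>[of x] unfolding P_def sec_herz by blast+
  have z: "\<Psi>0 (sec x) k 0 = 0" "\<Psi>1 (sec x) k 0 = 0" for x k using \<Psi>_zero[of 0] by auto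
  have inv: "grid_inv (i # js) (u g0 \<Psi>0)" "grid_inv (i # js) (u g1 \<Psi>1)"
    using u_inv[of g0 \<Psi>0, OF gi(1)] u_inv[of g1 \<Psi>1, OF gi(2)] z by blast+
  have c0: "coord_herz \<alpha>0 a0 b0 i (\<lambda>x. ennreal (u g0 \<Psi>0 x)) x \<le> ennreal (g0 x)" for x
    using gi(1) gp(1) gp(3) fac_pos(1) ur(3,4) z(1) \<Psi>_pos(1) \<Psi>_bound(1) by (rule u_coord[of g0 a0 b0 \<Psi>0])
  have c1: "coord_herz \<alpha>1 a1 b1 i (\<lambda>x. ennreal (u g1 \<Psi>1 x)) x \<le> ennreal (g1 x)" for x
    using gi(2) gp(2) gp(4) fac_pos(2) ur(5,6) z(2) \<Psi>_pos(2) \<Psi>_bound(2) by (rule u_coord[of g1 a1 b1 \<Psi>1])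
  have enn_inv: "grid_inv ls (\<lambda>x. ennreal (w x))" if "grid_inv ls w" for ls and w :: "real ^ 'n \<Rightarrow> real"
    using that unfolding grid_inv_def by metis
  have n0: "fold (coord_herz \<alpha>0 a0 b0) (i # js) (\<lambda>x. ennreal (u g0 \<Psi>0 x)) x
      \<le> fold (coord_herz \<alpha> a b) (i # js) (\<lambda>x. ennreal (F x)) x" for x
    using fold_coord_herz_grid_mono[OF ur(3,4) grid_inv_coord_herz[OF enn_inv[OF inv(1)]] enn_inv[OF gi(1)] c0]
    by (simp add: g(1)) (rule order_trans[OF _ gn(1)])
  have n1: "fold (coord_herz \<alpha>1 a1 b1) (i # js) (\<lambda>x. ennreal (u g1 \<Psi>1 x)) x
      \<le> fold (coord_herz \<alpha> a b) (i # js) (\<lambda>x. ennreal (F x)) x" for x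
    using fold_coord_herz_grid_mono[OF ur(5,6) grid_inv_coord_herz[OF enn_inv[OF inv(2)]] enn_inv[OF gi(2)] c1]
    by (simp add: g(1)) (rule order_trans[OF _ gn(2)])
  have s0: "0 \<le> u g0 \<Psi>0 x" "u g0 \<Psi>0 x = 0 \<longleftrightarrow> F x = 0" for x
    using fac_pos(1)[of x] \<Psi>_pos(1)[OF Cons.prems(3)] \<Psi>_zero(1)[OF Cons.prems(3)[of x], of x]
    by (auto simp: u_def)
  have s1: "0 \<le> u g1 \<Psi>1 x" "u g1 \<Psi>1 x = 0 \<longleftrightarrow> F x = 0" for x
    using fac_pos(2)[of x] \<Psi>_pos(2)[OF Cons.prems(3)] \<Psi>_zero(2)[OF Cons.prems(3)[of x], of x]
    by (auto simp: u_def)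
  have prod: "u g0 \<Psi>0 x powr (1 - \<theta>) * u g1 \<Psi>1 x powr \<theta> = F x" for x
  proof -
    have "u g0 \<Psi>0 x powr (1 - \<theta>) * u g1 \<Psi>1 x powr \<theta>
       = (fac g0 x powr (1 - \<theta>) * fac g1 x powr \<theta>) *
         (\<Psi>0 (sec x) (ring_index (x $ i)) (F x) powr (1 - \<theta>) * \<Psi>1 (sec x) (ring_index (x $ i)) (F x) powr \<theta>)"
      by (simp add: u_def powr_mult mult_ac)
    then show ?thesis by (simp add: fac_prod \<Psi>_prod[OF Cons.prems(3)])
  qed
  show ?case
    by (intro exI[of _ "u g0 \<Psi>0"] exI[of _ "u g1 \<Psi>1"] conjI allI inv n0 n1 s0 s1 prod)
qed

definition cell :: "('n \<Rightarrow> 'b) \<Rightarrow> (real ^ 'n) set" where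
  "cell c = {x. \<forall>l. \<sigma> (x $ l) = c l}"

definition cells :: "('n \<Rightarrow> 'b) set" where
  "cells = {c. \<forall>l. c l \<in> \<sigma> ` I}"

definition cell_point :: "('n \<Rightarrow> 'b) \<Rightarrow> real ^ 'n" where
  "cell_point c = (\<chi> l. inv_into I \<sigma> (c l))"

lemma finite_cells: "finite (cells :: ('n::finite \<Rightarrow> 'b) set)"
proof -
  have "(cells :: ('n \<Rightarrow> 'b) set) = PiE UNIV (\<lambda>_. \<sigma> ` I)"
    by (auto simp: cells_def PiE_def Pi_def)
  moreover have "finite (\<sigma> ` I)" using finite_range by (rule finite_subset[rotated]) auto
  ultimately show ?thesis by (simp add: finite_PiE)
qed

lemma cell_point: "c \<in> cells \<Longrightarrow> cell_point c \<in> cell c"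
  unfolding cells_def cell_def cell_point_def by (auto intro!: f_inv_into_f)

lemma cell_in_I:
  fixes x :: "real ^ 'n"
  assumes "c \<in> cells" "x \<in> cell c"
  shows "x $ l \<in> I"
proof -
  from assms(1) obtain t where "t \<in> I" "c l = \<sigma> t" unfolding cells_def by blast
  moreover have "\<sigma> (x $ l) = c l" using assms(2) by (simp add: cell_def)
  ultimately show ?thesis using I_cong[of t "x $ l"] by simp
qed

text \<open>
  The cells are pairwise disjoint.
\<close>
lemma sum_over_cells:
  fixes z :: "('n::finite \<Rightarrow> 'b) \<Rightarrow> 'c::semiring_1"
  assumes "c \<in> cells" "x \<in> cell c"
  shows "(\<Sum>d\<in>cells. z d * indicator (cell d) x) = z c"
proof -
  have "(\<Sum>d\<in>cells. z d * indicator (cell d) x) = (\<Sum>d\<in>cells. if d = c then z d else 0)"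
    using assms by (intro sum.cong) (auto simp: cell_def indicator_def fun_eq_iff)
  then show ?thesis using assms by (simp add: finite_cells)
qed

lemma grid_fun_eq_sum_cells:
  fixes F :: "real ^ 'n::finite \<Rightarrow> complex"
  assumes "grid_inv js F" "grid_supp js F" "set js = UNIV"
  shows "F x = (\<Sum>c\<in>cells. F (cell_point c) * indicator (cell c) x)"
proof (cases "\<forall>l. x $ l \<in> I")
  case True
  define c where "c l = \<sigma> (x $ l)" for l
  have c: "c \<in> cells" "x \<in> cell c" using True by (auto simp: cells_def cell_def c_def)
  have "F (cell_point c) = F x"
    using cell_point[OF c(1)] by (intro grid_invD[OF assms(1)]) (simp add: cell_def c_def)
  then show ?thesis using sum_over_cells[OF c, of "\<lambda>c. F (cell_point c)"] by simp
next
  case False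
  then have "F x = 0" using grid_suppD[OF assms(2), of x] assms(3) by auto
  moreover have "x \<notin> cell c" if "c \<in> cells" for c using cell_in_I[OF that] False by blast
  then have "(\<Sum>c\<in>cells. F (cell_point c) * indicator (cell c) x) = 0"
    by (intro sum.neutral) auto
  ultimately show ?thesis by simp
qed

end

section \<open>Interpolation of the operator\<close>

text \<open>
  The grid generated by finitely many sets: the signature of a point is the collection of those
  sets that contain it.
\<close>
lemma dyadic_grid_signature:
  fixes S :: "'i \<Rightarrow> real set"
  assumes "finite J" "finite K" "\<And>j. j \<in> J \<Longrightarrow> S j \<in> sets lebesgue" "\<And>k. k \<in> K \<Longrightarrow> \<exists>j\<in>J. S j = dyadic_ring k"
  shows "dyadic_grid (\<lambda>t. {j \<in> J. t \<in> S j}) K"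
proof
  have "range (\<lambda>t. {j \<in> J. t \<in> S j}) \<subseteq> Pow J" by auto
  then show "finite (range (\<lambda>t. {j \<in> J. t \<in> S j}))" using assms(1) finite_subset by blast
  show "(\<lambda>t. {j \<in> J. t \<in> S j}) -` {A} \<in> sets lebesgue" for A
  proof (cases "A \<subseteq> J")
    case True
    have "{t \<in> space lebesgue. \<forall>j\<in>J. t \<in> (if j \<in> A then S j else - S j)} \<in> sets lebesgue"
      using assms by (intro sets.sets_Collect_finite_All) (auto simp: Collect_neg_eq[symmetric] Compl_eq_Diff_UNIV intro: sets.compl_sets)
    moreover have "{t \<in> space lebesgue. \<forall>j\<in>J. t \<in> (if j \<in> A then S j else - S j)} = (\<lambda>t. {j \<in> J. t \<in> S j}) -` {A}"
      using True by (auto split: if_splits)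
    ultimately show ?thesis by simp
  next
    case False
    then have "(\<lambda>t. {j \<in> J. t \<in> S j}) -` {A} = {}" by auto
    then show ?thesis by simp
  qed
  fix t t' k assume eq: "{j \<in> J. t \<in> S j} = {j \<in> J. t' \<in> S j}" and k: "k \<in> K" "t \<in> dyadic_ring k"
  from assms(4)[OF k(1)] obtain j where "j \<in> J" "S j = dyadic_ring k" by blast
  then show "t' \<in> dyadic_ring k" using eq k by blast
qed (rule assms)

lemma I_set_mono: "m \<le> m' \<Longrightarrow> I_set m \<subseteq> I_set m'"
  unfolding I_set_eq by (rule UN_mono) auto

text \<open>
  The grid is generated by the sides of the boxes of \<open>f\<close> together with the rings that meet its
  support.
\<close>
lemma H_class_grid:
  fixes f :: "real ^ 'n \<Rightarrow> complex"
  assumes "f \<in> H_class"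
  obtains \<sigma> :: "real \<Rightarrow> (nat \<times> 'n + int) set" and m
  where "dyadic_grid \<sigma> {1 - int m..int m}"
    "\<And>js. set js = UNIV \<Longrightarrow> dyadic_grid.grid_inv \<sigma> js f"
    "\<And>js. set js = UNIV \<Longrightarrow> dyadic_grid.grid_supp {1 - int m..int m} js f"
proof -
  from assms obtain N :: nat and a and E :: "nat \<Rightarrow> (real ^ 'n) set" where
    E: "\<And>k. k < N \<Longrightarrow> measurable_box (E k)" "\<And>k. k < N \<Longrightarrow> \<exists>m. E k \<subseteq> A_set m"
    and f: "f = (\<lambda>x. \<Sum>k<N. a k * indicator (E k) x)"
    unfolding H_class_def by blast
  have "\<forall>k. \<exists>e :: 'n \<Rightarrow> real set. k < N \<longrightarrow> (\<forall>i. e i \<in> sets lebesgue) \<and> E k = {x. \<forall>i. x $ i \<in> e i}"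
    using E(1) unfolding measurable_box_def by blast
  then obtain e :: "nat \<Rightarrow> 'n \<Rightarrow> real set" where
    e: "\<And>k i. k < N \<Longrightarrow> e k i \<in> sets lebesgue" "\<And>k. k < N \<Longrightarrow> E k = {x. \<forall>i. x $ i \<in> e k i}"
    unfolding choice_iff by blast
  have "\<forall>k. \<exists>m. k < N \<longrightarrow> E k \<subseteq> A_set m" using E(2) by blast
  then obtain mm where mm: "\<And>k. k < N \<Longrightarrow> E k \<subseteq> A_set (mm k)" unfolding choice_iff by blast
  \<comment> \<open>Any common upper bound of the \<open>mm k\<close>.\<close>
  define m where "m = (\<Sum>k<N. mm k)"
  have m: "mm k \<le> m" if "k < N" for k unfolding m_def using that by (intro member_le_sum) auto
  define K where "K = {1 - int m..int m}"
  define J :: "(nat \<times> 'n + int) set" where "J = Inl ` ({..<N} \<times> UNIV) \<union> Inr ` K"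
  define S where "S = case_sum (\<lambda>(k, i). e k i) dyadic_ring"
  define \<sigma> where "\<sigma> = (\<lambda>t. {j \<in> J. t \<in> S j})"
  have grid: "dyadic_grid \<sigma> K" unfolding \<sigma>_def
  proof (rule dyadic_grid_signature)
    show "\<exists>j\<in>J. S j = dyadic_ring k" if "k \<in> K" for k
      using that by (intro bexI[of _ "Inr k"]) (auto simp: J_def S_def)
  qed (auto simp: J_def K_def S_def e)
  interpret dyadic_grid \<sigma> K by (rule grid)
  have "I = I_set m" unfolding I_def I_set_eq by (simp add: K_def)
  have inv: "grid_inv js f" if "set js = UNIV" for js
    unfolding grid_inv_def
  proof (intro allI impI)
    fix x y :: "real ^ 'n" assume "\<forall>l\<in>set js. \<sigma> (x $ l) = \<sigma> (y $ l)"
    then have xy: "\<sigma> (x $ l) = \<sigma> (y $ l)" for l using that by auto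
    have "x $ i \<in> e k i \<longleftrightarrow> y $ i \<in> e k i" if "k < N" for k i
    proof -
      have "Inl (k, i) \<in> J" using that by (auto simp: J_def)
      then have "t \<in> e k i \<longleftrightarrow> Inl (k, i) \<in> \<sigma> t" for t by (auto simp: \<sigma>_def S_def)
      then show ?thesis using xy[of i] by simp
    qed
    then have "x \<in> E k \<longleftrightarrow> y \<in> E k" if "k < N" for k using e(2)[OF that] that by simp
    then show "f x = f y" unfolding f by (intro sum.cong) (auto simp: indicator_def)
  qed
  have supp: "grid_supp js f" if "set js = UNIV" for js
    unfolding grid_supp_def
  proof (intro allI impI ballI)
    fix x l assume "f x \<noteq> 0"
    then obtain k where "k < N" "a k * indicator (E k) x \<noteq> 0"
      unfolding f by (meson lessThan_iff sum.neutral)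
    then have "x \<in> A_set (mm k)" using mm[of k] by (auto simp: indicator_def split: if_splits)
    then have "x $ l \<in> I_set (mm k)" by (simp add: A_set_def)
    then show "x $ l \<in> I" using I_set_mono[OF m[OF \<open>k < N\<close>]] \<open>I = I_set m\<close> by blast
  qed
  show thesis using grid inv supp unfolding K_def by (rule that)
qed

context dyadic_grid
begin

lemma H_class_cells:
  fixes z :: "('n::finite \<Rightarrow> 'b) \<Rightarrow> complex"
  assumes \<Gamma>: "\<Gamma> \<subseteq> cells" and I: "I \<subseteq> I_set m"
  shows "(\<lambda>x. \<Sum>c\<in>\<Gamma>. z c * indicator (cell c) x) \<in> H_class"
proof -
  have "finite \<Gamma>" using \<Gamma> finite_cells finite_subset by blast
  then obtain h where h: "bij_betw h {..<card \<Gamma>} \<Gamma>"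
    using ex_bij_betw_nat_finite by (metis atLeast0LessThan)
  have hin: "h k \<in> \<Gamma>" if "k < card \<Gamma>" for k using h that by (auto simp: bij_betw_def)
  have "disjoint_family_on (\<lambda>k. cell (h k)) {..<card \<Gamma>}"
    unfolding disjoint_family_on_def
  proof (intro ballI impI)
    fix k l assume kl: "k \<in> {..<card \<Gamma>}" "l \<in> {..<card \<Gamma>}" "k \<noteq> l"
    then have "h k \<noteq> h l" using h by (auto simp: bij_betw_def inj_on_def)
    then show "cell (h k) \<inter> cell (h l) = {}" by (auto simp: cell_def fun_eq_iff)
  qed
  moreover have "measurable_box (cell (h k))" for k
    unfolding measurable_box_def cell_def
    by (rule exI[of _ "\<lambda>i. \<sigma> -` {h k i}"]) (simp add: fiber)
  moreover have "cell (h k) \<subseteq> A_set m" if "k < card \<Gamma>" for k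
    using cell_in_I[of "h k"] hin[OF that] \<Gamma> I unfolding A_set_def by blast
  moreover have "(\<lambda>x. \<Sum>c\<in>\<Gamma>. z c * indicator (cell c) x) = (\<lambda>x. \<Sum>k<card \<Gamma>. z (h k) * indicator (cell (h k)) x)"
    using sum.reindex_bij_betw[OF h, symmetric] by (intro ext) fastforce
  ultimately show ?thesis unfolding H_class_def
    by (intro CollectI exI[of _ "card \<Gamma>"] exI[of _ "\<lambda>k. z (h k)"] exI[of _ "\<lambda>k. cell (h k)"]) blast
qed

lemma H_class_cell:
  assumes "c \<in> cells" and "I \<subseteq> I_set m"
  shows "(indicator (cell c) :: real ^ 'n::finite \<Rightarrow> complex) \<in> H_class"
  using H_class_cells[of "{c}" m "\<lambda>_. 1"] assms by simp

text \<open>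
  Linearity holds almost everywhere for each pair of functions, so it extends to one finite sum at
  a time; the exceptional set depends on the coefficients \<open>z\<close>. This is another reason for using
  finitely many points of the boundary lines.
\<close>
lemma linear_sum_cells:
  fixes T :: "(real ^ 'n::finite \<Rightarrow> complex) \<Rightarrow> int \<Rightarrow> real ^ 'n \<Rightarrow> complex"
  assumes T: "linear_seq_operator T" and \<Gamma>: "\<Gamma> \<subseteq> cells" and I: "I \<subseteq> I_set m"
  shows "AE x in lebesgue. \<forall>j. T (\<lambda>y. \<Sum>c\<in>\<Gamma>. z c * indicator (cell c) y) j x = (\<Sum>c\<in>\<Gamma>. z c * T (indicator (cell c)) j x)"
proof -
  have lin: "AE x in lebesgue. T (\<lambda>y. a * f y + b * g y) j x = a * T f j x + b * T g j x"
    if "f \<in> H_class" "g \<in> H_class" for f g a b j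
    using T that unfolding linear_seq_operator_def by blast
  have "finite \<Gamma>" using \<Gamma> finite_cells finite_subset by blast
  then have "AE x in lebesgue. T (\<lambda>y. \<Sum>c\<in>\<Gamma>. z c * indicator (cell c) y) j x = (\<Sum>c\<in>\<Gamma>. z c * T (indicator (cell c)) j x)" for j
    using \<Gamma>
  proof (induction \<Gamma> rule: finite_induct)
    case empty
    have "(\<lambda>y. 0) \<in> (H_class :: (real ^ 'n \<Rightarrow> complex) set)" using H_class_cells[of "{}" m] I by simp
    from lin[OF this this, of 0 0 j] show ?case by simp
  next
    case (insert c \<Gamma>)
    have 1: "(indicator (cell c) :: real ^ 'n \<Rightarrow> complex) \<in> H_class"
      using insert I by (intro H_class_cell) auto
    have 2: "(\<lambda>y. \<Sum>c\<in>\<Gamma>. z c * indicator (cell c) y :: complex) \<in> H_class"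
      using insert I by (intro H_class_cells) auto
    have "\<Gamma> \<subseteq> cells" using insert by auto
    from lin[OF 1 2, of "z c" 1 j] insert.IH[OF this] show ?case
      by eventually_elim (simp only: sum.insert[OF insert.hyps] mult_1)
  qed
  then show ?thesis unfolding AE_all_countable ..
qed

text \<open>
  The interpolation argument for an intermediate \<open>\<theta>\<close>, as outlined at the beginning.
\<close>
lemma interpolation_on_grid:
  fixes T :: "(real ^ 'n::{finite,linorder} \<Rightarrow> complex) \<Rightarrow> int \<Rightarrow> real ^ 'n::{finite,linorder} \<Rightarrow> complex"
  assumes \<theta>: "0 < \<theta>" "\<theta> < 1" and I: "I \<subseteq> I_set m" and T: "linear_seq_operator T"
    and ur: "unit_range a" "unit_range b" "unit_range a0" "unit_range b0" "unit_range a1" "unit_range b1"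
    and eq: "\<And>i. a i = (1 - \<theta>) * a0 i + \<theta> * a1 i" "\<And>i. b i = (1 - \<theta>) * b0 i + \<theta> * b1 i"
      "\<And>i. \<alpha> i = (1 - \<theta>) * \<alpha>0 i + \<theta> * \<alpha>1 i"
    and ur': "unit_range c" "unit_range d" "unit_range c0" "unit_range d0" "unit_range c1" "unit_range d1"
    and eq': "\<And>i. c i = (1 - \<theta>) * c0 i + \<theta> * c1 i" "\<And>i. d i = (1 - \<theta>) * d0 i + \<theta> * d1 i"
      "\<And>i. \<beta> i = (1 - \<theta>) * \<beta>0 i + \<theta> * \<beta>1 i"
    and M: "0 < M0" "0 < M1"
    and bound0: "\<And>f. f \<in> H_class \<Longrightarrow> mixed_norm \<alpha>0 a0 b0 (\<lambda>x. SUP j. ennreal (cmod (T f j x)))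
        \<le> ennreal M0 * mixed_norm \<beta>0 c0 d0 (\<lambda>x. ennreal (cmod (f x)))"
    and bound1: "\<And>f. f \<in> H_class \<Longrightarrow> mixed_norm \<alpha>1 a1 b1 (\<lambda>x. SUP j. ennreal (cmod (T f j x)))
        \<le> ennreal M1 * mixed_norm \<beta>1 c1 d1 (\<lambda>x. ennreal (cmod (f x)))"
    and f: "\<And>js. set js = UNIV \<Longrightarrow> grid_inv js f" "\<And>js. set js = UNIV \<Longrightarrow> grid_supp js f"
  shows "mixed_norm \<alpha> a b (\<lambda>x. SUP j. ennreal (cmod (T f j x)))
    \<le> ennreal (M0 powr (1 - \<theta>) * M1 powr \<theta>) * mixed_norm \<beta> c d (\<lambda>x. ennreal (cmod (f x)))"
proof -
  define js where "js = sorted_list_of_set (UNIV :: 'n set)"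
  have js: "set js = UNIV" "distinct js" by (simp_all add: js_def)
  define S where "S g x = (SUP j. ennreal (cmod (T g j x)))" for g x
  have T_meas: "T g j \<in> borel_measurable lebesgue" if "g \<in> H_class" for g j
    using T that unfolding linear_seq_operator_def by blast
  have S_meas: "S g \<in> borel_measurable lebesgue" if "g \<in> H_class" for g
  proof -
    note [measurable] = T_meas[OF that]
    show ?thesis unfolding S_def by measurable
  qed
  have finite_norm: "mixed_norm \<gamma> c' d' (\<lambda>x. ennreal (F x)) \<noteq> top"
    if "unit_range c'" "unit_range d'" "grid_inv js F" "grid_supp js F" for \<gamma> c' d' F
    using fold_coord_herz_grid_finite[OF that js(2)] unfolding mixed_norm_def js_def .

  have "grid_inv js (\<lambda>x. cmod (f x))" using f(1)[OF js(1)] unfolding grid_inv_def by metis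
  moreover have "grid_supp js (\<lambda>x. cmod (f x))" using f(2)[OF js(1)] unfolding grid_supp_def by simp
  ultimately have cf: "grid_inv js (\<lambda>x. cmod (f x))" "grid_supp js (\<lambda>x. cmod (f x))" .
  define n where "n = enn2real (mixed_norm \<beta> c d (\<lambda>x. ennreal (cmod (f x))))"
  have n: "mixed_norm \<beta> c d (\<lambda>x. ennreal (cmod (f x))) = ennreal n" "0 \<le> n"
    using finite_norm[OF ur'(1,2) cf] by (simp_all add: n_def less_top)
  from grid_factorization[where \<alpha> = \<beta> and ?\<alpha>0.0 = \<beta>0 and ?\<alpha>1.0 = \<beta>1, OF \<theta> ur' eq' cf norm_ge_zero js(2)] obtain u0 u1 where
    u_inv: "grid_inv js u0" "grid_inv js u1"
    and u_all: "\<forall>x. 0 \<le> u0 x \<and> 0 \<le> u1 x \<and> (u0 x = 0 \<longleftrightarrow> cmod (f x) = 0) \<and> (u1 x = 0 \<longleftrightarrow> cmod (f x) = 0) \<and>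
      u0 x powr (1 - \<theta>) * u1 x powr \<theta> = cmod (f x)"
    and u_fold: "\<forall>x. fold (coord_herz \<beta>0 c0 d0) js (\<lambda>x. ennreal (u0 x)) x \<le> fold (coord_herz \<beta> c d) js (\<lambda>x. ennreal (cmod (f x))) x"
      "\<forall>x. fold (coord_herz \<beta>1 c1 d1) js (\<lambda>x. ennreal (u1 x)) x \<le> fold (coord_herz \<beta> c d) js (\<lambda>x. ennreal (cmod (f x))) x"
    by (elim exE conjE) (rule that)
  have u: "0 \<le> u0 x" "0 \<le> u1 x" "u0 x = 0 \<longleftrightarrow> cmod (f x) = 0" "u1 x = 0 \<longleftrightarrow> cmod (f x) = 0"
      "u0 x powr (1 - \<theta>) * u1 x powr \<theta> = cmod (f x)" for x
    using u_all by blast+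
  have u_norm: "mixed_norm \<beta>0 c0 d0 (\<lambda>x. ennreal (u0 x)) \<le> ennreal n" "mixed_norm \<beta>1 c1 d1 (\<lambda>x. ennreal (u1 x)) \<le> ennreal n"
    using u_fold[THEN spec, of 0] n(1) unfolding mixed_norm_def js_def by simp_all

  define \<Gamma> where "\<Gamma> = (cells :: ('n \<Rightarrow> 'b) set)"
  have fin: "finite \<Gamma>" unfolding \<Gamma>_def by (rule finite_cells)
  define v where "v k = f (cell_point k)" for k
  \<comment> \<open>On a cell where \<open>f\<close> vanishes the coefficient \<open>w k\<close> is \<open>0\<close> and the frequency is immaterial.\<close>
  define \<Lambda> where "\<Lambda> k = (if v k = 0 then 0 else ln (u1 (cell_point k) / u0 (cell_point k)))" for k
  define w where "w k = sgn (v k) * of_real (u0 (cell_point k))" for k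
  define F where "F z = (\<lambda>x. \<Sum>k\<in>\<Gamma>. (w k * exp (of_real (\<Lambda> k) * z)) * indicator (cell k) x)" for z
  have F_H: "F z \<in> H_class" for z
    unfolding F_def \<Gamma>_def using I by (intro H_class_cells) auto
  have u_pos: "0 < u0 (cell_point k)" "0 < u1 (cell_point k)" if "v k \<noteq> 0" for k
    using u(1,3)[of "cell_point k"] u(2,4)[of "cell_point k"] that by (auto simp: v_def less_le)
  have w_\<theta>: "w k * exp (of_real (\<Lambda> k) * of_real \<theta>) = v k" for k
  proof (cases "v k = 0")
    case False
    note p = u_pos[OF False]
    have "exp (\<Lambda> k * \<theta>) = (u1 (cell_point k) / u0 (cell_point k)) powr \<theta>"
      using False p by (simp add: \<Lambda>_def powr_def mult.commute)
    then have "u0 (cell_point k) * exp (\<Lambda> k * \<theta>) = u0 (cell_point k) powr (1 - \<theta>) * u1 (cell_point k) powr \<theta>"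
      using p by (simp add: powr_divide powr_diff)
    also have "\<dots> = cmod (v k)" using u(5) by (simp add: v_def)
    finally have "w k * of_real (exp (\<Lambda> k * \<theta>)) = sgn (v k) * of_real (cmod (v k))"
      unfolding w_def mult.assoc of_real_mult[symmetric] by simp
    then show ?thesis by (simp add: sgn_div_norm scaleR_conv_of_real exp_of_real[symmetric] False)
  qed (simp add: w_def)
  have "f x = F (of_real \<theta>) x" for x
    using grid_fun_eq_sum_cells[OF f(1)[OF js(1)] f(2)[OF js(1)] js(1), of x]
    by (simp add: F_def w_\<theta> \<Gamma>_def v_def)
  then have F_\<theta>: "F (of_real \<theta>) = f" by auto
  have F_cell: "F z x = w k * exp (of_real (\<Lambda> k) * z)" if "k \<in> \<Gamma>" "x \<in> cell k" for z x k
    unfolding F_def \<Gamma>_def using that by (intro sum_over_cells) (auto simp: \<Gamma>_def)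
  have F_zero: "F z x = 0" if "\<And>k. k \<in> \<Gamma> \<Longrightarrow> x \<notin> cell k" for z x
    unfolding F_def using that by (intro sum.neutral) auto
  have u_cell: "u0 x = u0 (cell_point k)" "u1 x = u1 (cell_point k)" if "k \<in> \<Gamma>" "x \<in> cell k" for x k
    using that cell_point[of k] by (auto intro!: grid_invD[OF u_inv(1)] grid_invD[OF u_inv(2)] simp: cell_def \<Gamma>_def)
  have u_out: "u0 x = 0" "u1 x = 0" if "\<And>k. k \<in> \<Gamma> \<Longrightarrow> x \<notin> cell k" for x
    using F_zero[OF that, of "of_real \<theta>"] u(3,4)[of x] by (auto simp: F_\<theta>)
  have cmod_w: "cmod (w k) = u0 (cell_point k)" for k
    using u(1,3)[of "cell_point k"] by (auto simp: w_def norm_mult norm_sgn v_def)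
  have F_0: "cmod (F (Complex 0 y) x) = u0 x" for y x
  proof (cases "\<exists>k\<in>\<Gamma>. x \<in> cell k")
    case True
    then obtain k where k: "k \<in> \<Gamma>" "x \<in> cell k" by blast
    then show ?thesis by (simp add: F_cell[OF k] norm_mult cmod_w u_cell(1)[OF k])
  next
    case False
    then show ?thesis using F_zero[of x] u_out[of x] by auto
  qed
  have F_1: "cmod (F (Complex 1 y) x) = u1 x" for y x
  proof (cases "\<exists>k\<in>\<Gamma>. x \<in> cell k")
    case True
    then obtain k where k: "k \<in> \<Gamma>" "x \<in> cell k" by blast
    have "u0 (cell_point k) * exp (\<Lambda> k) = u1 (cell_point k)"
    proof (cases "v k = 0")
      case True
      then show ?thesis using u(3,4)[of "cell_point k"] by (simp add: v_def)
    next
      case False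
      then show ?thesis using u_pos[OF False] by (simp add: \<Lambda>_def)
    qed
    then show ?thesis by (simp add: F_cell[OF k] norm_mult cmod_w u_cell(2)[OF k])
  next
    case False
    then show ?thesis using F_zero[of x] u_out[of x] by auto
  qed
  define h where "h k j x = w k * T (indicator (cell k)) j x" for k j x
  define H where "H k x = (SUP j. ennreal (cmod (h k j x)))" for k x
  have cell_H: "(indicator (cell k) :: (real, 'n) vec \<Rightarrow> complex) \<in> H_class" if "k \<in> \<Gamma>" for k
    using that I by (intro H_class_cell) (auto simp: \<Gamma>_def)
  have H_meas: "H k \<in> borel_measurable lebesgue" if "k \<in> \<Gamma>" for k
  proof -
    note [measurable] = T_meas[OF cell_H[OF that]]
    show ?thesis unfolding H_def h_def by measurable
  qed
  have T_F: "AE x in lebesgue. \<forall>j. T (F z) j x = (\<Sum>k\<in>\<Gamma>. h k j x * exp (of_real (\<Lambda> k) * z))" for z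
  proof -
    have "AE x in lebesgue. \<forall>j. T (F z) j x = (\<Sum>k\<in>\<Gamma>. (w k * exp (of_real (\<Lambda> k) * z)) * T (indicator (cell k)) j x)"
      unfolding F_def using I by (intro linear_sum_cells[OF T]) (auto simp: \<Gamma>_def)
    then show ?thesis by (simp add: h_def mult_ac)
  qed
  have H_norm: "mixed_norm \<gamma> a' b' (H k) \<noteq> top"
    if k: "k \<in> \<Gamma>" and ab: "unit_range a'" "unit_range b'" "unit_range c'" "unit_range d'"
      and bound: "\<And>f. f \<in> H_class \<Longrightarrow> mixed_norm \<gamma> a' b' (\<lambda>x. SUP j. ennreal (cmod (T f j x)))
        \<le> ennreal M' * mixed_norm \<delta> c' d' (\<lambda>x. ennreal (cmod (f x)))"
    for \<gamma> a' b' \<delta> c' d' k and M' :: real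
  proof -
    have "mixed_norm \<gamma> a' b' (H k) \<le> ennreal (cmod (w k)) * mixed_norm \<gamma> a' b' (S (indicator (cell k)))"
    proof (intro mixed_norm_cmult ab H_meas S_meas cell_H k AE_I2)
      fix x
      show "H k x \<le> ennreal (cmod (w k)) * S (indicator (cell k)) x"
        unfolding H_def S_def h_def
        by (auto simp: norm_mult ennreal_mult intro!: SUP_least mult_left_mono SUP_upper)
    qed
    also have "\<dots> \<le> ennreal (cmod (w k)) * (ennreal M' * mixed_norm \<delta> c' d' (\<lambda>x. ennreal (cmod (indicator (cell k) x :: complex))))"
      unfolding S_def by (intro mult_left_mono bound[OF cell_H[OF k]]) auto
    finally have le: "mixed_norm \<gamma> a' b' (H k)
        \<le> ennreal (cmod (w k)) * (ennreal M' * mixed_norm \<delta> c' d' (\<lambda>x. ennreal (cmod (indicator (cell k) x :: complex))))" .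
    have "mixed_norm \<delta> c' d' (\<lambda>x. ennreal (cmod (indicator (cell k) x :: complex))) < top"
    proof -
      have "grid_inv js (\<lambda>x. cmod (indicator (cell k) x :: complex))"
        using js(1) unfolding grid_inv_def by (auto simp: cell_def indicator_def)
      moreover have "grid_supp js (\<lambda>x. cmod (indicator (cell k) x :: complex))"
        using cell_in_I[of k] k unfolding grid_supp_def by (auto simp: \<Gamma>_def indicator_def split: if_splits)
      ultimately show ?thesis using finite_norm[OF ab(3,4)] by (simp add: less_top)
    qed
    then have "ennreal (cmod (w k)) * (ennreal M' * mixed_norm \<delta> c' d' (\<lambda>x. ennreal (cmod (indicator (cell k) x :: complex)))) < top"
      by (simp add: ennreal_mult_less_top)
    with le show ?thesis by auto
  qed
  \<comment> \<open>The error terms: finite constants that do not depend on \<open>e\<close>.\<close>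
  define C0 where "C0 = enn2real (\<Sum>k\<in>\<Gamma>. mixed_norm \<alpha>0 a0 b0 (H k))"
  define C1 where "C1 = enn2real (\<Sum>k\<in>\<Gamma>. mixed_norm \<alpha>1 a1 b1 (H k))"
  have C0: "(\<Sum>k\<in>\<Gamma>. mixed_norm \<alpha>0 a0 b0 (H k)) = ennreal C0" "0 \<le> C0"
    using H_norm[OF _ ur(3,4) ur'(3,4) bound0] fin by (simp_all add: C0_def less_top)
  have C1: "(\<Sum>k\<in>\<Gamma>. mixed_norm \<alpha>1 a1 b1 (H k)) = ennreal C1" "0 \<le> C1"
    using H_norm[OF _ ur(5,6) ur'(5,6) bound1] fin by (simp_all add: C1_def less_top)
  define G where "G e N wt \<tau> s = (\<lambda>x. (\<Sum>l<N. ennreal (wt l) * S (F (Complex s (\<tau> l))) x) + (\<Sum>k\<in>\<Gamma>. ennreal e * H k x))"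
    for e and N :: nat and wt \<tau> :: "nat \<Rightarrow> real" and s
  have G_meas: "G e N wt \<tau> s \<in> borel_measurable lebesgue" for e N wt \<tau> s
    unfolding G_def using S_meas[OF F_H] H_meas by (intro borel_measurable_add borel_measurable_sum borel_measurable_times_ennreal) auto
  have G_norm: "mixed_norm \<gamma> a' b' (G e N wt \<tau> s) \<le> ennreal (M' * n + e * C)"
    if ab: "unit_range a'" "unit_range b'" and e: "0 < e" and wt: "\<forall>l<N. 0 \<le> wt l" "(\<Sum>l<N. wt l) \<le> 1"
      and C: "(\<Sum>k\<in>\<Gamma>. mixed_norm \<gamma> a' b' (H k)) = ennreal C" "0 \<le> C" and M': "0 < M'"
      and bound: "\<And>f. f \<in> H_class \<Longrightarrow> mixed_norm \<gamma> a' b' (\<lambda>x. SUP j. ennreal (cmod (T f j x)))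
        \<le> ennreal M' * mixed_norm \<delta> c' d' (\<lambda>x. ennreal (cmod (f x)))"
      and Fn: "\<And>y. mixed_norm \<delta> c' d' (\<lambda>x. ennreal (cmod (F (Complex s y) x))) \<le> ennreal n"
    for \<gamma> a' b' e N wt \<tau> s C M' \<delta> c' d'
  proof -
    have SF: "mixed_norm \<gamma> a' b' (S (F (Complex s y))) \<le> ennreal (M' * n)" for y
    proof -
      have "mixed_norm \<gamma> a' b' (S (F (Complex s y))) \<le> ennreal M' * mixed_norm \<delta> c' d' (\<lambda>x. ennreal (cmod (F (Complex s y) x)))"
        unfolding S_def by (rule bound[OF F_H])
      also have "\<dots> \<le> ennreal M' * ennreal n" by (intro mult_left_mono Fn) auto
      also have "\<dots> = ennreal (M' * n)" using M' n by (simp add: ennreal_mult)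
      finally show ?thesis .
    qed
    have "mixed_norm \<gamma> a' b' (G e N wt \<tau> s)
        \<le> mixed_norm \<gamma> a' b' (\<lambda>x. \<Sum>l<N. ennreal (wt l) * S (F (Complex s (\<tau> l))) x)
        + mixed_norm \<gamma> a' b' (\<lambda>x. \<Sum>k\<in>\<Gamma>. ennreal e * H k x)"
      unfolding G_def using S_meas[OF F_H] H_meas ab
      by (intro mixed_norm_triangle borel_measurable_sum borel_measurable_times_ennreal) auto
    also have "\<dots> \<le> (\<Sum>l<N. ennreal (wt l) * mixed_norm \<gamma> a' b' (S (F (Complex s (\<tau> l)))))
        + (\<Sum>k\<in>\<Gamma>. ennreal e * mixed_norm \<gamma> a' b' (H k))"
      using S_meas[OF F_H] H_meas ab fin by (intro add_mono mixed_norm_sum) auto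
    also have "\<dots> \<le> (\<Sum>l<N. ennreal (wt l) * ennreal (M' * n)) + ennreal e * ennreal C"
      unfolding sum_distrib_left[symmetric] C(1) using SF by (intro add_mono sum_mono mult_left_mono) auto
    also have "(\<Sum>l<N. ennreal (wt l) * ennreal (M' * n)) = ennreal ((\<Sum>l<N. wt l) * (M' * n))"
    proof -
      have "(\<Sum>l<N. ennreal (wt l)) = ennreal (\<Sum>l<N. wt l)" using wt by (intro sum_ennreal) auto
      moreover have "0 \<le> (\<Sum>l<N. wt l)" using wt by (intro sum_nonneg) auto
      ultimately show ?thesis
        using n M' by (simp add: sum_distrib_right[symmetric] ennreal_mult)
    qed
    also have "\<dots> + ennreal e * ennreal C \<le> ennreal (1 * (M' * n)) + ennreal e * ennreal C"
      using wt n M' by (intro add_mono ennreal_leI mult_right_mono) auto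
    also have "\<dots> = ennreal (M' * n + e * C)"
      using e C M' n by (simp add: ennreal_mult ennreal_plus)
    finally show ?thesis .
  qed
  have key: "mixed_norm \<alpha> a b (S f) \<le> ennreal ((M0 * n + e * C0) powr (1 - \<theta>) * (M1 * n + e * C1) powr \<theta>)"
    if e: "0 < e" for e
  proof -
    from exponential_sum_interpolation[OF \<theta> fin e, of \<Lambda>] obtain N0 :: nat and w0 \<tau>0 and N1 :: nat and w1 \<tau>1 where
      w0: "\<forall>l<N0. 0 \<le> w0 l" "(\<Sum>l<N0. w0 l) \<le> 1" and w1: "\<forall>l<N1. 0 \<le> w1 l" "(\<Sum>l<N1. w1 l) \<le> 1"
      and scalar: "\<And>h. cmod (\<Sum>k\<in>\<Gamma>. h k * exp (of_real (\<Lambda> k) * of_real \<theta>))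
      \<le> ((\<Sum>l<N0. w0 l * cmod (\<Sum>k\<in>\<Gamma>. h k * exp (of_real (\<Lambda> k) * Complex 0 (\<tau>0 l)))) + e * (\<Sum>k\<in>\<Gamma>. cmod (h k))) powr (1 - \<theta>)
      * ((\<Sum>l<N1. w1 l * cmod (\<Sum>k\<in>\<Gamma>. h k * exp (of_real (\<Lambda> k) * Complex 1 (\<tau>1 l)))) + e * (\<Sum>k\<in>\<Gamma>. cmod (h k))) powr \<theta>"
      by blast
    have "AE x in lebesgue. \<forall>l. \<forall>j. T (F (Complex 0 (\<tau>0 l))) j x = (\<Sum>k\<in>\<Gamma>. h k j x * exp (of_real (\<Lambda> k) * Complex 0 (\<tau>0 l)))"
      "AE x in lebesgue. \<forall>l. \<forall>j. T (F (Complex 1 (\<tau>1 l))) j x = (\<Sum>k\<in>\<Gamma>. h k j x * exp (of_real (\<Lambda> k) * Complex 1 (\<tau>1 l)))"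
      unfolding AE_all_countable[of "\<lambda>l x. \<forall>j. _ l j x"] using T_F by auto
    with T_F[of "of_real \<theta>"]
    have "AE x in lebesgue. S f x \<le> enn_geo \<theta> (G e N0 w0 \<tau>0 0 x) (G e N1 w1 \<tau>1 1 x)"
    proof eventually_elim
      case (elim x)
      have G_ge: "ennreal ((\<Sum>l<N. wt l * cmod (T (F (Complex s (\<tau> l))) j x)) + e * (\<Sum>k\<in>\<Gamma>. cmod (h k j x))) \<le> G e N wt \<tau> s x"
        if "\<forall>l<N. 0 \<le> wt l" for N wt \<tau> s j
      proof -
        have "ennreal ((\<Sum>l<N. wt l * cmod (T (F (Complex s (\<tau> l))) j x)) + e * (\<Sum>k\<in>\<Gamma>. cmod (h k j x)))
          = (\<Sum>l<N. ennreal (wt l) * ennreal (cmod (T (F (Complex s (\<tau> l))) j x))) + (\<Sum>k\<in>\<Gamma>. ennreal e * ennreal (cmod (h k j x)))"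
        proof -
          have "(\<Sum>l<N. ennreal (wt l) * ennreal (cmod (T (F (Complex s (\<tau> l))) j x)))
              = ennreal (\<Sum>l<N. wt l * cmod (T (F (Complex s (\<tau> l))) j x))"
            using that by (subst sum_ennreal[symmetric]) (auto simp: ennreal_mult intro!: sum.cong)
          moreover have "(\<Sum>k\<in>\<Gamma>. ennreal e * ennreal (cmod (h k j x))) = ennreal (e * (\<Sum>k\<in>\<Gamma>. cmod (h k j x)))"
            using e by (simp add: sum_distrib_left[symmetric] ennreal_mult sum_nonneg)
          moreover have "0 \<le> (\<Sum>l<N. wt l * cmod (T (F (Complex s (\<tau> l))) j x))" "0 \<le> e * (\<Sum>k\<in>\<Gamma>. cmod (h k j x))"
            using that e by (auto intro!: sum_nonneg mult_nonneg_nonneg)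
          ultimately show ?thesis by (simp add: ennreal_plus)
        qed
        also have "\<dots> \<le> G e N wt \<tau> s x"
          unfolding G_def S_def H_def by (intro add_mono sum_mono mult_left_mono SUP_upper) auto
        finally show ?thesis .
      qed
      have "ennreal (cmod (T f j x)) \<le> enn_geo \<theta> (G e N0 w0 \<tau>0 0 x) (G e N1 w1 \<tau>1 1 x)" for j
      proof -
        let ?X = "(\<Sum>l<N0. w0 l * cmod (T (F (Complex 0 (\<tau>0 l))) j x)) + e * (\<Sum>k\<in>\<Gamma>. cmod (h k j x))"
        let ?Y = "(\<Sum>l<N1. w1 l * cmod (T (F (Complex 1 (\<tau>1 l))) j x)) + e * (\<Sum>k\<in>\<Gamma>. cmod (h k j x))"
        have "cmod (T f j x) \<le> ?X powr (1 - \<theta>) * ?Y powr \<theta>"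
          using scalar[of "\<lambda>k. h k j x"] elim by (simp add: F_\<theta>)
        then have "ennreal (cmod (T f j x)) \<le> ennreal (?X powr (1 - \<theta>) * ?Y powr \<theta>)" by (rule ennreal_leI)
        also have "\<dots> = enn_geo \<theta> (ennreal ?X) (ennreal ?Y)"
          using w0 w1 e by (intro enn_geo_ennreal[symmetric] add_nonneg_nonneg sum_nonneg mult_nonneg_nonneg) auto
        also have "\<dots> \<le> enn_geo \<theta> (G e N0 w0 \<tau>0 0 x) (G e N1 w1 \<tau>1 1 x)"
          using \<theta> by (intro enn_geo_mono G_ge w0 w1) auto
        finally show ?thesis .
      qed
      then show ?case unfolding S_def by (intro SUP_least)
    qed
    then have "mixed_norm \<alpha> a b (S f) \<le> enn_geo \<theta> (mixed_norm \<alpha>0 a0 b0 (G e N0 w0 \<tau>0 0)) (mixed_norm \<alpha>1 a1 b1 (G e N1 w1 \<tau>1 1))"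
      using S_meas[OF F_H, of "of_real \<theta>"] G_meas ur eq unfolding F_\<theta> by (intro mixed_norm_holder \<theta>) auto
    also have "\<dots> \<le> enn_geo \<theta> (ennreal (M0 * n + e * C0)) (ennreal (M1 * n + e * C1))"
    proof (intro enn_geo_mono)
      show "mixed_norm \<alpha>0 a0 b0 (G e N0 w0 \<tau>0 0) \<le> ennreal (M0 * n + e * C0)"
        using u_norm(1) by (intro G_norm[OF ur(3,4) e w0 C0 M(1) bound0]) (simp_all add: F_0)
      show "mixed_norm \<alpha>1 a1 b1 (G e N1 w1 \<tau>1 1) \<le> ennreal (M1 * n + e * C1)"
        using u_norm(2) by (intro G_norm[OF ur(5,6) e w1 C1 M(2) bound1]) (simp_all add: F_1)
    qed (use \<theta> in auto)
    also have "\<dots> = ennreal ((M0 * n + e * C0) powr (1 - \<theta>) * (M1 * n + e * C1) powr \<theta>)"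
      using M n C0 C1 e by (intro enn_geo_ennreal) auto
    finally show ?thesis .
  qed
  have "((\<lambda>e. ennreal ((M0 * n + e * C0) powr (1 - \<theta>) * (M1 * n + e * C1) powr \<theta>))
      \<longlongrightarrow> ennreal ((M0 * n + 0 * C0) powr (1 - \<theta>) * (M1 * n + 0 * C1) powr \<theta>)) (at_right 0)"
  proof (intro tendsto_ennrealI tendsto_mult)
    have ev: "eventually (\<lambda>e :: real. 0 < e) (at_right 0)" by (rule eventually_at_right_less)
    show "((\<lambda>e. (M0 * n + e * C0) powr (1 - \<theta>)) \<longlongrightarrow> (M0 * n + 0 * C0) powr (1 - \<theta>)) (at_right 0)"
      using \<theta> M n C0 by (intro tendsto_powr' tendsto_intros) (auto intro!: eventually_mono[OF ev])
    show "((\<lambda>e. (M1 * n + e * C1) powr \<theta>) \<longlongrightarrow> (M1 * n + 0 * C1) powr \<theta>) (at_right 0)"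
      using \<theta> M n C1 by (intro tendsto_powr' tendsto_intros) (auto intro!: eventually_mono[OF ev])
  qed
  then have "mixed_norm \<alpha> a b (S f) \<le> ennreal ((M0 * n + 0 * C0) powr (1 - \<theta>) * (M1 * n + 0 * C1) powr \<theta>)"
    by (rule tendsto_lowerbound) (auto intro!: eventually_mono[OF eventually_at_right_less] key)
  also have "(M0 * n + 0 * C0) powr (1 - \<theta>) * (M1 * n + 0 * C1) powr \<theta> = M0 powr (1 - \<theta>) * M1 powr \<theta> * n"
  proof -
    have "n powr (1 - \<theta>) * n powr \<theta> = n" using n by (cases "n = 0") (auto simp flip: powr_add)
    then show ?thesis by (simp add: powr_mult mult_ac)
  qed
  also have "ennreal (M0 powr (1 - \<theta>) * M1 powr \<theta> * n) = ennreal (M0 powr (1 - \<theta>) * M1 powr \<theta>) * ennreal n"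
    using n by (simp add: ennreal_mult)
  finally show ?thesis by (simp add: n S_def[abs_def])
qed

end

theorem theorem3p6:
  fixes \<alpha>0 \<alpha>1 \<beta>0 \<beta>1 \<alpha> \<beta> :: "real ^ 'n::{finite,linorder}"
    and p0 q0 s0 t0 p1 q1 s1 t1 p q s t :: "ennreal ^ 'n::{finite,linorder}"
    and \<theta> M0 M1 :: real
    and T :: "(real ^ 'n::{finite,linorder} \<Rightarrow> complex) \<Rightarrow> int \<Rightarrow> real ^ 'n::{finite,linorder} \<Rightarrow> complex"
  assumes exponents0: "\<And>i. 1 \<le> p0 $ i \<and> 1 \<le> q0 $ i \<and> 1 \<le> s0 $ i \<and> 1 \<le> t0 $ i"
    and exponents1: "\<And>i. 1 \<le> p1 $ i \<and> 1 \<le> q1 $ i \<and> 1 \<le> s1 $ i \<and> 1 \<le> t1 $ i"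
    and exponents: "\<And>i. 1 \<le> p $ i \<and> 1 \<le> q $ i \<and> 1 \<le> s $ i \<and> 1 \<le> t $ i"
    and theta: "0 \<le> \<theta>" "\<theta> \<le> 1"
    and p: "\<And>i. 1 / p $ i = ennreal (1 - \<theta>) / p0 $ i + ennreal \<theta> / p1 $ i"
    and q: "\<And>i. 1 / q $ i = ennreal (1 - \<theta>) / q0 $ i + ennreal \<theta> / q1 $ i"
    and s: "\<And>i. 1 / s $ i = ennreal (1 - \<theta>) / s0 $ i + ennreal \<theta> / s1 $ i"
    and t: "\<And>i. 1 / t $ i = ennreal (1 - \<theta>) / t0 $ i + ennreal \<theta> / t1 $ i"
    and alpha: "\<alpha> = (1 - \<theta>) *\<^sub>R \<alpha>0 + \<theta> *\<^sub>R \<alpha>1"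
    and beta: "\<beta> = (1 - \<theta>) *\<^sub>R \<beta>0 + \<theta> *\<^sub>R \<beta>1"
    and T: "linear_seq_operator T"
    and M: "0 < M0" "0 < M1"
    and bound0: "\<And>f. f \<in> H_class \<Longrightarrow>
        E_linf_norm \<alpha>0 p0 q0 (T f) \<le> ennreal M0 * E_norm \<beta>0 s0 t0 f"
    and bound1: "\<And>f. f \<in> H_class \<Longrightarrow>
        E_linf_norm \<alpha>1 p1 q1 (T f) \<le> ennreal M1 * E_norm \<beta>1 s1 t1 f"
  shows "\<forall>f\<in>H_class.
        E_linf_norm \<alpha> p q (T f) \<le> ennreal (M0 powr (1 - \<theta>) * M1 powr \<theta>) * E_norm \<beta> s t f"
proof -
  have norm_eq: "E_linf_norm \<gamma> r r' g = mixed_norm (($) \<gamma>) (\<lambda>i. recip (r $ i)) (\<lambda>i. recip (r' $ i)) (\<lambda>x. SUP j. ennreal (cmod (g j x)))"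
    "E_norm \<gamma> r r' h = mixed_norm (($) \<gamma>) (\<lambda>i. recip (r $ i)) (\<lambda>i. recip (r' $ i)) (\<lambda>x. ennreal (cmod (h x)))"
    if "\<And>i. 1 \<le> r $ i" "\<And>i. 1 \<le> r' $ i" for \<gamma> :: "(real, 'n) vec" and r r' :: "(ennreal, 'n) vec" and g h
    using that by (simp_all add: E_linf_norm_def E_norm_def mixed_herz_norm_eq)
  have ur: "unit_range (\<lambda>i. recip (r $ i))" if "\<And>i. 1 \<le> r $ i" for r :: "(ennreal, 'n) vec"
    using that recip_bounds by (simp add: unit_range_def)
  have eqs: "recip (p $ i) = (1 - \<theta>) * recip (p0 $ i) + \<theta> * recip (p1 $ i)"
    "recip (q $ i) = (1 - \<theta>) * recip (q0 $ i) + \<theta> * recip (q1 $ i)"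
    "recip (s $ i) = (1 - \<theta>) * recip (s0 $ i) + \<theta> * recip (s1 $ i)"
    "recip (t $ i) = (1 - \<theta>) * recip (t0 $ i) + \<theta> * recip (t1 $ i)"
    "\<alpha> $ i = (1 - \<theta>) * \<alpha>0 $ i + \<theta> * \<alpha>1 $ i" "\<beta> $ i = (1 - \<theta>) * \<beta>0 $ i + \<theta> * \<beta>1 $ i" for i
    using exponents0 exponents1 theta by (auto intro!: recip_interpolate p q s t simp: alpha beta)
  have ge: "\<And>i. 1 \<le> p $ i" "\<And>i. 1 \<le> q $ i" "\<And>i. 1 \<le> s $ i" "\<And>i. 1 \<le> t $ i"
    "\<And>i. 1 \<le> p0 $ i" "\<And>i. 1 \<le> q0 $ i" "\<And>i. 1 \<le> s0 $ i" "\<And>i. 1 \<le> t0 $ i"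
    "\<And>i. 1 \<le> p1 $ i" "\<And>i. 1 \<le> q1 $ i" "\<And>i. 1 \<le> s1 $ i" "\<And>i. 1 \<le> t1 $ i"
    using exponents exponents0 exponents1 by auto
  show ?thesis
  proof
    fix f :: "(real, 'n) vec \<Rightarrow> complex" assume f: "f \<in> H_class"
    consider "\<theta> = 0" | "\<theta> = 1" | "0 < \<theta>" "\<theta> < 1" using theta by linarith
    then show "E_linf_norm \<alpha> p q (T f) \<le> ennreal (M0 powr (1 - \<theta>) * M1 powr \<theta>) * E_norm \<beta> s t f"
    proof cases
      case 1
      have "\<alpha> = \<alpha>0" "\<beta> = \<beta>0" using alpha beta 1 by auto
      then show ?thesis using bound0[OF f] M 1 by (simp add: norm_eq ge eqs)
    next
      case 2
      have "\<alpha> = \<alpha>1" "\<beta> = \<beta>1" using alpha beta 2 by auto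
      then show ?thesis using bound1[OF f] M 2 by (simp add: norm_eq ge eqs)
    next
      case 3
      from H_class_grid[OF f] obtain \<sigma> :: "real \<Rightarrow> (nat \<times> 'n + int) set" and m where
        grid: "dyadic_grid \<sigma> {1 - int m..int m}" and
        fg: "\<And>js. set js = UNIV \<Longrightarrow> dyadic_grid.grid_inv \<sigma> js f"
          "\<And>js. set js = UNIV \<Longrightarrow> dyadic_grid.grid_supp {1 - int m..int m} js f"
        by blast
      interpret dyadic_grid \<sigma> "{1 - int m..int m}" by (rule grid)
      have I: "I \<subseteq> I_set m" unfolding I_def I_set_eq ..
      show ?thesis
        unfolding norm_eq[OF ge(1,2)] norm_eq[OF ge(3,4)]
        using bound0 bound1 ge
        by (intro interpolation_on_grid[OF 3 I T _ _ _ _ _ _ eqs(1,2,5) _ _ _ _ _ _ eqs(3,4,6) M _ _ fg] ur)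
           (simp_all add: norm_eq)
    qed
  qed
qed

end
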